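(* Let $\widehat{A}=\widehat{V}/\widehat{L}$ and $A=V/L$ be (complex) Abelian varieties with complex structures $\widehat{J}$ on $\widehat{V}$ and $J$ on $V$, and let $\pi:\widehat{A}\rightarrow A$ be a surjective homomorphism of Abelian varieties. Let $\widehat{\omega}$ be a fixed form in $H^{1,1}(\widehat{A},\mathbb{Q})$. Let $N=\dim(\widehat{A})$ and $n=\dim(A)$ (complex dimensions), and let $q$ be any integer with $1\leq q\leq n$ and $N-q-1\geq 0$. 1) If $\widehat{\omega}(u,\widehat{J}u)\neq 0$ for all $0\neq u\in H_1(\widehat{A},\mathbb{R})=\widehat{V}$, then $$\dim_{\mathbb{Q}}\big(\pi_*(\widehat{\omega}^{N-q-1}\wedge H^{1,1}(\widehat{A},\mathbb{Q}))\big)\leq \dim_{\mathbb{Q}} H^{1,1}(A,\mathbb{Q}).$$ 2) For any $\widehat{\omega}\in H^{1,1}(\widehat{A},\mathbb{Q})$, $$\pi_*(\widehat{\omega}^{N-q-1}\wedge H^{1,1}(\widehat{A},\mathbb{Q}))\subset \mathbb{R}\otimes_{\mathbb{Z}}\bigwedge^{n-q}H^{1,1}(A,\mathbb{Q}).$$ In particular, if $\dim_{\mathbb{Q}} H^{n-q,n-q}(A,\mathbb{Q})>\dim_{\mathbb{Q}}\bigwedge^{n-q}H^{1,1}(A,\mathbb{Q})$, then the map $$\pi_*(\widehat{\omega}^{N-q-1}\wedge\,\cdot\,):H^{1,1}(\widehat{A},\mathbb{Q})\rightarrow H^{n-q,n-q}(A,\mathbb{Q})$$ is not surjective.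
   Context: An Abelian variety $A=V/L$ of dimension $n$ is given by a real vector space $V$ of dimension $2n$ with a complex structure $J:V\to V$, $J^2=-1$, and a lattice $L\subset V$ of rank $2n$, such that there is an alternating bilinear form $E:V\times V\to\mathbb{R}$ with $E(Jx,Jy)=E(x,y)$, $E(x,Jy)$ symmetric and positive definite, and $E(L,L)\subset\mathbb{Z}$. A homomorphism of Abelian varieties $\widehat{V}/\widehat{L}\to V/L$ is a holomorphic group homomorphism; it is induced by a $\mathbb{C}$-linear map $\widehat{V}\to V$ sending $\widehat{L}$ into $L$. For a projective manifold $X$, $H^{k,k}(X,\mathbb{Q})=H^{2k}(X,\mathbb{Q})\cap H^{k,k}(X)$. Cohomology classes on an Abelian variety are identified with translation-invariant differential forms. In particular $\widehat{\omega}\in H^{1,1}(\widehat{A},\mathbb{Q})$ is identified with an alternating real bilinear form on $\widehat{V}=H_1(\widehat{A},\mathbb{R})$, rational on $\widehat{L}$ and satisfying $\widehat{\omega}(\widehat{J}x,\widehat{J}y)=\widehat{\omega}(x,y)$; the value $\widehat{\omega}(u,\widehat{J}u)$ is taken in this sense. Powers of $\widehat{\omega}$ are with respect to the wedge (cup) product, and $\widehat{\omega}^{0}=1$. $\pi_*:H^{k}(\widehat{A},\mathbb{R})\to H^{k-2(N-n)}(A,\mathbb{R})$ denotes the pushforward (Gysin map), i.e. the Poincaré dual of the pushforward on homology, characterized by $\int_A\pi_*(\beta)\wedge u=\int_{\widehat{A}}\beta\wedge\pi^*(u)$ for all $u$ of complementary degree. It maps $H^{N-q,N-q}(\widehat{A},\mathbb{Q})$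 to $H^{n-q,n-q}(A,\mathbb{Q})$. $\widehat{\omega}^{N-q-1}\wedge H^{1,1}(\widehat{A},\mathbb{Q})$ denotes the set of all $\widehat{\omega}^{N-q-1}\wedge D$ with $D\in H^{1,1}(\widehat{A},\mathbb{Q})$. $\bigwedge^{m}H^{1,1}(A,\mathbb{Q})$ denotes the $\mathbb{Q}$-subspace of $H^{m,m}(A,\mathbb{Q})$ spanned by all wedge (cup) products of $m$ elements of $H^{1,1}(A,\mathbb{Q})$ (for $m=0$ it is $\mathbb{Q}\cdot 1=H^{0,0}(A,\mathbb{Q})$), and $\mathbb{R}\otimes_{\mathbb{Z}}\bigwedge^{m}H^{1,1}(A,\mathbb{Q})$ is regarded as its real span in $H^{2m}(A,\mathbb{R})$. *)

theory Defs
  imports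
    "HOL-Analysis.Analysis"
    "HOL-Combinatorics.Permutations"
    "HOL-Library.Function_Algebras"
begin

definition lattice_basis :: "nat \<Rightarrow> 'v::real_vector set \<Rightarrow> (nat \<Rightarrow> 'v) \<Rightarrow> bool" where
  "lattice_basis r L b \<longleftrightarrow>
     inj_on b {..<r} \<and> independent (b ` {..<r}) \<and>
     L = {\<Sum>i<r. of_int (c i) *\<^sub>R b i |c :: nat \<Rightarrow> int. True}"

definition is_lattice :: "nat \<Rightarrow> 'v::real_vector set \<Rightarrow> bool" where
  "is_lattice r L \<longleftrightarrow> (\<exists>b. lattice_basis r L b)"

definition complex_structure :: "('v::real_vector \<Rightarrow> 'v) \<Rightarrow> bool" where
  "complex_structure J \<longleftrightarrow> linear J \<and> (\<forall>x. J (J x) = - x)"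

definition polarization ::
    "('v::real_vector \<Rightarrow> 'v) \<Rightarrow> 'v set \<Rightarrow> ('v \<Rightarrow> 'v \<Rightarrow> real) \<Rightarrow> bool" where
  "polarization J L E \<longleftrightarrow>
     bilinear E \<and> (\<forall>x. E x x = 0) \<and>
     (\<forall>x y. E (J x) (J y) = E x y) \<and>
     (\<forall>x y. E x (J y) = E y (J x)) \<and>
     (\<forall>x. x \<noteq> 0 \<longrightarrow> E x (J x) > 0) \<and>
     (\<forall>x\<in>L. \<forall>y\<in>L. E x y \<in> \<int>)"

(* V is the whole type; n is the complex dimension.  For n > 0 the condition on dim
   forces V to be finite-dimensional (dim is 0 when there is no finite basis). *)
definition abelian_variety :: "nat \<Rightarrow> ('v::real_vector \<Rightarrow> 'v) \<Rightarrow> 'v set \<Rightarrow> bool" where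
  "abelian_variety n J L \<longleftrightarrow>
     dim (UNIV :: 'v set) = 2 * n \<and> complex_structure J \<and> is_lattice (2 * n) L \<and>
     (\<exists>E. polarization J L E)"

definition torus_point :: "'v::real_vector set \<Rightarrow> 'v \<Rightarrow> 'v set" where
  "torus_point L x = (\<lambda>l. x + l) ` L"

definition torus :: "'v::real_vector set \<Rightarrow> 'v set set" where
  "torus L = range (torus_point L)"

(* h is a homomorphism V1/L1 -> V2/L2, and the C-linear map f : V1 -> V2 is its lift,
   i.e. the map induced by h on H_1( _ , R). *)
definition abelian_hom ::
    "('u::real_vector \<Rightarrow> 'u) \<Rightarrow> 'u set \<Rightarrow> ('v::real_vector \<Rightarrow> 'v) \<Rightarrow> 'v set \<Rightarrow>
     ('u set \<Rightarrow> 'v set) \<Rightarrow> ('u \<Rightarrow> 'v) \<Rightarrow> bool" where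
  "abelian_hom J1 L1 J2 L2 h f \<longleftrightarrow>
     linear f \<and> (\<forall>x. f (J1 x) = J2 (f x)) \<and> f ` L1 \<subseteq> L2 \<and>
     (\<forall>x. h (torus_point L1 x) = torus_point L2 (f x))"

(* Alternating multilinear forms.  A k-form takes a sequence of vectors as argument and
   depends only on the entries 0, ..., k - 1.  The set of real k-forms on V is the
   cohomology group H^k(V/L, R) (translation-invariant forms). *)

definition alt_forms :: "nat \<Rightarrow> ((nat \<Rightarrow> 'v::real_vector) \<Rightarrow> 'b::real_field) set" where
  "alt_forms k = {\<alpha>.
     (\<forall>x y. (\<forall>i<k. x i = y i) \<longrightarrow> \<alpha> x = \<alpha> y) \<and>
     (\<forall>i<k. \<forall>x. linear (\<lambda>v. \<alpha> (x(i := v)))) \<and>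
     (\<forall>x. \<forall>i<k. \<forall>j<k. i \<noteq> j \<and> x i = x j \<longrightarrow> \<alpha> x = 0)}"

(* The wedge product of a p-form and a q-form, normalised so that the wedge product of
   1-forms a_1, ..., a_k is det (a_i (x_j)). *)
definition wedge ::
    "nat \<Rightarrow> nat \<Rightarrow> ((nat \<Rightarrow> 'v::real_vector) \<Rightarrow> 'b::real_field) \<Rightarrow> ((nat \<Rightarrow> 'v) \<Rightarrow> 'b) \<Rightarrow>
     (nat \<Rightarrow> 'v) \<Rightarrow> 'b" where
  "wedge p q \<alpha> \<beta> = (\<lambda>x.
     (\<Sum>\<sigma> | \<sigma> permutes {..<p + q}.
        of_int (sign \<sigma>) * \<alpha> (\<lambda>i. x (\<sigma> i)) * \<beta> (\<lambda>i. x (\<sigma> (p + i)))) / (fact p * fact q))"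

(* wedge product of a list of forms that all have degree d *)
primrec wedge_list ::
    "nat \<Rightarrow> ((nat \<Rightarrow> 'v::real_vector) \<Rightarrow> 'b::real_field) list \<Rightarrow> (nat \<Rightarrow> 'v) \<Rightarrow> 'b" where
  "wedge_list d [] = (\<lambda>x. 1)"
| "wedge_list d (\<alpha> # \<alpha>s) = wedge d (d * length \<alpha>s) \<alpha> (wedge_list d \<alpha>s)"

definition wedge_power ::
    "nat \<Rightarrow> ((nat \<Rightarrow> 'v::real_vector) \<Rightarrow> 'b::real_field) \<Rightarrow> nat \<Rightarrow> (nat \<Rightarrow> 'v) \<Rightarrow> 'b" where
  "wedge_power d \<alpha> m = wedge_list d (replicate m \<alpha>)"

definition pullback ::
    "('u \<Rightarrow> 'v) \<Rightarrow> ((nat \<Rightarrow> 'v) \<Rightarrow> 'b) \<Rightarrow> (nat \<Rightarrow> 'u) \<Rightarrow> 'b" where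
  "pullback f \<alpha> = (\<lambda>x. \<alpha> (\<lambda>i. f (x i)))"

(* Function spaces over a field (used for real and complex spans of forms), and spaces of
   real-valued functions over the rationals. *)

interpretation fun_space: vector_space "\<lambda>(c::'b::field) (f::'a \<Rightarrow> 'b) x. c * f x"
  by unfold_locales (auto simp: fun_eq_iff algebra_simps)

interpretation rat_space: vector_space "\<lambda>(c::rat) (f::'a \<Rightarrow> real) x. real_of_rat c * f x"
  by unfold_locales (auto simp: fun_eq_iff algebra_simps of_rat_add of_rat_mult)

definition rational_forms :: "nat \<Rightarrow> 'v::real_vector set \<Rightarrow> ((nat \<Rightarrow> 'v) \<Rightarrow> real) set" where
  "rational_forms k L = {\<alpha> \<in> alt_forms k. \<forall>x. (\<forall>i. x i \<in> L) \<longrightarrow> \<alpha> x \<in> \<rat>}"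

definition one_form :: "('v \<Rightarrow> 'b) \<Rightarrow> (nat \<Rightarrow> 'v) \<Rightarrow> 'b" where
  "one_form l = (\<lambda>x. l (x 0))"

(* H^{p,q}: the complex span of the products of p C-linear and q C-antilinear 1-forms *)
definition type_forms ::
    "('v::real_vector \<Rightarrow> 'v) \<Rightarrow> nat \<Rightarrow> nat \<Rightarrow> ((nat \<Rightarrow> 'v) \<Rightarrow> complex) set" where
  "type_forms J p q = fun_space.span
     {wedge_list 1 (map one_form (as @ bs)) |as bs.
        length as = p \<and> length bs = q \<and>
        (\<forall>a\<in>set as. linear a \<and> (\<forall>x. a (J x) = \<i> * a x)) \<and>
        (\<forall>b\<in>set bs. linear b \<and> (\<forall>x. b (J x) = - \<i> * b x))}"

(* H^{k,k}(V/L, Q) *)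
definition hodge_classes ::
    "nat \<Rightarrow> ('v::real_vector \<Rightarrow> 'v) \<Rightarrow> 'v set \<Rightarrow> ((nat \<Rightarrow> 'v) \<Rightarrow> real) set" where
  "hodge_classes k J L =
     {\<alpha> \<in> rational_forms (2 * k) L. (\<lambda>x. complex_of_real (\<alpha> x)) \<in> type_forms J k k}"

(* the rational span of the products of m elements of H^{1,1}(V/L, Q) *)
definition divisor_products ::
    "nat \<Rightarrow> ('v::real_vector \<Rightarrow> 'v) \<Rightarrow> 'v set \<Rightarrow> ((nat \<Rightarrow> 'v) \<Rightarrow> real) set" where
  "divisor_products m J L =
     rat_space.span {wedge_list 2 Ds |Ds. length Ds = m \<and> set Ds \<subseteq> hodge_classes 1 J L}"

(* The complex orientation, in which v_0, J v_0, ..., v_{n-1}, J v_{n-1} is positive for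
   every C-basis v of V; a 2n-form that is positive on this family forces v to be a
   C-basis. *)
definition positively_oriented ::
    "nat \<Rightarrow> ('v::real_vector \<Rightarrow> 'v) \<Rightarrow> (nat \<Rightarrow> 'v) \<Rightarrow> bool" where
  "positively_oriented n J b \<longleftrightarrow>
     (\<exists>\<alpha>\<in>alt_forms (2 * n). \<exists>v.
        \<alpha> (\<lambda>i. if even i then v (i div 2) else J (v (i div 2))) > (0::real) \<and> \<alpha> b > 0)"

(* The integral over V/L of an invariant 2n-form: in the coordinates of a positively
   oriented basis b of L, V/L is the unit cube with opposite faces identified and the form
   has the constant coefficient \<alpha> b.  This number does not depend on the choice of b. *)
definition torus_integral ::
    "nat \<Rightarrow> ('v::real_vector \<Rightarrow> 'v) \<Rightarrow> 'v set \<Rightarrow> ((nat \<Rightarrow> 'v) \<Rightarrow> real) \<Rightarrow> real" where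
  "torus_integral n J L \<alpha> =
     \<alpha> (SOME b. lattice_basis (2 * n) L b \<and> positively_oriented n J b)"

(* The pushforward H^k(V1/L1, R) -> H^{k-2(N-n)}(V2/L2, R) along the homomorphism with lift
   f, where N, n are the complex dimensions of V1/L1, V2/L2.  It is meant for n \<le> N and
   2(N-n) \<le> k \<le> 2N. *)
definition gysin ::
    "nat \<Rightarrow> ('u::real_vector \<Rightarrow> 'u) \<Rightarrow> 'u set \<Rightarrow> nat \<Rightarrow> ('v::real_vector \<Rightarrow> 'v) \<Rightarrow> 'v set \<Rightarrow>
     ('u \<Rightarrow> 'v) \<Rightarrow> nat \<Rightarrow> ((nat \<Rightarrow> 'u) \<Rightarrow> real) \<Rightarrow> (nat \<Rightarrow> 'v) \<Rightarrow> real" where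
  "gysin N J1 L1 n J2 L2 f k \<beta> =
     (THE \<gamma>. \<gamma> \<in> alt_forms (k - 2 * (N - n)) \<and>
        (\<forall>u\<in>alt_forms (2 * N - k).
           torus_integral n J2 L2 (wedge (k - 2 * (N - n)) (2 * N - k) \<gamma> u) =
           torus_integral N J1 L1 (wedge k (2 * N - k) \<beta> (pullback f u))))"

(* The map D |-> pi_* (\<omega>^{N-q-1} \<and> D) on H^2. *)
definition push_map ::
    "nat \<Rightarrow> ('u::real_vector \<Rightarrow> 'u) \<Rightarrow> 'u set \<Rightarrow> nat \<Rightarrow> ('v::real_vector \<Rightarrow> 'v) \<Rightarrow> 'v set \<Rightarrow>
     ('u \<Rightarrow> 'v) \<Rightarrow> nat \<Rightarrow> ((nat \<Rightarrow> 'u) \<Rightarrow> real) \<Rightarrow> ((nat \<Rightarrow> 'u) \<Rightarrow> real) \<Rightarrow> (nat \<Rightarrow> 'v) \<Rightarrow> real" where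
  "push_map N J1 L1 n J2 L2 f q \<omega> D =
     gysin N J1 L1 n J2 L2 f (2 * (N - q))
       (wedge (2 * (N - q - 1)) 2 (wedge_power 2 \<omega> (N - q - 1)) D)"

end

theory Submission
  imports Defs
begin

text \<open>If \<open>\<omega>\<close> is definite, the kernel \<open>K\<close> of the lift \<open>f\<close> has an \<open>\<omega>\<close>-orthogonal complement, which is
  rational and complex and is the image of a section \<open>s\<close> of \<open>f\<close>. Hence \<open>\<omega> = \<kappa> + f\<^sup>* a\<close> with \<open>a = s\<^sup>* \<omega>\<close>
  and \<open>\<kappa>\<close> living on \<open>K\<close>, and similarly \<open>D = D\<^sub>K + D' + f\<^sup>* s\<^sup>* D\<close> with a mixed term \<open>D'\<close>. Expanding
  \<open>\<omega>\<^sup>M \<and> D\<close> with \<open>M = N - q - 1\<close>, only the terms of full degree along \<open>K\<close> survive integration over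
  the fibre, so the pushforward of \<open>\<omega>\<^sup>M \<and> D\<close> is \<open>c\<^sub>1 a\<^sup>m + c\<^sub>2 a\<^sup>m\<^sup>-\<^sup>1 \<and> s\<^sup>* D\<close> with \<open>m = n - q\<close> and rational \<open>c\<^sub>1\<close>, \<open>c\<^sub>2\<close>.
  This is a product of divisors, and for \<open>m > 0\<close> it lies in the image of \<open>H\<^sup>1\<^sup>,\<^sup>1(A, \<rat>)\<close> under the
  multiplication by \<open>a\<^sup>m\<^sup>-\<^sup>1\<close>.

  An arbitrary \<open>\<omega>\<close> becomes definite after adding a large multiple \<open>t E\<close> of a polarization. The
  pushforward of \<open>(\<omega> + t E)\<^sup>M \<and> D\<close> is a polynomial in \<open>t\<close>, and a polynomial with values in a rational
  subspace for all large integers \<open>t\<close> has its coefficients there; in particular its value at \<open>t = 0\<close>.\<close>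

section \<open>Exterior algebra\<close>

text \<open>The pushforward is a definite description, and its existence is not established for
  general forms. For definite \<open>\<omega>\<close> the explicit formula exhibits it. For other
  \<open>\<omega>\<close> existence is inherited together with membership in the divisor products,
  because the forms having such a pushforward make up a rational subspace. Uniqueness is Poincare
  duality for invariant forms; the exterior algebra is developed up to the nondegeneracy of the
  wedge pairing for its sake.

  The delicate point is that the complement of \<open>K\<close> is rational. No rational basis of
  \<open>K\<close> is chosen. A vector of the complement is the only solution of linear equations
  with rational coefficients, and rational-linear functionals on the reals turn a real solution into
  a rational one.

  Which terms survive is read off from weights under a scaling by 2. Hence no bigrading of forms is
  set up, and the fibre needs no orientation or integral of its own: only the rationality of the
  constants matters.

  For \<open>m = 0\<close> the image consists of constants, and the dimension bound then needs a
  nonzero class in degree (1,1) on \<open>A\<close>, namely its polarization.\<close>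

lemma alt_forms_cong: "\<alpha> \<in> alt_forms k \<Longrightarrow> (\<And>i. i < k \<Longrightarrow> x i = y i) \<Longrightarrow> \<alpha> x = \<alpha> y"
  unfolding alt_forms_def by blast

lemma alt_forms_linear: "\<alpha> \<in> alt_forms k \<Longrightarrow> i < k \<Longrightarrow> linear (\<lambda>v. \<alpha> (x(i := v)))"
  unfolding alt_forms_def by blast

lemma alt_forms_alt: "\<alpha> \<in> alt_forms k \<Longrightarrow> i < k \<Longrightarrow> j < k \<Longrightarrow> i \<noteq> j \<Longrightarrow> x i = x j \<Longrightarrow> \<alpha> x = 0"
  unfolding alt_forms_def by blast

lemma alt_formsI:
  assumes "\<And>x y. (\<And>i. i < k \<Longrightarrow> x i = y i) \<Longrightarrow> \<alpha> x = \<alpha> y"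
    and "\<And>i x. i < k \<Longrightarrow> linear (\<lambda>v. \<alpha> (x(i := v)))"
    and "\<And>x i j. i < k \<Longrightarrow> j < k \<Longrightarrow> i \<noteq> j \<Longrightarrow> x i = x j \<Longrightarrow> \<alpha> x = 0"
  shows "\<alpha> \<in> alt_forms k"
  using assms unfolding alt_forms_def by blast

lemma alt_forms_0: "\<alpha> \<in> alt_forms 0 \<Longrightarrow> \<alpha> x = \<alpha> y"
  by (rule alt_forms_cong) auto

lemma const_in_alt_forms: "(\<lambda>x. c) \<in> alt_forms 0"
  by (rule alt_formsI) auto

lemma zero_in_alt_forms: "(\<lambda>x. 0) \<in> alt_forms k"
  by (rule alt_formsI) (auto simp: linear_iff)

lemma add_in_alt_forms:
  assumes "\<alpha> \<in> alt_forms k" "\<beta> \<in> alt_forms k"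
  shows "(\<lambda>x. \<alpha> x + \<beta> x) \<in> alt_forms k"
proof (rule alt_formsI)
  show "\<alpha> x + \<beta> x = \<alpha> y + \<beta> y" if "\<And>i. i < k \<Longrightarrow> x i = y i" for x y
    using alt_forms_cong[OF assms(1) that] alt_forms_cong[OF assms(2) that] by simp
  show "linear (\<lambda>v. \<alpha> (x(i := v)) + \<beta> (x(i := v)))" if "i < k" for i x
    by (intro linear_compose_add alt_forms_linear[OF _ that] assms)
  show "\<alpha> x + \<beta> x = 0" if "i < k" "j < k" "i \<noteq> j" "x i = x j" for x i j
    using alt_forms_alt[OF assms(1) that] alt_forms_alt[OF assms(2) that] by simp
qed

lemma linear_cmult:
  fixes f :: "'v::real_vector \<Rightarrow> 'b::real_algebra"
  shows "linear f \<Longrightarrow> linear (\<lambda>v. c * f v)" and "linear f \<Longrightarrow> linear (\<lambda>v. f v * c)"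
  by (simp_all add: linear_iff distrib_left distrib_right)

lemma scale_in_alt_forms:
  assumes "\<alpha> \<in> alt_forms k"
  shows "(\<lambda>x. c * \<alpha> x) \<in> alt_forms k"
proof (rule alt_formsI)
  show "c * \<alpha> x = c * \<alpha> y" if "\<And>i. i < k \<Longrightarrow> x i = y i" for x y
    using alt_forms_cong[OF assms that] by simp
  show "linear (\<lambda>v. c * \<alpha> (x(i := v)))" if "i < k" for i x
    by (rule linear_cmult(1)[OF alt_forms_linear[OF assms that]])
  show "c * \<alpha> x = 0" if "i < k" "j < k" "i \<noteq> j" "x i = x j" for x i j
    using alt_forms_alt[OF assms that] by simp
qed

lemma diff_in_alt_forms:
  assumes "\<alpha> \<in> alt_forms k" "\<beta> \<in> alt_forms k"
  shows "(\<lambda>x. \<alpha> x - \<beta> x) \<in> alt_forms k"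
  using add_in_alt_forms[OF assms(1) scale_in_alt_forms[OF assms(2), of "-1"]] by simp

lemma sum_in_alt_forms:
  assumes "\<And>i. i \<in> I \<Longrightarrow> \<alpha> i \<in> alt_forms k"
  shows "(\<lambda>x. \<Sum>i\<in>I. \<alpha> i x) \<in> alt_forms k"
  using assms
proof (induction I rule: infinite_finite_induct)
  case (insert i I)
  then have "(\<lambda>x. \<alpha> i x + (\<Sum>i\<in>I. \<alpha> i x)) \<in> alt_forms k"
    by (intro add_in_alt_forms) auto
  then show ?case using insert by simp
qed (auto simp: zero_in_alt_forms)

text \<open>Polarization of the alternating condition: expand the form with \<open>x i + x j\<close>
  in both slots.\<close>

lemma alt_forms_transpose:
  fixes \<alpha> :: "(nat \<Rightarrow> 'v::real_vector) \<Rightarrow> 'b::real_field"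
  assumes a: "\<alpha> \<in> alt_forms k" and ij: "i < k" "j < k" "i \<noteq> j"
  shows "\<alpha> (\<lambda>l. x (Transposition.transpose i j l)) = - \<alpha> x"
proof -
  let ?u = "\<lambda>a b. x(i := a, j := b)"
  let ?s = "x i + x j"
  have swap: "?u a b = (x(j := b))(i := a)" for a b
    using ij by (simp add: fun_upd_twist)
  have l2: "\<alpha> (?u a (b + c)) = \<alpha> (?u a b) + \<alpha> (?u a c)" for a b c
    by (rule linear_add[OF alt_forms_linear[OF a ij(2)]])
  have l1: "\<alpha> (?u (a + b) c) = \<alpha> (?u a c) + \<alpha> (?u b c)" for a b c
    unfolding swap by (rule linear_add[OF alt_forms_linear[OF a ij(1)]])
  have z: "\<alpha> (?u a a) = 0" for a
    using ij by (intro alt_forms_alt[OF a ij]) simp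
  have "0 = \<alpha> (?u ?s ?s)" by (simp only: z)
  also have "\<dots> = \<alpha> (?u (x i) (x j)) + \<alpha> (?u (x j) (x i))"
    unfolding l1 l2 unfolding z by (simp only: add_0_left add_0_right add.commute)
  finally have "\<alpha> (?u (x j) (x i)) = - \<alpha> (?u (x i) (x j))"
    by (simp add: eq_neg_iff_add_eq_0 add.commute)
  moreover have "?u (x j) (x i) = (\<lambda>l. x (Transposition.transpose i j l))"
    by (auto simp: fun_eq_iff Transposition.transpose_def)
  moreover have "?u (x i) (x j) = x" by auto
  ultimately show ?thesis by simp
qed

lemma alt_forms_permute:
  fixes \<alpha> :: "(nat \<Rightarrow> 'v::real_vector) \<Rightarrow> 'b::real_field"
  assumes a: "\<alpha> \<in> alt_forms k" and s: "\<sigma> permutes {..<k}"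
  shows "\<alpha> (\<lambda>i. x (\<sigma> i)) = of_int (sign \<sigma>) * \<alpha> x"
  using s finite_lessThan[of k]
proof (induction arbitrary: x rule: permutes_induct)
  case id
  then show ?case by simp
next
  case (swap i j p)
  have "\<alpha> (\<lambda>l. x ((Transposition.transpose i j \<circ> p) l)) = of_int (sign p) * (- \<alpha> x)"
    using swap.IH[of "\<lambda>l. x (Transposition.transpose i j l)"] swap.hyps
    by (simp add: alt_forms_transpose[OF a])
  also have "\<dots> = of_int (sign (Transposition.transpose i j \<circ> p)) * \<alpha> x"
  proof -
    have "permutation p"
      using swap.hyps finite_lessThan permutation_permutes by blast
    then have "sign (Transposition.transpose i j \<circ> p) = sign (Transposition.transpose i j) * sign p"
      by (rule sign_compose[OF permutation_swap_id])
    then show ?thesis using swap.hyps by (simp add: sign_swap_id)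
  qed
  finally show ?case .
qed

text \<open>Serves two purposes: with integer factors it clears denominators, with the constant
  factor 2 it computes weights under scaling.\<close>

lemma alt_forms_scale_args:
  fixes \<alpha> :: "(nat \<Rightarrow> 'v::real_vector) \<Rightarrow> 'b::real_field"
  assumes a: "\<alpha> \<in> alt_forms k"
  shows "\<alpha> (\<lambda>i. c i *\<^sub>R x i) = of_real (\<Prod>i<k. c i) * \<alpha> x"
proof -
  have "m \<le> k \<Longrightarrow> \<alpha> (\<lambda>i. if i < m then c i *\<^sub>R x i else x i) = of_real (\<Prod>i<m. c i) * \<alpha> x" for m
  proof (induction m)
    case (Suc m)
    let ?y = "\<lambda>i. if i < m then c i *\<^sub>R x i else x i"
    have "\<alpha> (\<lambda>i. if i < Suc m then c i *\<^sub>R x i else x i) = \<alpha> (?y(m := c m *\<^sub>R x m))"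
      by (rule arg_cong[of _ _ \<alpha>]) (auto simp: fun_eq_iff less_Suc_eq)
    also have "\<dots> = c m *\<^sub>R \<alpha> (?y(m := x m))"
      using Suc.prems by (intro linear_scale alt_forms_linear[OF a]) auto
    also have "?y(m := x m) = ?y" by auto
    finally show ?case using Suc by (simp add: scaleR_conv_of_real)
  qed simp
  from this[of k] have "\<alpha> (\<lambda>i. if i < k then c i *\<^sub>R x i else x i) = of_real (\<Prod>i<k. c i) * \<alpha> x"
    by simp
  moreover have "\<alpha> (\<lambda>i. if i < k then c i *\<^sub>R x i else x i) = \<alpha> (\<lambda>i. c i *\<^sub>R x i)"
    by (rule alt_forms_cong[OF a]) simp
  ultimately show ?thesis by simp
qed

lemma one_form_in_alt_forms:
  assumes "linear l"
  shows "one_form l \<in> alt_forms 1"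
  using assms unfolding one_form_def by (intro alt_formsI) auto

lemma alt_forms_1_cases:
  assumes "\<alpha> \<in> alt_forms 1"
  obtains l where "linear l" "\<alpha> = one_form l"
proof
  show "linear (\<lambda>v. \<alpha> ((\<lambda>_. v)(0 := v)))"
  proof -
    have "(\<lambda>v. \<alpha> ((\<lambda>_. v)(0 := v))) = (\<lambda>v. \<alpha> ((\<lambda>_. 0)(0 := v)))"
      by (intro ext alt_forms_cong[OF assms]) auto
    then show ?thesis using alt_forms_linear[OF assms, of 0] by simp
  qed
  show "\<alpha> = one_form (\<lambda>v. \<alpha> ((\<lambda>_. v)(0 := v)))"
    unfolding one_form_def by (intro ext alt_forms_cong[OF assms]) auto
qed

lemma pullback_in_alt_forms:
  assumes f: "linear f" and a: "\<alpha> \<in> alt_forms k"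
  shows "pullback f \<alpha> \<in> alt_forms k"
  unfolding pullback_def
proof (rule alt_formsI)
  show "\<alpha> (\<lambda>i. f (x i)) = \<alpha> (\<lambda>i. f (y i))" if "\<And>i. i < k \<Longrightarrow> x i = y i" for x y
    using that by (intro alt_forms_cong[OF a]) auto
  show "linear (\<lambda>v. \<alpha> (\<lambda>j. f ((x(i := v)) j)))" if "i < k" for i x
  proof -
    have "(\<lambda>v. \<alpha> (\<lambda>j. f ((x(i := v)) j))) = (\<lambda>v. \<alpha> ((\<lambda>j. f (x j))(i := v))) \<circ> f"
      by (auto simp: fun_eq_iff intro!: arg_cong[of _ _ \<alpha>])
    then show ?thesis
      using linear_compose[OF f alt_forms_linear[OF a that]] by metis
  qed
  show "\<alpha> (\<lambda>i. f (x i)) = 0" if "i < k" "j < k" "i \<noteq> j" "x i = x j" for x i j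
    using that by (intro alt_forms_alt[OF a, of i j]) auto
qed

lemma pullback_wedge: "pullback f (wedge p q \<alpha> \<beta>) = wedge p q (pullback f \<alpha>) (pullback f \<beta>)"
  by (simp add: pullback_def wedge_def)

section \<open>The wedge product is alternating\<close>

lemma wedge_permute:
  fixes \<alpha> \<beta> :: "(nat \<Rightarrow> 'v::real_vector) \<Rightarrow> 'b::real_field"
  assumes t: "\<tau> permutes {..<p + q}"
  shows "wedge p q \<alpha> \<beta> (\<lambda>i. x (\<tau> i)) = of_int (sign \<tau>) * wedge p q \<alpha> \<beta> x"
proof -
  let ?P = "{\<sigma>. \<sigma> permutes {..<p + q}}"
  let ?F = "\<lambda>\<sigma>. \<alpha> (\<lambda>i. x (\<sigma> i)) * \<beta> (\<lambda>i. x (\<sigma> (p + i)))"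
  have perm: "permutation \<sigma>" if "\<sigma> permutes {..<p + q}" for \<sigma>
    using that finite_lessThan permutation_permutes by blast
  have "(\<Sum>\<sigma>\<in>?P. of_int (sign \<sigma>) * ?F \<sigma>) = (\<Sum>\<sigma>\<in>?P. of_int (sign (\<tau> \<circ> \<sigma>)) * ?F (\<tau> \<circ> \<sigma>))"
    by (rule setum_permutations_compose_left[OF t])
  also have "\<dots> = (\<Sum>\<sigma>\<in>?P. of_int (sign \<tau>) * (of_int (sign \<sigma>) * ?F (\<tau> \<circ> \<sigma>)))"
    using perm perm[OF t] by (intro sum.cong refl) (simp add: sign_compose)
  also have "\<dots> = of_int (sign \<tau>) * (\<Sum>\<sigma>\<in>?P. of_int (sign \<sigma>) * ?F (\<tau> \<circ> \<sigma>))"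
    by (rule sum_distrib_left[symmetric])
  finally have S: "(\<Sum>\<sigma>\<in>?P. of_int (sign \<sigma>) * ?F \<sigma>)
      = of_int (sign \<tau>) * (\<Sum>\<sigma>\<in>?P. of_int (sign \<sigma>) * ?F (\<tau> \<circ> \<sigma>))" .
  have "of_int (sign \<tau>) * (of_int (sign \<tau>) * z) = z" for z :: 'b
    by (simp add: sign_def)
  then have "(\<Sum>\<sigma>\<in>?P. of_int (sign \<sigma>) * ?F (\<tau> \<circ> \<sigma>))
      = of_int (sign \<tau>) * (\<Sum>\<sigma>\<in>?P. of_int (sign \<sigma>) * ?F \<sigma>)"
    by (subst S) simp
  then show ?thesis
    by (simp add: wedge_def mult.assoc)
qed

lemma wedge_in_alt_forms:
  fixes \<alpha> \<beta> :: "(nat \<Rightarrow> 'v::real_vector) \<Rightarrow> 'b::real_field"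
  assumes a: "\<alpha> \<in> alt_forms p" and b: "\<beta> \<in> alt_forms q"
  shows "wedge p q \<alpha> \<beta> \<in> alt_forms (p + q)"
proof (rule alt_formsI)
  let ?P = "{\<sigma>. \<sigma> permutes {..<p + q}}"
  have lt: "\<sigma> i < p + q" if "\<sigma> \<in> ?P" "i < p + q" for \<sigma> i
    using that permutes_in_image[of \<sigma> "{..<p + q}" i] by auto
  show "wedge p q \<alpha> \<beta> x = wedge p q \<alpha> \<beta> y" if eq: "\<And>i. i < p + q \<Longrightarrow> x i = y i" for x y
  proof -
    have "\<alpha> (\<lambda>i. x (\<sigma> i)) = \<alpha> (\<lambda>i. y (\<sigma> i)) \<and> \<beta> (\<lambda>i. x (\<sigma> (p + i))) = \<beta> (\<lambda>i. y (\<sigma> (p + i)))"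
      if "\<sigma> \<in> ?P" for \<sigma>
      using lt[OF that] eq
      by (intro conjI alt_forms_cong[OF a] alt_forms_cong[OF b]) auto
    then show ?thesis
      unfolding wedge_def by (intro arg_cong2[where f = "(/)"] sum.cong refl) auto
  qed
  show "linear (\<lambda>v. wedge p q \<alpha> \<beta> (x(i := v)))" if i: "i < p + q" for i x
  proof -
    have lin: "linear (\<lambda>v. of_int (sign \<sigma>) * \<alpha> (\<lambda>j. (x(i := v)) (\<sigma> j)) * \<beta> (\<lambda>j. (x(i := v)) (\<sigma> (p + j))))"
      if s: "\<sigma> \<in> ?P" for \<sigma>
    proof -
      have s': "\<sigma> permutes {..<p + q}" using s by simp
      \<comment> \<open>The varying vector occupies exactly one slot of the permuted sequence,
        namely \<open>k\<close>, so only one of the two factors depends on it.\<close>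
      obtain k where k: "\<sigma> k = i" using permutes_surj[OF s'] by (metis surjD)
      have kl: "k < p + q"
        using k i permutes_in_image[OF s', of k] by auto
      have eq: "\<sigma> j = i \<longleftrightarrow> j = k" for j
        using permutes_inj[OF s'] k by (metis injD)
      show ?thesis
      proof (cases "k < p")
        case True
        have e1: "(\<lambda>j. (x(i := v)) (\<sigma> j)) = (\<lambda>j. x (\<sigma> j))(k := v)" for v
          by (auto simp: fun_eq_iff eq)
        have e2: "(\<lambda>j. (x(i := v)) (\<sigma> (p + j))) = (\<lambda>j. x (\<sigma> (p + j)))" for v
          using True by (auto simp: fun_eq_iff eq)
        show ?thesis
          unfolding e1 e2
          by (rule linear_cmult(2)[OF linear_cmult(1)[OF alt_forms_linear[OF a True]]])
      next
        case False
        then have kq: "k - p < q" using kl by simp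
        have e1: "\<alpha> (\<lambda>j. (x(i := v)) (\<sigma> j)) = \<alpha> (\<lambda>j. x (\<sigma> j))" for v
          using False by (intro alt_forms_cong[OF a]) (auto simp: eq)
        have e2: "(\<lambda>j. (x(i := v)) (\<sigma> (p + j))) = (\<lambda>j. x (\<sigma> (p + j)))(k - p := v)" for v
          using False by (auto simp: fun_eq_iff eq)
        show ?thesis
          unfolding e1 e2 by (rule linear_cmult(1)[OF alt_forms_linear[OF b kq]])
      qed
    qed
    have "linear (\<lambda>v. \<Sum>\<sigma>\<in>?P. of_int (sign \<sigma>) * \<alpha> (\<lambda>j. (x(i := v)) (\<sigma> j)) * \<beta> (\<lambda>j. (x(i := v)) (\<sigma> (p + j))))"
      by (rule linear_compose_sum) (use lin in blast)
    then show ?thesis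
      unfolding wedge_def divide_inverse by (rule linear_cmult(2))
  qed
  show "wedge p q \<alpha> \<beta> x = 0" if "i < p + q" "j < p + q" "i \<noteq> j" "x i = x j" for x i j
  proof -
    \<comment> \<open>Exchanging two equal arguments changes nothing, yet it reverses the sign of
      the product; hence twice the value is 0.\<close>
    have "(\<lambda>l. x (Transposition.transpose i j l)) = x"
      using that(4) by (auto simp: fun_eq_iff Transposition.transpose_def)
    then have "wedge p q \<alpha> \<beta> x = - wedge p q \<alpha> \<beta> x"
      using wedge_permute[OF permutes_swap_id, of i p q j \<alpha> \<beta> x] that
      by (simp add: sign_swap_id)
    then have "wedge p q \<alpha> \<beta> x + wedge p q \<alpha> \<beta> x = 0"
      by (simp only: eq_neg_iff_add_eq_0)
    then have "2 * wedge p q \<alpha> \<beta> x = 0"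
      by (simp only: mult_2)
    then show ?thesis by simp
  qed
qed

lemma wedge_0_right:
  fixes \<alpha> \<beta> :: "(nat \<Rightarrow> 'v::real_vector) \<Rightarrow> 'b::real_field"
  assumes a: "\<alpha> \<in> alt_forms p" and b: "\<beta> \<in> alt_forms 0"
  shows "wedge p 0 \<alpha> \<beta> x = \<alpha> x * \<beta> x"
proof -
  have "of_int (sign \<sigma>) * \<alpha> (\<lambda>i. x (\<sigma> i)) * \<beta> (\<lambda>i. x (\<sigma> (p + i))) = \<alpha> x * \<beta> x"
    if s: "\<sigma> permutes {..<p}" for \<sigma>
  proof -
    have e: "\<beta> (\<lambda>i. x (\<sigma> (p + i))) = \<beta> x"
      by (rule alt_forms_0[OF b])
    show ?thesis
      unfolding alt_forms_permute[OF a s] e by (simp add: sign_def)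
  qed
  then show ?thesis
    by (simp add: wedge_def card_permutations)
qed

text \<open>The cycle is a product of \<open>k\<close> adjacent transpositions. It produces the sign
  in the product rule for contraction.\<close>

lemma alt_forms_rotate:
  fixes \<beta> :: "(nat \<Rightarrow> 'v::real_vector) \<Rightarrow> 'b::real_field"
  assumes b: "\<beta> \<in> alt_forms (Suc k)"
  shows "\<beta> (\<lambda>i. if i < k then z (Suc i) else z 0) = (-1) ^ k * \<beta> z"
proof -
  have "j \<le> k \<Longrightarrow> \<beta> (\<lambda>i. if i < j then z (Suc i) else if i = j then z 0 else z i) = (-1) ^ j * \<beta> z" for j
  proof (induction j)
    case 0
    have "(\<lambda>i. if i = 0 then z 0 else z i) = z" by auto
    then show ?case by simp
  next
    case (Suc j)
    let ?y = "\<lambda>j i. if i < j then z (Suc i) else if i = j then z 0 else z i"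
    have "(\<lambda>i. ?y j (Transposition.transpose j (Suc j) i)) = ?y (Suc j)"
      by (auto simp: fun_eq_iff Transposition.transpose_def)
    then show ?case
      using alt_forms_transpose[OF b, of j "Suc j" "?y j"] Suc by simp
  qed
  from this[of k] have "\<beta> (\<lambda>i. if i < k then z (Suc i) else if i = k then z 0 else z i) = (-1) ^ k * \<beta> z"
    by simp
  moreover have "\<beta> (\<lambda>i. if i < k then z (Suc i) else if i = k then z 0 else z i)
      = \<beta> (\<lambda>i. if i < k then z (Suc i) else z 0)"
    by (rule alt_forms_cong[OF b]) auto
  ultimately show ?thesis by simp
qed

text \<open>Passing to inverses moves the transposition to the right-hand factor. Then
  \<open>q \<circ> Transposition.transpose a b\<close> sends \<open>b\<close> to \<open>a\<close>,
  so the outer sum runs over the position in which \<open>a\<close> occurs.\<close>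

lemma sum_over_permutations_insert_right:
  assumes fS: "finite S" and aS: "a \<notin> S"
  shows "(\<Sum>p | p permutes insert a S. f p) =
    (\<Sum>b\<in>insert a S. \<Sum>q | q permutes S. f (q \<circ> Transposition.transpose a b))"
proof -
  have inv: "inv (Transposition.transpose a b \<circ> q) = inv q \<circ> Transposition.transpose a b"
    if "q permutes S" for q b
    using that by (subst o_inv_distrib) (auto simp: permutes_bij)
  have "(\<Sum>p | p permutes insert a S. f p) = (\<Sum>p | p permutes insert a S. f (inv p))"
    by (rule sum_permutations_inverse)
  also have "\<dots> = (\<Sum>b\<in>insert a S. \<Sum>q | q permutes S. f (inv q \<circ> Transposition.transpose a b))"
    unfolding sum_over_permutations_insert[OF fS aS] by (intro sum.cong refl) (simp add: inv)
  also have "\<dots> = (\<Sum>b\<in>insert a S. \<Sum>q | q permutes S. f (q \<circ> Transposition.transpose a b))"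
    by (intro sum.cong refl sum_permutations_inverse[symmetric])
  finally show ?thesis .
qed

text \<open>Contraction acts on the last argument, which avoids shifting the others. A form of positive
  degree is determined by its contractions, and contraction is an antiderivation of the wedge
  product; associativity and graded commutativity follow by induction on the degree.\<close>

definition contract ::
    "nat \<Rightarrow> 'v::real_vector \<Rightarrow> ((nat \<Rightarrow> 'v) \<Rightarrow> 'b::real_field) \<Rightarrow> (nat \<Rightarrow> 'v) \<Rightarrow> 'b" where
  "contract k v \<alpha> = (\<lambda>x. if k = 0 then 0 else \<alpha> (x(k - 1 := v)))"

text \<open>The value 0 in degree 0 lets the product rule hold without exceptions, although the
  degree \<open>q - 1\<close> is truncated there.\<close>

lemma contract_0: "contract 0 v \<alpha> = (\<lambda>x. 0)"
  by (simp add: contract_def)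

lemma contract_in_alt_forms:
  assumes a: "\<alpha> \<in> alt_forms k"
  shows "contract k v \<alpha> \<in> alt_forms (k - 1)"
proof (cases k)
  case 0
  then show ?thesis by (simp add: contract_0 zero_in_alt_forms)
next
  case (Suc m)
  have "(\<lambda>x. \<alpha> (x(m := v))) \<in> alt_forms m"
  proof (rule alt_formsI)
    show "\<alpha> (x(m := v)) = \<alpha> (y(m := v))" if "\<And>i. i < m \<Longrightarrow> x i = y i" for x y
      using that Suc by (intro alt_forms_cong[OF a]) auto
    show "linear (\<lambda>w. \<alpha> ((x(i := w))(m := v)))" if "i < m" for i x
    proof -
      have "(x(i := w))(m := v) = (x(m := v))(i := w)" for w
        using that by auto
      then show ?thesis
        using alt_forms_linear[OF a, of i "x(m := v)"] that Suc by simp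
    qed
    show "\<alpha> (x(m := v)) = 0" if "i < m" "j < m" "i \<noteq> j" "x i = x j" for x i j
      using that Suc by (intro alt_forms_alt[OF a, of i j]) auto
  qed
  then show ?thesis using Suc by (simp add: contract_def)
qed

lemma forms_eqI_contract:
  assumes k: "k > 0" and eq: "\<And>v x. contract k v \<alpha> x = contract k v \<beta> x"
  shows "\<alpha> = \<beta>"
proof
  fix x
  show "\<alpha> x = \<beta> x" using eq[of "x (k - 1)" x] k by (simp add: contract_def)
qed

text \<open>Sort the permutations by the position \<open>b\<close> at which the last argument
  \<open>v\<close> is used. If \<open>b\<close> lies among the arguments of \<open>\<beta>\<close>,
  the term belongs to the contraction of \<open>\<beta>\<close>, otherwise to that of
  \<open>\<alpha>\<close>. The contribution does not depend on \<open>b\<close> within each group,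
  so the \<open>q\<close> and \<open>p\<close> choices turn the factorials of the wedge product into
  those of the contracted products.\<close>

lemma contract_wedge:
  fixes \<alpha> \<beta> :: "(nat \<Rightarrow> 'v::real_vector) \<Rightarrow> 'b::real_field"
  assumes a: "\<alpha> \<in> alt_forms p" and b: "\<beta> \<in> alt_forms q"
  shows "contract (p + q) v (wedge p q \<alpha> \<beta>) x =
    wedge p (q - 1) \<alpha> (contract q v \<beta>) x + (-1) ^ q * wedge (p - 1) q (contract p v \<alpha>) \<beta> x"
proof (cases q)
  case 0
  then have "\<beta> \<in> alt_forms 0" using b by simp
  moreover have "wedge p 0 \<alpha> (contract 0 v \<beta>) x = 0"
    by (simp add: contract_0 wedge_def)
  moreover have "\<beta> (x(p - 1 := v)) = \<beta> x"
    using \<open>\<beta> \<in> alt_forms 0\<close> by (rule alt_forms_0)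
  ultimately show ?thesis
    using 0 wedge_0_right[OF a] wedge_0_right[OF contract_in_alt_forms[OF a]]
    by (cases "p = 0") (simp_all add: contract_def)
next
  case (Suc q')
  define n where "n = p + q'"
  let ?P = "{\<rho>. \<rho> permutes {..<n}}"
  let ?y = "x(n := v)"
  define F where "F \<sigma> = of_int (sign \<sigma>) * \<alpha> (\<lambda>i. ?y (\<sigma> i)) * \<beta> (\<lambda>i. ?y (\<sigma> (p + i)))" for \<sigma>
  define A where "A \<rho> = of_int (sign \<rho>) * \<alpha> (\<lambda>i. x (\<rho> i)) * \<beta> ((\<lambda>i. x (\<rho> (p + i)))(q' := v))" for \<rho>
  define B where "B \<rho> = of_int (sign \<rho>) * \<alpha> ((\<lambda>i. x (\<rho> i))(p - 1 := v)) * \<beta> (\<lambda>i. x (\<rho> (p - 1 + i)))" for \<rho>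
  have perm: "permutation \<rho>" if "\<rho> permutes {..<n}" for \<rho>
    using that finite_lessThan permutation_permutes by blast
  have sgn: "sign (\<rho> \<circ> Transposition.transpose i j) = (if i = j then sign \<rho> else - sign \<rho>)"
    if "\<rho> permutes {..<n}" for \<rho> i j
    using sign_compose[OF perm[OF that] permutation_swap_id, of i j] by (simp add: sign_swap_id)
  have small: "\<rho> i < n \<longleftrightarrow> i < n" if "\<rho> permutes {..<n}" for \<rho> i
    using permutes_in_image[OF that, of i] by simp
  have fix_n: "\<rho> n = n" if "\<rho> permutes {..<n}" for \<rho>
    using permutes_not_in[OF that] by simp
  have hi: "F (\<rho> \<circ> Transposition.transpose n b) = A \<rho>"
    if r: "\<rho> permutes {..<n}" and bb: "p \<le> b" "b \<le> n" for \<rho> b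
  proof -
    let ?t = "Transposition.transpose n b"
    let ?z = "(\<lambda>i. x (\<rho> (p + i)))(q' := v)"
    have e1: "\<alpha> (\<lambda>i. ?y ((\<rho> \<circ> ?t) i)) = \<alpha> (\<lambda>i. x (\<rho> i))"
    proof (rule alt_forms_cong[OF a])
      fix i assume i: "i < p"
      then have "?t i = i" using bb by (intro transpose_apply_other) auto
      moreover have "\<rho> i \<noteq> n" using small[OF r, of i] i bb by auto
      ultimately show "?y ((\<rho> \<circ> ?t) i) = x (\<rho> i)" by simp
    qed
    have e2: "\<beta> (\<lambda>i. ?y ((\<rho> \<circ> ?t) (p + i))) = \<beta> (\<lambda>i. ?z (Transposition.transpose q' (b - p) i))"
    proof (rule alt_forms_cong[OF b])
      fix i assume i: "i < q"
      have "?t (p + i) = p + Transposition.transpose q' (b - p) i"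
        using i bb Suc by (auto simp: Transposition.transpose_def n_def)
      moreover have "?y (\<rho> (p + j)) = ?z j" if "j \<le> q'" for j
        using small[OF r, of "p + j"] fix_n[OF r] that by (cases "j = q'") (auto simp: n_def)
      moreover have "Transposition.transpose q' (b - p) i \<le> q'"
        using i bb Suc by (auto simp: Transposition.transpose_def n_def)
      ultimately show "?y ((\<rho> \<circ> ?t) (p + i)) = ?z (Transposition.transpose q' (b - p) i)"
        by (simp del: fun_upd_apply)
    qed
    have e3: "\<beta> (\<lambda>i. ?z (Transposition.transpose q' (b - p) i)) = (if b = n then \<beta> ?z else - \<beta> ?z)"
    proof (cases "b = n")
      case True
      then show ?thesis by (simp add: n_def fun_upd_def)
    next
      case False
      then show ?thesis
        using alt_forms_transpose[OF b, of q' "b - p" ?z] bb Suc by (auto simp: n_def)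
    qed
    show ?thesis
      unfolding F_def A_def e1 e2 e3 sgn[OF r] by simp
  qed
  \<comment> \<open>An additional transposition brings \<open>v\<close> to the last slot of
    \<open>\<alpha>\<close>. The argument displaced from there lands in the last slot of
    \<open>\<beta>\<close> and is rotated to its front, with sign \<open>(-1) ^ q'\<close>; the
    transpositions together contribute one more sign.\<close>
  have lo: "F (\<rho> \<circ> Transposition.transpose b (p - 1) \<circ> Transposition.transpose n b) = (-1) ^ q * B \<rho>"
    if r: "\<rho> permutes {..<n}" and bp: "b < p" for \<rho> b
  proof -
    let ?u = "Transposition.transpose b (p - 1)"
    let ?t = "Transposition.transpose n b"
    let ?z = "(\<lambda>i. x (\<rho> i))(p - 1 := v)"
    let ?w = "\<lambda>i. x (\<rho> (p - 1 + i))"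
    have bn: "b < n" using bp by (simp add: n_def)
    have ru: "\<rho> \<circ> ?u permutes {..<n}"
      using bp by (intro permutes_compose[OF _ r] permutes_swap_id) (auto simp: n_def)
    have e1: "\<alpha> (\<lambda>i. ?y ((\<rho> \<circ> ?u \<circ> ?t) i)) = \<alpha> (\<lambda>i. ?z (?u i))"
    proof (rule alt_forms_cong[OF a])
      fix i assume i: "i < p"
      show "?y ((\<rho> \<circ> ?u \<circ> ?t) i) = ?z (?u i)"
      proof (cases "i = b")
        case True
        have "?u n = n" using bp by (intro transpose_apply_other) (auto simp: n_def)
        then show ?thesis using True fix_n[OF r] by simp
      next
        case False
        then have "?t i = i" using i by (intro transpose_apply_other) (auto simp: n_def)
        moreover have "?u i < n" "?u i \<noteq> p - 1"
          using i bp False by (auto simp: Transposition.transpose_def n_def)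
        ultimately show ?thesis using small[OF r, of "?u i"] by auto
      qed
    qed
    have e2: "\<alpha> (\<lambda>i. ?z (?u i)) = (if b = p - 1 then \<alpha> ?z else - \<alpha> ?z)"
      using alt_forms_transpose[OF a, of b "p - 1" ?z] bp
      by (cases "b = p - 1") (simp_all add: fun_upd_def)
    have e3: "\<beta> (\<lambda>i. ?y ((\<rho> \<circ> ?u \<circ> ?t) (p + i))) = \<beta> (\<lambda>i. if i < q' then ?w (Suc i) else ?w 0)"
    proof (rule alt_forms_cong[OF b])
      fix i assume i: "i < q"
      show "?y ((\<rho> \<circ> ?u \<circ> ?t) (p + i)) = (if i < q' then ?w (Suc i) else ?w 0)"
      proof (cases "i = q'")
        case True
        then have "\<rho> (?u (?t (p + i))) = \<rho> (p - 1)"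
          by (simp add: n_def)
        moreover have "\<rho> (p - 1) < n"
          using small[OF r, of "p - 1"] bp by (simp add: n_def)
        ultimately show ?thesis using True by auto
      next
        case False
        then have "?t (p + i) = p + i" "?u (p + i) = p + i" "p + i < n"
          using i bp Suc by (auto simp: Transposition.transpose_def n_def)
        moreover have "p - 1 + Suc i = p + i" using bp by simp
        ultimately show ?thesis
          using False i Suc small[OF r, of "p + i"] by auto
      qed
    qed
    have e4: "\<beta> (\<lambda>i. if i < q' then ?w (Suc i) else ?w 0) = (-1) ^ q' * \<beta> ?w"
      using alt_forms_rotate[of \<beta> q' ?w] b Suc by simp
    have s: "sign (\<rho> \<circ> ?u \<circ> ?t) = (if b = p - 1 then - sign \<rho> else sign \<rho>)"
      unfolding sgn[OF ru] sgn[OF r] using bn by simp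
    show ?thesis
      unfolding F_def B_def s e1 e2 e3 e4 using Suc by simp
  qed
  have sum_hi: "(\<Sum>\<rho>\<in>?P. F (\<rho> \<circ> Transposition.transpose n b)) = sum A ?P" if "p \<le> b" "b \<le> n" for b
    using hi that by (intro sum.cong) auto
  have sum_lo: "(\<Sum>\<rho>\<in>?P. F (\<rho> \<circ> Transposition.transpose n b)) = (-1) ^ q * sum B ?P" if "b < p" for b
  proof -
    have "(\<Sum>\<rho>\<in>?P. F (\<rho> \<circ> Transposition.transpose n b)) =
      (\<Sum>\<rho>\<in>?P. F (\<rho> \<circ> Transposition.transpose b (p - 1) \<circ> Transposition.transpose n b))"
      using that by (intro sum_permutations_compose_right permutes_swap_id) (auto simp: n_def)
    also have "\<dots> = (\<Sum>\<rho>\<in>?P. (-1) ^ q * B \<rho>)"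
      using lo that by (intro sum.cong) auto
    finally show ?thesis by (simp add: sum_distrib_left)
  qed
  have ins: "{..<p + q} = insert n {..<n}"
    using Suc by (auto simp: n_def)
  have "(\<Sum>\<sigma> | \<sigma> permutes {..<p + q}. F \<sigma>)
      = (\<Sum>b\<in>insert n {..<n}. \<Sum>\<rho>\<in>?P. F (\<rho> \<circ> Transposition.transpose n b))"
    unfolding ins by (rule sum_over_permutations_insert_right) auto
  also have "insert n {..<n} = {..<p} \<union> {p..n}"
    by (auto simp: n_def)
  also have "(\<Sum>b\<in>{..<p} \<union> {p..n}. \<Sum>\<rho>\<in>?P. F (\<rho> \<circ> Transposition.transpose n b))
      = (\<Sum>b<p. (-1) ^ q * sum B ?P) + (\<Sum>b\<in>{p..n}. sum A ?P)"
    using sum_hi sum_lo by (subst sum.union_disjoint) auto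
  also have "\<dots> = of_nat p * ((-1) ^ q * sum B ?P) + of_nat q * sum A ?P"
    using Suc by (simp add: n_def)
  finally have main: "(\<Sum>\<sigma> | \<sigma> permutes {..<p + q}. F \<sigma>)
      = of_nat p * ((-1) ^ q * sum B ?P) + of_nat q * sum A ?P" .
  have l: "contract (p + q) v (wedge p q \<alpha> \<beta>) x = (\<Sum>\<sigma> | \<sigma> permutes {..<p + q}. F \<sigma>) / (fact p * fact q)"
    using Suc by (simp add: contract_def wedge_def F_def n_def)
  have r1: "wedge p (q - 1) \<alpha> (contract q v \<beta>) x = sum A ?P / (fact p * fact q')"
    using Suc by (simp add: contract_def wedge_def A_def n_def)
  have r2: "of_nat p * sum B ?P / (fact p * fact q) = wedge (p - 1) q (contract p v \<alpha>) \<beta> x"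
  proof (cases p)
    case 0
    then show ?thesis by (simp add: contract_0 wedge_def)
  next
    case (Suc p')
    have "p' + q = n" using \<open>q = Suc q'\<close> Suc by (simp add: n_def)
    then have "wedge (p - 1) q (contract p v \<alpha>) \<beta> x = sum B ?P / (fact p' * fact q)"
      using Suc by (simp add: contract_def wedge_def B_def)
    then show ?thesis
      using Suc by (simp add: field_simps del: of_nat_Suc)
  qed
  have "(of_nat p * ((-1) ^ q * sum B ?P) + of_nat q * sum A ?P) / (fact p * fact q)
     = (-1) ^ q * (of_nat p * sum B ?P / (fact p * fact q)) + sum A ?P / (fact p * fact q')"
    using Suc by (simp add: field_simps del: of_nat_Suc)
  then show ?thesis
    unfolding l main r1 r2 by simp
qed

section \<open>Bilinearity, associativity and graded commutativity\<close>

lemma wedge_add_left: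
  "wedge p q (\<lambda>x. \<alpha> x + \<alpha>' x) \<beta> = (\<lambda>x. wedge p q \<alpha> \<beta> x + wedge p q \<alpha>' \<beta> x)"
  by (simp add: wedge_def fun_eq_iff distrib_left distrib_right sum.distrib add_divide_distrib)

lemma wedge_add_right:
  "wedge p q \<alpha> (\<lambda>x. \<beta> x + \<beta>' x) = (\<lambda>x. wedge p q \<alpha> \<beta> x + wedge p q \<alpha> \<beta>' x)"
  by (simp add: wedge_def fun_eq_iff distrib_left sum.distrib add_divide_distrib)

lemma wedge_scale_left: "wedge p q (\<lambda>x. c * \<alpha> x) \<beta> = (\<lambda>x. c * wedge p q \<alpha> \<beta> x)"
  by (simp add: wedge_def fun_eq_iff sum_distrib_left mult_ac)

lemma wedge_scale_right: "wedge p q \<alpha> (\<lambda>x. c * \<beta> x) = (\<lambda>x. c * wedge p q \<alpha> \<beta> x)"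
  by (simp add: wedge_def fun_eq_iff sum_distrib_left mult_ac)

lemma wedge_zero_left: "wedge p q (\<lambda>x. 0) \<beta> = (\<lambda>x. 0)"
  by (simp add: wedge_def)

lemma wedge_zero_right: "wedge p q \<alpha> (\<lambda>x. 0) = (\<lambda>x. 0)"
  by (simp add: wedge_def)

lemma wedge_sum_left:
  "wedge p q (\<lambda>x. \<Sum>i\<in>I. \<alpha> i x) \<beta> = (\<lambda>x. \<Sum>i\<in>I. wedge p q (\<alpha> i) \<beta> x)"
  by (induction I rule: infinite_finite_induct) (simp_all add: wedge_zero_left wedge_add_left)

lemma wedge_sum_right:
  "wedge p q \<alpha> (\<lambda>x. \<Sum>i\<in>I. \<beta> i x) = (\<lambda>x. \<Sum>i\<in>I. wedge p q \<alpha> (\<beta> i) x)"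
  by (induction I rule: infinite_finite_induct) (simp_all add: wedge_zero_right wedge_add_right)

lemma of_real_wedge:
  "(\<lambda>x. of_real (wedge p q \<alpha> \<beta> x)) = wedge p q (\<lambda>x. of_real (\<alpha> x)) (\<lambda>x. of_real (\<beta> x) :: 'b::real_field)"
  by (simp add: wedge_def fun_eq_iff)

lemma contract_wedge_fun:
  fixes \<alpha> \<beta> :: "(nat \<Rightarrow> 'v::real_vector) \<Rightarrow> 'b::real_field"
  assumes "\<alpha> \<in> alt_forms p" "\<beta> \<in> alt_forms q"
  shows "contract (p + q) v (wedge p q \<alpha> \<beta>) = (\<lambda>x.
    wedge p (q - 1) \<alpha> (contract q v \<beta>) x + (-1) ^ q * wedge (p - 1) q (contract p v \<alpha>) \<beta> x)"
  using contract_wedge[OF assms] by blast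

lemma wedge_assoc:
  fixes \<alpha> \<beta> \<gamma> :: "(nat \<Rightarrow> 'v::real_vector) \<Rightarrow> 'b::real_field"
  assumes "\<alpha> \<in> alt_forms p" "\<beta> \<in> alt_forms q" "\<gamma> \<in> alt_forms r"
  shows "wedge (p + q) r (wedge p q \<alpha> \<beta>) \<gamma> = wedge p (q + r) \<alpha> (wedge q r \<beta> \<gamma>)"
  using assms
proof (induction "p + q + r" arbitrary: p q r \<alpha> \<beta> \<gamma> rule: less_induct)
  case less
  note a = \<open>\<alpha> \<in> alt_forms p\<close> and b = \<open>\<beta> \<in> alt_forms q\<close> and c = \<open>\<gamma> \<in> alt_forms r\<close>
  note ab = wedge_in_alt_forms[OF a b] and bc = wedge_in_alt_forms[OF b c]
  show ?case
  proof (cases "p + q + r = 0")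
    case True
    then have "\<alpha> \<in> alt_forms 0" "\<beta> \<in> alt_forms 0" "\<gamma> \<in> alt_forms 0" "p = 0" "q = 0" "r = 0"
      using a b c by auto
    then show ?thesis
      using ab bc by (simp add: wedge_0_right mult.assoc fun_eq_iff)
  next
    case False
    show ?thesis
    proof (rule forms_eqI_contract)
      show "p + q + r > 0" using False by simp
      fix v x
      note ca = contract_in_alt_forms[OF a, of v] and cb = contract_in_alt_forms[OF b, of v]
        and cc = contract_in_alt_forms[OF c, of v]
      \<comment> \<open>The induction hypothesis needs a strictly smaller total degree. If the
        contracted factor has degree 0, the degrees do not drop, but then both sides vanish.\<close>
      have h1: "wedge (p + q) (r - 1) (wedge p q \<alpha> \<beta>) (contract r v \<gamma>)
        = wedge p (q + r - 1) \<alpha> (wedge q (r - 1) \<beta> (contract r v \<gamma>))"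
      proof (cases r)
        case 0
        then show ?thesis by (simp add: contract_0 wedge_zero_right)
      next
        case (Suc r')
        then show ?thesis using less.hyps[OF _ a b cc] by simp
      qed
      have h2: "wedge (p + q - 1) r (wedge p (q - 1) \<alpha> (contract q v \<beta>)) \<gamma>
        = wedge p (q + r - 1) \<alpha> (wedge (q - 1) r (contract q v \<beta>) \<gamma>)"
      proof (cases q)
        case 0
        then show ?thesis by (simp add: contract_0 wedge_zero_right wedge_zero_left)
      next
        case (Suc q')
        then show ?thesis using less.hyps[OF _ a cb c] by simp
      qed
      have h3: "wedge (p + q - 1) r (wedge (p - 1) q (contract p v \<alpha>) \<beta>) \<gamma>
        = wedge (p - 1) (q + r) (contract p v \<alpha>) (wedge q r \<beta> \<gamma>)"
      proof (cases p)
        case 0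
        then show ?thesis by (simp add: contract_0 wedge_zero_left)
      next
        case (Suc p')
        then show ?thesis using less.hyps[OF _ ca b c] by simp
      qed
      have "contract (p + q + r) v (wedge (p + q) r (wedge p q \<alpha> \<beta>) \<gamma>) x =
        wedge p (q + r - 1) \<alpha> (wedge q (r - 1) \<beta> (contract r v \<gamma>)) x +
        (-1) ^ r * (wedge p (q + r - 1) \<alpha> (wedge (q - 1) r (contract q v \<beta>) \<gamma>) x +
          (-1) ^ q * wedge (p - 1) (q + r) (contract p v \<alpha>) (wedge q r \<beta> \<gamma>) x)"
        unfolding contract_wedge[OF ab c] contract_wedge_fun[OF a b] wedge_add_left wedge_scale_left
          h1 h2 h3 ..
      also have "\<dots> = contract (p + (q + r)) v (wedge p (q + r) \<alpha> (wedge q r \<beta> \<gamma>)) x"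
        unfolding contract_wedge[OF a bc] contract_wedge_fun[OF b c] wedge_add_right wedge_scale_right
        by (simp add: power_add algebra_simps)
      finally show "contract (p + q + r) v (wedge (p + q) r (wedge p q \<alpha> \<beta>) \<gamma>) x =
        contract (p + q + r) v (wedge p (q + r) \<alpha> (wedge q r \<beta> \<gamma>)) x"
        by (simp add: add.assoc)
    qed
  qed
qed

lemma wedge_commute:
  fixes \<alpha> \<beta> :: "(nat \<Rightarrow> 'v::real_vector) \<Rightarrow> 'b::real_field"
  assumes "\<alpha> \<in> alt_forms p" "\<beta> \<in> alt_forms q"
  shows "wedge p q \<alpha> \<beta> = (\<lambda>x. (-1) ^ (p * q) * wedge q p \<beta> \<alpha> x)"
  using assms
proof (induction "p + q" arbitrary: p q \<alpha> \<beta> rule: less_induct)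
  case less
  note a = \<open>\<alpha> \<in> alt_forms p\<close> and b = \<open>\<beta> \<in> alt_forms q\<close>
  show ?case
  proof (cases "p + q = 0")
    case True
    then have "\<alpha> \<in> alt_forms 0" "\<beta> \<in> alt_forms 0" "p = 0" "q = 0"
      using a b by auto
    then show ?thesis by (simp add: wedge_0_right mult.commute fun_eq_iff)
  next
    case False
    show ?thesis
    proof (rule forms_eqI_contract)
      show "p + q > 0" using False by simp
      fix v x
      note ca = contract_in_alt_forms[OF a, of v] and cb = contract_in_alt_forms[OF b, of v]
      have h1: "wedge p (q - 1) \<alpha> (contract q v \<beta>) x
        = (-1) ^ (p * q + p) * wedge (q - 1) p (contract q v \<beta>) \<alpha> x"
      proof (cases q)
        case 0
        then show ?thesis by (simp add: contract_0 wedge_zero_right wedge_zero_left)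
      next
        case (Suc q')
        then show ?thesis using less.hyps[OF _ a cb] by (simp add: power_add)
      qed
      have h2: "wedge (p - 1) q (contract p v \<alpha>) \<beta> x
        = (-1) ^ (p * q + q) * wedge q (p - 1) \<beta> (contract p v \<alpha>) x"
      proof (cases p)
        case 0
        then show ?thesis by (simp add: contract_0 wedge_zero_right wedge_zero_left)
      next
        case (Suc p')
        then show ?thesis using less.hyps[OF _ ca b] by (simp add: power_add)
      qed
      have "contract (p + q) v (\<lambda>x. (-1) ^ (p * q) * wedge q p \<beta> \<alpha> x) x
        = (-1) ^ (p * q) * contract (q + p) v (wedge q p \<beta> \<alpha>) x"
        using False by (auto simp: contract_def add.commute)
      then show "contract (p + q) v (wedge p q \<alpha> \<beta>) x
        = contract (p + q) v (\<lambda>x. (-1) ^ (p * q) * wedge q p \<beta> \<alpha> x) x"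
        unfolding contract_wedge[OF a b] contract_wedge[OF b a] h1 h2
        by (simp add: power_add algebra_simps)
    qed
  qed
qed

lemma wedge_commute_even:
  fixes \<alpha> \<beta> :: "(nat \<Rightarrow> 'v::real_vector) \<Rightarrow> 'b::real_field"
  assumes "\<alpha> \<in> alt_forms p" "\<beta> \<in> alt_forms q" "even p \<or> even q"
  shows "wedge p q \<alpha> \<beta> = wedge q p \<beta> \<alpha>"
  using wedge_commute[OF assms(1,2)] assms(3) by (auto simp: fun_eq_iff)

lemma wedge_0_left:
  fixes \<alpha> \<beta> :: "(nat \<Rightarrow> 'v::real_vector) \<Rightarrow> 'b::real_field"
  assumes a: "\<alpha> \<in> alt_forms 0" and b: "\<beta> \<in> alt_forms q"
  shows "wedge 0 q \<alpha> \<beta> x = \<alpha> x * \<beta> x"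
  using wedge_commute_even[OF a b] wedge_0_right[OF b a] by simp

section \<open>Iterated products and powers\<close>

lemma wedge_list_in_alt_forms:
  "set \<alpha>s \<subseteq> alt_forms d \<Longrightarrow> wedge_list d \<alpha>s \<in> alt_forms (d * length \<alpha>s)"
  using wedge_in_alt_forms
  by (induction \<alpha>s) (auto simp: const_in_alt_forms)

lemma wedge_list_append:
  assumes "set \<alpha>s \<subseteq> alt_forms d" "set \<beta>s \<subseteq> alt_forms d"
  shows "wedge_list d (\<alpha>s @ \<beta>s) =
    wedge (d * length \<alpha>s) (d * length \<beta>s) (wedge_list d \<alpha>s) (wedge_list d \<beta>s)"
  using assms(1)
proof (induction \<alpha>s)
  case Nil
  then show ?case
    using wedge_list_in_alt_forms[OF assms(2)] by (simp add: wedge_0_left[OF const_in_alt_forms] fun_eq_iff)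
next
  case (Cons \<alpha> \<alpha>s)
  then show ?case
    using wedge_assoc[of \<alpha> d "wedge_list d \<alpha>s" "d * length \<alpha>s" "wedge_list d \<beta>s" "d * length \<beta>s"]
      wedge_list_in_alt_forms[of \<alpha>s d] wedge_list_in_alt_forms[OF assms(2)]
    by (simp add: add_mult_distrib2)
qed

lemma pullback_wedge_list: "pullback f (wedge_list d \<alpha>s) = wedge_list d (map (pullback f) \<alpha>s)"
proof (induction \<alpha>s)
  case Nil
  show ?case by (simp add: pullback_def)
qed (simp add: pullback_wedge)

lemma pullback_wedge_power: "pullback f (wedge_power d \<alpha> m) = wedge_power d (pullback f \<alpha>) m"
  by (simp add: wedge_power_def pullback_wedge_list)

lemma wedge_power_in_alt_forms: "\<alpha> \<in> alt_forms d \<Longrightarrow> wedge_power d \<alpha> m \<in> alt_forms (d * m)"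
  using wedge_list_in_alt_forms[of "replicate m \<alpha>" d] set_replicate_conv_if[of m \<alpha>]
  by (simp add: wedge_power_def split: if_splits)

lemma wedge_power_0: "wedge_power d \<alpha> 0 = (\<lambda>x. 1)"
  by (simp add: wedge_power_def)

lemma wedge_power_Suc: "wedge_power d \<alpha> (Suc m) = wedge d (d * m) \<alpha> (wedge_power d \<alpha> m)"
  by (simp add: wedge_power_def)

text \<open>The binomial theorem holds because forms of even degree commute; the induction step is
  Pascal's rule.\<close>

lemma wedge_power_add:
  fixes \<alpha> \<beta> :: "(nat \<Rightarrow> 'v::real_vector) \<Rightarrow> 'b::real_field"
  assumes a: "\<alpha> \<in> alt_forms 2" and b: "\<beta> \<in> alt_forms 2"
  shows "wedge_power 2 (\<lambda>x. \<alpha> x + \<beta> x) m x = (\<Sum>i\<le>m. of_nat (m choose i) *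
    wedge (2 * i) (2 * (m - i)) (wedge_power 2 \<alpha> i) (wedge_power 2 \<beta> (m - i)) x)"
proof (induction m arbitrary: x)
  case 0
  then show ?case
    by (simp add: wedge_power_0 wedge_0_right[OF const_in_alt_forms const_in_alt_forms])
next
  case (Suc m)
  note pa = wedge_power_in_alt_forms[OF a] and pb = wedge_power_in_alt_forms[OF b]
  define g where "g i = wedge (2 * i) (2 * (Suc m - i)) (wedge_power 2 \<alpha> i) (wedge_power 2 \<beta> (Suc m - i)) x" for i
  have l: "wedge 2 (2 * m) \<alpha> (wedge (2 * i) (2 * (m - i)) (wedge_power 2 \<alpha> i) (wedge_power 2 \<beta> (m - i))) x
      = g (Suc i)" if "i \<le> m" for i
  proof -
    have "2 * i + 2 * (m - i) = 2 * m" using that by simp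
    then show ?thesis
      using wedge_assoc[OF a pa pb, of i "m - i"] by (simp add: g_def wedge_power_Suc)
  qed
  have r: "wedge 2 (2 * m) \<beta> (wedge (2 * i) (2 * (m - i)) (wedge_power 2 \<alpha> i) (wedge_power 2 \<beta> (m - i))) x
      = g i" if i: "i \<le> m" for i
  proof -
    have e: "2 * i + 2 * (m - i) = 2 * m" using i by simp
    have "wedge 2 (2 * m) \<beta> (wedge (2 * i) (2 * (m - i)) (wedge_power 2 \<alpha> i) (wedge_power 2 \<beta> (m - i)))
        = wedge (2 + 2 * i) (2 * (m - i)) (wedge 2 (2 * i) \<beta> (wedge_power 2 \<alpha> i)) (wedge_power 2 \<beta> (m - i))"
      using wedge_assoc[OF b pa pb, of i "m - i"] e by simp
    also have "wedge 2 (2 * i) \<beta> (wedge_power 2 \<alpha> i) = wedge (2 * i) 2 (wedge_power 2 \<alpha> i) \<beta>"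
      by (rule wedge_commute_even[OF b pa]) simp
    also have "wedge (2 + 2 * i) (2 * (m - i)) (wedge (2 * i) 2 (wedge_power 2 \<alpha> i) \<beta>) (wedge_power 2 \<beta> (m - i))
        = wedge (2 * i) (2 + 2 * (m - i)) (wedge_power 2 \<alpha> i) (wedge_power 2 \<beta> (Suc (m - i)))"
      using wedge_assoc[OF pa b pb, of i "m - i"] by (simp add: wedge_power_Suc add.commute)
    finally show ?thesis using i by (simp add: g_def Suc_diff_le)
  qed
  have eq: "wedge_power 2 (\<lambda>x. \<alpha> x + \<beta> x) m = (\<lambda>x. \<Sum>i\<le>m. of_nat (m choose i) *
    wedge (2 * i) (2 * (m - i)) (wedge_power 2 \<alpha> i) (wedge_power 2 \<beta> (m - i)) x)"
    using Suc.IH by (rule ext)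
  have "wedge_power 2 (\<lambda>x. \<alpha> x + \<beta> x) (Suc m) x
      = (\<Sum>i\<le>m. of_nat (m choose i) * g (Suc i)) + (\<Sum>i\<le>m. of_nat (m choose i) * g i)"
    unfolding wedge_power_Suc eq wedge_add_left wedge_sum_right wedge_scale_right
    by (intro arg_cong2[where f = "(+)"] sum.cong refl) (simp_all add: l r)
  also have "(\<Sum>i\<le>m. of_nat (m choose i) * g i) = (\<Sum>i\<le>Suc m. of_nat (m choose i) * g i)"
    by simp
  also have "\<dots> = g 0 + (\<Sum>i\<le>m. of_nat (m choose Suc i) * g (Suc i))"
    by (subst sum.atMost_Suc_shift) simp
  also have "(\<Sum>i\<le>m. of_nat (m choose i) * g (Suc i)) + (g 0 + (\<Sum>i\<le>m. of_nat (m choose Suc i) * g (Suc i)))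
      = g 0 + (\<Sum>i\<le>m. of_nat (Suc m choose Suc i) * g (Suc i))"
    by (simp add: sum.distrib distrib_right)
  also have "\<dots> = (\<Sum>i\<le>Suc m. of_nat (Suc m choose i) * g i)"
    by (subst sum.atMost_Suc_shift) simp
  finally show ?case by (simp add: g_def)
qed

section \<open>Dual bases and Poincare duality\<close>

text \<open>The basis is kept as an indexed family together with its coordinate functionals, because
  a top form is evaluated on the family itself and its sign depends on the order.\<close>

definition dual_basis :: "nat \<Rightarrow> (nat \<Rightarrow> 'v::real_vector) \<Rightarrow> (nat \<Rightarrow> 'v \<Rightarrow> real) \<Rightarrow> bool" where
  "dual_basis d b e \<longleftrightarrow> (\<forall>i<d. linear (e i)) \<and>
     (\<forall>i<d. \<forall>j<d. e i (b j) = (if i = j then 1 else 0)) \<and> (\<forall>v. v = (\<Sum>i<d. e i v *\<^sub>R b i))"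

lemma dual_basisD:
  assumes "dual_basis d b e"
  shows "i < d \<Longrightarrow> linear (e i)" and "i < d \<Longrightarrow> j < d \<Longrightarrow> e i (b j) = (if i = j then 1 else 0)"
    and "v = (\<Sum>i<d. e i v *\<^sub>R b i)"
  using assms unfolding dual_basis_def by blast+

lemma dual_basis_exists:
  fixes b :: "nat \<Rightarrow> 'v::real_vector"
  assumes dim: "dim (UNIV :: 'v set) = d" and d: "d > 0"
    and inj: "inj_on b {..<d}" and ind: "independent (b ` {..<d})"
  obtains e where "dual_basis d b e"
proof -
  let ?B = "b ` {..<d}"
  obtain C :: "'v set" where C: "independent C" "UNIV \<subseteq> span C" "card C = dim (UNIV :: 'v set)"
    by (rule real_vector.basis_exists[of UNIV])
  \<comment> \<open>Positivity of \<open>d\<close> excludes the infinite-dimensional case, in which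
    \<open>dim\<close> takes the default value 0.\<close>
  then have fin: "finite C" using dim d by (metis card.infinite less_nat_zero_code)
  have cB: "card ?B = d" using inj by (simp add: card_image)
  have span: "span ?B = UNIV"
  proof (rule ccontr)
    assume "span ?B \<noteq> UNIV"
    then obtain v where v: "v \<notin> span ?B" by auto
    then have "independent (insert v ?B)" using ind by (simp add: independent_insert)
    moreover have "insert v ?B \<subseteq> span C" using C by auto
    ultimately have "card (insert v ?B) \<le> card C"
      using independent_span_bound[OF fin] by fast
    moreover have "v \<notin> ?B" using v span_superset[of ?B] by fast
    ultimately show False using cB C(3) dim by simp
  qed
  define e where "e i v = representation ?B v (b i)" for i v
  have "dual_basis d b e"
    unfolding dual_basis_def
  proof (intro conjI allI impI)
    show "linear (e i)" for i
      unfolding e_def linear_iff using ind span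
      by (simp add: representation_add representation_scale)
    show "e i (b j) = (if i = j then 1 else 0)" if "i < d" "j < d" for i j
      using ind that inj by (auto simp: e_def representation_basis inj_on_eq_iff)
    show "v = (\<Sum>i<d. e i v *\<^sub>R b i)" for v
    proof -
      have "(\<Sum>w\<in>?B. representation ?B v w *\<^sub>R w) = v"
        using ind span by (intro sum_representation_eq) auto
      then show ?thesis using inj by (simp add: sum.reindex e_def)
    qed
  qed
  then show ?thesis using that by blast
qed

lemma contract_expand:
  fixes \<alpha> :: "(nat \<Rightarrow> 'v::real_vector) \<Rightarrow> real"
  assumes b: "dual_basis d b e" and a: "\<alpha> \<in> alt_forms k"
  shows "contract k v \<alpha> x = (\<Sum>i<d. e i v * contract k (b i) \<alpha> x)"
proof (cases k)
  case 0
  then show ?thesis by (simp add: contract_0)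
next
  case (Suc m)
  have l: "linear (\<lambda>v. \<alpha> (x(m := v)))" using alt_forms_linear[OF a] Suc by simp
  have "\<alpha> (x(m := v)) = \<alpha> (x(m := \<Sum>i<d. e i v *\<^sub>R b i))"
    using dual_basisD(3)[OF b, of v] by simp
  also have "\<dots> = (\<Sum>i<d. e i v * \<alpha> (x(m := b i)))"
    by (simp only: linear_sum[OF l] linear_scale[OF l] real_scaleR_def)
  finally show ?thesis using Suc by (simp add: contract_def)
qed

lemma alt_forms_eq_0_basis:
  fixes \<alpha> :: "(nat \<Rightarrow> 'v::real_vector) \<Rightarrow> real"
  assumes b: "dual_basis d b e" and "\<alpha> \<in> alt_forms k"
    and "\<And>g. (\<And>i. i < k \<Longrightarrow> g i < d) \<Longrightarrow> \<alpha> (\<lambda>i. b (g i)) = 0"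
  shows "\<alpha> = (\<lambda>x. 0)"
  using assms(2,3)
proof (induction k arbitrary: \<alpha>)
  case 0
  have "\<alpha> (\<lambda>i. b i) = 0" using 0(2)[of "\<lambda>i. i"] by simp
  then show ?case using alt_forms_0[OF 0(1), of _ "\<lambda>i. b i"] by auto
next
  case (Suc k)
  have "contract (Suc k) (b j) \<alpha> = (\<lambda>x. 0)" if j: "j < d" for j
  proof (rule Suc.IH)
    show "contract (Suc k) (b j) \<alpha> \<in> alt_forms k"
      using contract_in_alt_forms[OF Suc.prems(1)] by simp
    fix g :: "nat \<Rightarrow> nat" assume g: "\<And>i. i < k \<Longrightarrow> g i < d"
    have "(\<lambda>i. b (g i))(k := b j) = (\<lambda>i. b ((g(k := j)) i))" by auto
    moreover have "\<alpha> (\<lambda>i. b ((g(k := j)) i)) = 0"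
      using g j by (intro Suc.prems(2)) (auto simp: less_Suc_eq)
    ultimately show "contract (Suc k) (b j) \<alpha> (\<lambda>i. b (g i)) = 0"
      by (simp add: contract_def)
  qed
  then have "contract (Suc k) v \<alpha> x = 0" for v x
    by (simp add: contract_expand[OF b Suc.prems(1)])
  then have "contract (Suc k) (x k) \<alpha> x = 0" for x by blast
  then show ?case by (simp add: contract_def)
qed

text \<open>Top forms are one-dimensional: a choice of \<open>d\<close> members of the basis either
  repeats one of them or is a permutation of all.\<close>

lemma top_form_eq_0:
  fixes \<alpha> :: "(nat \<Rightarrow> 'v::real_vector) \<Rightarrow> real"
  assumes b: "dual_basis d b e" and a: "\<alpha> \<in> alt_forms d" and z: "\<alpha> b = 0"
  shows "\<alpha> = (\<lambda>x. 0)"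
proof (rule alt_forms_eq_0_basis[OF b a])
  fix g assume g: "\<And>i. i < d \<Longrightarrow> g i < d"
  show "\<alpha> (\<lambda>i. b (g i)) = 0"
  proof (cases "inj_on g {..<d}")
    case True
    \<comment> \<open>\<open>g\<close> is arbitrary beyond \<open>d\<close>; \<open>permutes\<close>
      demands the identity there.\<close>
    define h where "h i = (if i < d then g i else i)" for i
    have "h ` {..<d} \<subseteq> {..<d}" using g by (auto simp: h_def)
    moreover have "inj_on h {..<d}" using True by (auto simp: h_def inj_on_def)
    ultimately have "bij_betw h {..<d} {..<d}"
      by (simp add: bij_betw_def endo_inj_surj)
    then have h: "h permutes {..<d}"
      by (rule bij_imp_permutes) (simp add: h_def)
    have "\<alpha> (\<lambda>i. b (g i)) = \<alpha> (\<lambda>i. b (h i))"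
      by (rule alt_forms_cong[OF a]) (simp add: h_def)
    then show ?thesis using alt_forms_permute[OF a h, of b] z by simp
  next
    case False
    then obtain i j where "i < d" "j < d" "i \<noteq> j" "g i = g j"
      by (auto simp: inj_on_def)
    then show ?thesis by (intro alt_forms_alt[OF a, of i j]) auto
  qed
qed

lemma contract_wedge_list_one_forms:
  assumes "\<And>l. l \<in> set ls \<Longrightarrow> linear l" and "\<And>l. l \<in> set ls \<Longrightarrow> l v = 0"
  shows "contract (length ls) v (wedge_list 1 (map one_form ls)) = (\<lambda>x. 0)"
  using assms
proof (induction ls)
  case Nil
  then show ?case by (simp add: contract_0)
next
  case (Cons l ls)
  have l: "one_form l \<in> alt_forms 1" using Cons.prems by (intro one_form_in_alt_forms) auto
  have ls: "wedge_list 1 (map one_form ls) \<in> alt_forms (length ls)"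
    using wedge_list_in_alt_forms[of "map one_form ls" 1] Cons.prems one_form_in_alt_forms by auto
  have "contract 1 v (one_form l) = (\<lambda>x. 0)"
    using Cons.prems(2)[of l] by (simp add: contract_def one_form_def)
  then show ?case
    using contract_wedge_fun[OF l ls, of v] Cons by (simp add: wedge_zero_left wedge_zero_right)
qed

text \<open>The factors are listed in reverse because contraction acts on the last argument.\<close>

lemma wedge_list_dual_basis:
  assumes b: "dual_basis d b e"
  shows "wedge_list 1 (map (\<lambda>i. one_form (e i)) (rev [0..<d])) b \<in> {1, -1}"
proof -
  have "m \<le> d \<Longrightarrow> wedge_list 1 (map (\<lambda>i. one_form (e i)) (rev [0..<m])) b \<in> {1, -1}" for m
  proof (induction m)
    case (Suc m)
    define X where "X = wedge_list 1 (map one_form (map e (rev [0..<m])))"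
    have em: "one_form (e m) \<in> alt_forms 1"
      using Suc.prems dual_basisD(1)[OF b] by (intro one_form_in_alt_forms) auto
    have X: "X \<in> alt_forms m"
    proof -
      have "set (map one_form (map e (rev [0..<m]))) \<subseteq> alt_forms 1"
        using Suc.prems dual_basisD(1)[OF b]
        by (auto intro!: one_form_in_alt_forms simp del: One_nat_def)
      from wedge_list_in_alt_forms[OF this] show ?thesis by (simp add: X_def)
    qed
    have "contract (length (map e (rev [0..<m]))) (b m) X = (\<lambda>x. 0)"
      unfolding X_def by (rule contract_wedge_list_one_forms) (use Suc.prems dual_basisD(1,2)[OF b] in auto)
    then have "contract m (b m) X = (\<lambda>x. 0)" by simp
    moreover have "contract 1 (b m) (one_form (e m)) = (\<lambda>x. 1)"
      using dual_basisD(2)[OF b, of m m] Suc.prems by (simp add: contract_def one_form_def)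
    \<comment> \<open>By the product rule the contraction with \<open>b m\<close> can only hit the
      leading factor, since the remaining functionals vanish on \<open>b m\<close>.\<close>
    ultimately have "contract (1 + m) (b m) (wedge 1 m (one_form (e m)) X) b = (-1) ^ m * X b"
      using contract_wedge[OF em X, of "b m" b]
      by (simp add: wedge_zero_right wedge_0_left[OF const_in_alt_forms X] del: One_nat_def)
    then have "wedge 1 m (one_form (e m)) X b = (-1) ^ m * X b"
      by (simp add: contract_def)
    moreover have "X b \<in> {1, -1}" using Suc by (simp add: X_def comp_def)
    ultimately show ?case by (cases "even m") (auto simp: X_def comp_def)
  qed simp
  then show ?thesis by blast
qed

text \<open>The next two identities are analogues of Euler's formula for homogeneous polynomials. The
  second one shows that a form below the top degree vanishes once its products with all 1-forms do.\<close>

lemma sum_contract_wedge_dual: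
  fixes \<gamma> :: "(nat \<Rightarrow> 'v::real_vector) \<Rightarrow> real"
  assumes b: "dual_basis d b e" and "\<gamma> \<in> alt_forms k"
  shows "(\<Sum>i<d. wedge (k - 1) 1 (contract k (b i) \<gamma>) (one_form (e i)) x) = of_nat k * \<gamma> x"
  using assms(2)
proof (induction k arbitrary: \<gamma> x)
  case 0
  then show ?case by (simp add: contract_0 wedge_zero_left)
next
  case (Suc k)
  note g = Suc.prems
  have e: "one_form (e i) \<in> alt_forms 1" if "i < d" for i
    using that dual_basisD(1)[OF b] by (intro one_form_in_alt_forms) auto
  have c: "contract (Suc k) v \<gamma> \<in> alt_forms k" for v
    using contract_in_alt_forms[OF g, of v] by simp
  \<comment> \<open>Contractions anticommute. This lets the contraction with \<open>v\<close> pass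
    to the inside, where the induction hypothesis applies to
    \<open>contract (Suc k) v \<gamma>\<close>.\<close>
  have anti: "contract k v (contract (Suc k) w \<gamma>) = (\<lambda>x. - contract k w (contract (Suc k) v \<gamma>) x)" for v w
  proof
    fix x
    show "contract k v (contract (Suc k) w \<gamma>) x = - contract k w (contract (Suc k) v \<gamma>) x"
    proof (cases k)
      case 0
      then show ?thesis by (simp add: contract_0)
    next
      case (Suc m)
      let ?y = "x(m := v, k := w)"
      have eq: "(\<lambda>l. ?y (Transposition.transpose m k l)) = x(m := w, k := v)"
        using Suc by (auto simp: fun_eq_iff Transposition.transpose_def)
      have "\<gamma> (\<lambda>l. ?y (Transposition.transpose m k l)) = - \<gamma> ?y"
        by (rule alt_forms_transpose[OF g]) (use Suc in auto)
      then show ?thesis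
        unfolding eq using Suc by (simp add: contract_def)
    qed
  qed
  let ?L = "\<lambda>x. \<Sum>i<d. wedge k 1 (contract (Suc k) (b i) \<gamma>) (one_form (e i)) x"
  have L: "?L \<in> alt_forms (Suc k)"
    using wedge_in_alt_forms[OF c e] by (intro sum_in_alt_forms) auto
  have cL: "contract (Suc k) v ?L x = of_nat (Suc k) * contract (Suc k) v \<gamma> x" for v x
  proof -
    have "contract (Suc k) v ?L x
        = (\<Sum>i<d. contract (k + 1) v (wedge k 1 (contract (Suc k) (b i) \<gamma>) (one_form (e i))) x)"
      by (simp add: contract_def)
    \<comment> \<open>Contracting the 1-form gives the coordinate \<open>e i v\<close>, and these
      terms add up to one copy of the contraction of \<open>\<gamma>\<close>; the other terms give
      \<open>k\<close> further copies by induction.\<close>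
    also have "\<dots> = (\<Sum>i<d. e i v * contract (Suc k) (b i) \<gamma> x
        + wedge (k - 1) 1 (contract k (b i) (contract (Suc k) v \<gamma>)) (one_form (e i)) x)"
    proof (intro sum.cong refl)
      fix i assume "i \<in> {..<d}"
      then have e: "one_form (e i) \<in> alt_forms 1" using e by simp
      have "contract 1 v (one_form (e i)) = (\<lambda>x. e i v)"
        by (simp add: contract_def one_form_def)
      moreover have "wedge (k - 1) 1 (contract k v (contract (Suc k) (b i) \<gamma>)) (one_form (e i))
          = (\<lambda>x. - wedge (k - 1) 1 (contract k (b i) (contract (Suc k) v \<gamma>)) (one_form (e i)) x)"
        unfolding anti[of v] using wedge_scale_left[of "k - 1" 1 "-1"] by simp
      ultimately show "contract (k + 1) v (wedge k 1 (contract (Suc k) (b i) \<gamma>) (one_form (e i))) x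
        = e i v * contract (Suc k) (b i) \<gamma> x
        + wedge (k - 1) 1 (contract k (b i) (contract (Suc k) v \<gamma>)) (one_form (e i)) x"
        unfolding contract_wedge[OF c e] by (simp add: wedge_0_right[OF c const_in_alt_forms] mult.commute)
    qed
    also have "\<dots> = contract (Suc k) v \<gamma> x + of_nat k * contract (Suc k) v \<gamma> x"
      using contract_expand[OF b g, of v x] Suc.IH[OF c] by (simp add: sum.distrib)
    finally show ?thesis by (simp add: distrib_right)
  qed
  have "?L x = contract (Suc k) (x k) ?L x"
    by (simp add: contract_def)
  also have "\<dots> = of_nat (Suc k) * \<gamma> x"
    unfolding cL by (simp add: contract_def)
  finally show ?case by simp
qed

lemma sum_wedge_dual_contract:
  fixes \<gamma> :: "(nat \<Rightarrow> 'v::real_vector) \<Rightarrow> real"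
  assumes b: "dual_basis d b e" and g: "\<gamma> \<in> alt_forms k"
  shows "(\<Sum>i<d. contract (k + 1) (b i) (wedge k 1 \<gamma> (one_form (e i))) x) = (of_nat d - of_nat k) * \<gamma> x"
proof -
  have "contract (k + 1) (b i) (wedge k 1 \<gamma> (one_form (e i))) x
      = \<gamma> x - wedge (k - 1) 1 (contract k (b i) \<gamma>) (one_form (e i)) x" if i: "i < d" for i
  proof -
    have e: "one_form (e i) \<in> alt_forms 1"
      using i dual_basisD(1)[OF b] by (intro one_form_in_alt_forms) auto
    have "contract 1 (b i) (one_form (e i)) = (\<lambda>x. 1)"
      using dual_basisD(2)[OF b i i] by (simp add: contract_def one_form_def)
    then show ?thesis
      unfolding contract_wedge[OF g e] by (simp add: wedge_0_right[OF g const_in_alt_forms])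
  qed
  then show ?thesis
    using sum_contract_wedge_dual[OF b g, of x] by (simp add: sum_subtractf left_diff_distrib)
qed

text \<open>Poincare duality, by descending induction on the degree: the product of
  \<open>\<gamma>\<close> with a 1-form has the same property one degree higher, hence vanishes, and
  \<open>sum_wedge_dual_contract\<close> recovers \<open>(d - m) \<gamma>\<close> from these
  products.\<close>

lemma wedge_nondegenerate:
  fixes \<gamma> :: "(nat \<Rightarrow> 'v::real_vector) \<Rightarrow> real"
  assumes b: "dual_basis d b e" and "\<gamma> \<in> alt_forms m" "m \<le> d"
    and "\<And>u. u \<in> alt_forms (d - m) \<Longrightarrow> wedge m (d - m) \<gamma> u b = 0"
  shows "\<gamma> = (\<lambda>x. 0)"
  using assms(3,2,4)
proof (induction arbitrary: \<gamma> rule: inc_induct)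
  case base
  have "wedge d 0 \<gamma> (\<lambda>x. 1) b = 0"
    using base(2)[of "\<lambda>x. 1"] by (simp add: const_in_alt_forms)
  then have "\<gamma> b = 0"
    by (simp add: wedge_0_right[OF base(1) const_in_alt_forms])
  then show ?case by (rule top_form_eq_0[OF b base(1)])
next
  case (step m)
  have "wedge m 1 \<gamma> (one_form (e i)) = (\<lambda>x. 0)" if i: "i < d" for i
  proof (rule step.IH)
    have e: "one_form (e i) \<in> alt_forms 1"
      using i dual_basisD(1)[OF b] by (intro one_form_in_alt_forms) auto
    show "wedge m 1 \<gamma> (one_form (e i)) \<in> alt_forms (Suc m)"
      using wedge_in_alt_forms[OF step.prems(1) e] by simp
    fix u :: "(nat \<Rightarrow> 'v) \<Rightarrow> real" assume u: "u \<in> alt_forms (d - Suc m)"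
    have "wedge (m + 1) (d - Suc m) (wedge m 1 \<gamma> (one_form (e i))) u
        = wedge m (1 + (d - Suc m)) \<gamma> (wedge 1 (d - Suc m) (one_form (e i)) u)"
      by (rule wedge_assoc[OF step.prems(1) e u])
    moreover have "1 + (d - Suc m) = d - m" using step.hyps by simp
    ultimately show "wedge (Suc m) (d - Suc m) (wedge m 1 \<gamma> (one_form (e i))) u b = 0"
      using step.prems(2)[of "wedge 1 (d - Suc m) (one_form (e i)) u"] wedge_in_alt_forms[OF e u] by simp
  qed
  then have "(of_nat d - of_nat m) * \<gamma> x = 0" for x
    using sum_wedge_dual_contract[OF b step.prems(1), of x] by (simp add: contract_def)
  then show ?case using step.hyps by (auto simp: fun_eq_iff)
qed

section \<open>Hodge classes\<close>

lemma wedge_one_forms: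
  fixes a b :: "'v::real_vector \<Rightarrow> 'b::real_field"
  assumes "linear a" "linear b"
  shows "wedge 1 1 (one_form a) (one_form b) x = a (x 0) * b (x 1) - a (x 1) * b (x 0)"
proof -
  note A = one_form_in_alt_forms[OF assms(1)] and B = one_form_in_alt_forms[OF assms(2)]
  have cA: "contract 1 (x 1) (one_form a) = (\<lambda>_. a (x 1))"
    and cB: "contract 1 (x 1) (one_form b) = (\<lambda>_. b (x 1))"
    by (simp_all add: contract_def one_form_def)
  have "wedge 1 1 (one_form a) (one_form b) x = contract (1 + 1) (x 1) (wedge 1 1 (one_form a) (one_form b)) x"
    by (simp add: contract_def)
  also have "\<dots> = a (x 0) * b (x 1) - a (x 1) * b (x 0)"
    unfolding contract_wedge[OF A B] cA cB
    by (simp add: wedge_0_right[OF A const_in_alt_forms] wedge_0_left[OF const_in_alt_forms B] del: One_nat_def)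
      (simp add: one_form_def)
  finally show ?thesis .
qed

lemma wedge_list_two_one_forms:
  fixes a b :: "'v::real_vector \<Rightarrow> 'b::real_field"
  assumes "linear a" "linear b"
  shows "wedge_list 1 (map one_form ([a] @ [b])) = wedge 1 1 (one_form a) (one_form b)"
proof -
  have "wedge 1 0 (one_form b) (\<lambda>x. 1) = one_form b"
    using wedge_0_right[OF one_form_in_alt_forms[OF assms(2)] const_in_alt_forms] by (simp add: fun_eq_iff)
  then show ?thesis by simp
qed

text \<open>On a generator the factors \<open>\<i>\<close> and \<open>- \<i>\<close> multiply to
  1.\<close>

lemma type_forms_11_invariant:
  assumes "\<beta> \<in> type_forms J 1 1"
  shows "\<beta> (\<lambda>i. J (x i)) = \<beta> x"
  using assms unfolding type_forms_def
proof (induction rule: fun_space.span_induct)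
  case base
  show ?case
    by (auto simp: fun_space.subspace_def)
next
  case (step \<beta>)
  then obtain a b where ab: "\<beta> = wedge_list 1 (map one_form ([a] @ [b]))"
    "linear a" "\<And>x. a (J x) = \<i> * a x" "linear b" "\<And>x. b (J x) = - \<i> * b x"
    by (auto simp: length_Suc_conv)
  show ?case
    unfolding ab(1) wedge_list_two_one_forms[OF ab(2,4)] wedge_one_forms[OF ab(2,4)] ab(3,5)
    by (simp add: algebra_simps)
qed

lemma type_forms_add: "\<alpha> \<in> type_forms J p q \<Longrightarrow> \<beta> \<in> type_forms J p q \<Longrightarrow> (\<lambda>x. \<alpha> x + \<beta> x) \<in> type_forms J p q"
  unfolding type_forms_def using fun_space.span_add[of \<alpha> _ \<beta>] by (simp add: plus_fun_def)

lemma type_forms_scale: "\<alpha> \<in> type_forms J p q \<Longrightarrow> (\<lambda>x. c * \<alpha> x) \<in> type_forms J p q"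
  unfolding type_forms_def by (rule fun_space.span_scale)

lemma type_forms_zero: "(\<lambda>x. 0) \<in> type_forms J p q"
  unfolding type_forms_def using fun_space.span_zero by (simp add: zero_fun_def)

lemma type_forms_sum:
  "(\<And>i. i \<in> I \<Longrightarrow> \<alpha> i \<in> type_forms J p q) \<Longrightarrow> (\<lambda>x. \<Sum>i\<in>I. \<alpha> i x) \<in> type_forms J p q"
  by (induction I rule: infinite_finite_induct) (simp_all add: type_forms_zero type_forms_add)

text \<open>The average of a product of real 1-forms over \<open>J\<close> has type (1,1). With
  \<open>a h\<close> and \<open>b h\<close> the C-linear and antilinear parts of \<open>h\<close>
  (up to the factor 2), the imaginary parts cancel in the antisymmetrized product of
  \<open>a\<close> and \<open>b\<close>, and twice the average-type sum remains.\<close>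

lemma type_forms_wedge_invariant:
  fixes J :: "'a::real_vector \<Rightarrow> 'a"
  assumes J: "complex_structure J" and l: "linear l" and m: "linear m"
  shows "(\<lambda>x. complex_of_real (wedge 1 1 (one_form l) (one_form m) x
      + wedge 1 1 (one_form l) (one_form m) (\<lambda>i. J (x i)))) \<in> type_forms J 1 1"
proof -
  have JJ: "J (J x) = - x" for x using J by (simp add: complex_structure_def)
  have Jl: "linear J" using J by (simp add: complex_structure_def)
  define a where "a h x = complex_of_real (h x) - \<i> * complex_of_real (h (J x))" for h :: "'a \<Rightarrow> real" and x
  define b where "b h x = complex_of_real (h x) + \<i> * complex_of_real (h (J x))" for h :: "'a \<Rightarrow> real" and x
  have la: "linear (a h)" and lb: "linear (b h)" if h: "linear h" for h
    using linear_compose[OF Jl h] h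
    unfolding a_def b_def linear_iff by (auto simp: algebra_simps scaleR_conv_of_real)
  have aJ: "a h (J x) = \<i> * a h x" and bJ: "b h (J x) = - \<i> * b h x" if h: "linear h" for h x
    using linear_neg[OF h] by (auto simp: a_def b_def JJ algebra_simps)
  have gen: "wedge 1 1 (one_form (a h)) (one_form (b k)) \<in> type_forms J 1 1"
    if h: "linear h" and k: "linear k" for h k
    unfolding type_forms_def
  proof (rule fun_space.span_base, intro CollectI exI conjI)
    show "wedge 1 1 (one_form (a h)) (one_form (b k)) = wedge_list 1 (map one_form ([a h] @ [b k]))"
      using wedge_list_two_one_forms[OF la[OF h] lb[OF k]] by simp
  qed (use la[OF h] lb[OF k] aJ[OF h] bJ[OF k] in auto)
  have "(\<lambda>x. (1/2) * wedge 1 1 (one_form (a l)) (one_form (b m)) x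
      + (-1/2) * wedge 1 1 (one_form (a m)) (one_form (b l)) x) \<in> type_forms J 1 1"
    by (intro type_forms_add type_forms_scale gen l m)
  moreover have "complex_of_real (wedge 1 1 (one_form l) (one_form m) x
      + wedge 1 1 (one_form l) (one_form m) (\<lambda>i. J (x i)))
    = (1/2) * wedge 1 1 (one_form (a l)) (one_form (b m)) x
      + (-1/2) * wedge 1 1 (one_form (a m)) (one_form (b l)) x" for x
    unfolding wedge_one_forms[OF l m] wedge_one_forms[OF la[OF l] lb[OF m]] wedge_one_forms[OF la[OF m] lb[OF l]]
    by (simp add: a_def b_def field_simps complex_eq_iff)
  ultimately show ?thesis by simp
qed

text \<open>From here on classes of degree (1,1) are treated as real \<open>J\<close>-invariant
  forms, without complex coefficients. For the converse direction
  \<open>sum_contract_wedge_dual\<close> writes \<open>\<alpha>\<close> as a sum of products of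
  1-forms, which are then averaged over \<open>J\<close>.\<close>

lemma hodge_classes_1_iff:
  fixes J :: "'v::real_vector \<Rightarrow> 'v" and b :: "nat \<Rightarrow> 'v" and \<alpha> :: "(nat \<Rightarrow> 'v) \<Rightarrow> real"
  assumes b: "dual_basis d b e" and J: "complex_structure J"
  shows "\<alpha> \<in> hodge_classes 1 J L \<longleftrightarrow> \<alpha> \<in> rational_forms 2 L \<and> (\<forall>x. \<alpha> (\<lambda>i. J (x i)) = \<alpha> x)"
proof
  assume "\<alpha> \<in> hodge_classes 1 J L"
  then have "\<alpha> \<in> rational_forms 2 L" "(\<lambda>x. complex_of_real (\<alpha> x)) \<in> type_forms J 1 1"
    by (simp_all add: hodge_classes_def)
  then show "\<alpha> \<in> rational_forms 2 L \<and> (\<forall>x. \<alpha> (\<lambda>i. J (x i)) = \<alpha> x)"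
    using type_forms_11_invariant by fastforce
next
  assume a: "\<alpha> \<in> rational_forms 2 L \<and> (\<forall>x. \<alpha> (\<lambda>i. J (x i)) = \<alpha> x)"
  then have alt: "\<alpha> \<in> alt_forms 2" by (simp add: rational_forms_def)
  have "\<exists>l. linear l \<and> contract 2 (b i) \<alpha> = one_form l" for i
    using contract_in_alt_forms[OF alt, of "b i"] alt_forms_1_cases by (metis diff_add_inverse one_add_one)
  then obtain l where l: "\<And>i. linear (l i)" "\<And>i. contract 2 (b i) \<alpha> = one_form (l i)" by metis
  have s: "2 * \<alpha> x = (\<Sum>i<d. wedge 1 1 (one_form (l i)) (one_form (e i)) x)" for x
    using sum_contract_wedge_dual[OF b alt, of x] by (simp add: l)
  \<comment> \<open>Averaging leaves \<open>\<alpha>\<close> unchanged by invariance, while it makes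
    every single summand of type (1,1).\<close>
  have four: "4 * \<alpha> x = 2 * \<alpha> x + 2 * \<alpha> (\<lambda>i. J (x i))" for x using a by simp
  have "4 * \<alpha> x = (\<Sum>i<d. wedge 1 1 (one_form (l i)) (one_form (e i)) x
      + wedge 1 1 (one_form (l i)) (one_form (e i)) (\<lambda>i. J (x i)))" for x
    unfolding four s by (simp add: sum.distrib)
  then have quarter: "\<alpha> x = (1/4) * (\<Sum>i<d. wedge 1 1 (one_form (l i)) (one_form (e i)) x
      + wedge 1 1 (one_form (l i)) (one_form (e i)) (\<lambda>i. J (x i)))" for x
    by (simp add: eq_divide_eq mult.commute)
  have c: "complex_of_real (\<alpha> x) = (1/4) * (\<Sum>i<d. complex_of_real (wedge 1 1 (one_form (l i)) (one_form (e i)) x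
      + wedge 1 1 (one_form (l i)) (one_form (e i)) (\<lambda>i. J (x i))))" for x
    unfolding quarter[of x] by simp
  have "(\<lambda>x. complex_of_real (\<alpha> x)) \<in> type_forms J 1 1"
    unfolding c
    using dual_basisD(1)[OF b] l(1) J
    by (intro type_forms_scale type_forms_sum type_forms_wedge_invariant) auto
  then show "\<alpha> \<in> hodge_classes 1 J L"
    using a by (simp add: hodge_classes_def)
qed

text \<open>Generators of \<open>type_forms\<close> list all C-linear factors before the antilinear
  ones; a product of two generators is brought into this order by exchanging its two middle
  blocks.\<close>

lemma wedge_list_swap:
  assumes "set as \<subseteq> alt_forms 1" "set bs \<subseteq> alt_forms 1" "set cs \<subseteq> alt_forms 1" "set ds \<subseteq> alt_forms 1"
  shows "wedge_list 1 (as @ bs @ cs @ ds) =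
    (\<lambda>x. (-1) ^ (length bs * length cs) * wedge_list 1 (as @ cs @ bs @ ds) x)"
proof -
  have bc: "wedge_list 1 (bs @ cs) = (\<lambda>x. (-1) ^ (length bs * length cs) * wedge_list 1 (cs @ bs) x)"
    unfolding wedge_list_append[OF assms(2,3)] wedge_list_append[OF assms(3,2)]
    using wedge_commute[OF wedge_list_in_alt_forms[OF assms(2)] wedge_list_in_alt_forms[OF assms(3)]]
    by simp
  have s1: "set (bs @ cs) \<subseteq> alt_forms 1" "set (cs @ bs) \<subseteq> alt_forms 1"
    "set ((bs @ cs) @ ds) \<subseteq> alt_forms 1" "set ((cs @ bs) @ ds) \<subseteq> alt_forms 1"
    using assms by simp_all
  have "wedge_list 1 (as @ (bs @ cs) @ ds)
      = (\<lambda>x. (-1) ^ (length bs * length cs) * wedge_list 1 (as @ (cs @ bs) @ ds) x)"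
    unfolding wedge_list_append[OF assms(1) s1(3)] wedge_list_append[OF s1(1) assms(4)]
      wedge_list_append[OF assms(1) s1(4)] wedge_list_append[OF s1(2) assms(4)] bc
      wedge_scale_left wedge_scale_right
    by (simp add: ac_simps)
  then show ?thesis by simp
qed

lemma wedge_in_type_forms:
  assumes a: "\<alpha> \<in> type_forms J p q" and b: "\<beta> \<in> type_forms J r s"
  shows "wedge (p + q) (r + s) \<alpha> \<beta> \<in> type_forms J (p + r) (q + s)"
  using a unfolding type_forms_def[of J p q]
proof (induction rule: fun_space.span_induct)
  case base
  show ?case
    using type_forms_zero type_forms_add type_forms_scale
    by (auto simp: fun_space.subspace_def wedge_add_left wedge_scale_left wedge_zero_left
        zero_fun_def plus_fun_def)
next
  case (step \<alpha>)
  then obtain as bs where ab: "\<alpha> = wedge_list 1 (map one_form (as @ bs))" "length as = p" "length bs = q"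
    "\<forall>a\<in>set as. linear a \<and> (\<forall>x. a (J x) = \<i> * a x)" "\<forall>b\<in>set bs. linear b \<and> (\<forall>x. b (J x) = - \<i> * b x)"
    by blast
  show ?case
    using b unfolding type_forms_def[of J r s]
  proof (induction rule: fun_space.span_induct)
    case base
    show ?case
      using type_forms_zero type_forms_add type_forms_scale
      by (auto simp: fun_space.subspace_def wedge_add_right wedge_scale_right wedge_zero_right
          zero_fun_def plus_fun_def)
  next
    case (step \<beta>)
    then obtain cs ds where cd: "\<beta> = wedge_list 1 (map one_form (cs @ ds))" "length cs = r" "length ds = s"
      "\<forall>a\<in>set cs. linear a \<and> (\<forall>x. a (J x) = \<i> * a x)" "\<forall>b\<in>set ds. linear b \<and> (\<forall>x. b (J x) = - \<i> * b x)"
      by blast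
    have alt: "set (map one_form as) \<subseteq> alt_forms 1" "set (map one_form bs) \<subseteq> alt_forms 1"
      "set (map one_form cs) \<subseteq> alt_forms 1" "set (map one_form ds) \<subseteq> alt_forms 1"
      using ab(4,5) cd(4,5) by (auto intro!: one_form_in_alt_forms simp del: One_nat_def)
    have alt': "set (map one_form (as @ bs)) \<subseteq> alt_forms 1" "set (map one_form (cs @ ds)) \<subseteq> alt_forms 1"
      using alt by auto
    have "wedge (p + q) (r + s) \<alpha> \<beta> = wedge_list 1 (map one_form (as @ bs) @ map one_form (cs @ ds))"
      using wedge_list_append[OF alt'] ab cd by simp
    also have "\<dots> = (\<lambda>x. (-1) ^ (q * r) * wedge_list 1 (map one_form ((as @ cs) @ (bs @ ds))) x)"
      using wedge_list_swap[OF alt] ab cd by simp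
    also have "\<dots> \<in> type_forms J (p + r) (q + s)"
    proof (rule type_forms_scale)
      have "length (as @ cs) = p + r \<and> length (bs @ ds) = q + s \<and>
        (\<forall>a\<in>set (as @ cs). linear a \<and> (\<forall>x. a (J x) = \<i> * a x)) \<and>
        (\<forall>b\<in>set (bs @ ds). linear b \<and> (\<forall>x. b (J x) = - \<i> * b x))"
        using ab cd by auto
      then show "wedge_list 1 (map one_form ((as @ cs) @ (bs @ ds))) \<in> type_forms J (p + r) (q + s)"
        unfolding type_forms_def by (intro fun_space.span_base) blast
    qed
    finally show ?case .
  qed
qed

section \<open>Rational forms and Hodge classes under products and pullbacks\<close>

lemma rational_formsD:
  "\<alpha> \<in> rational_forms k L \<Longrightarrow> \<alpha> \<in> alt_forms k"
  "\<alpha> \<in> rational_forms k L \<Longrightarrow> (\<And>i. x i \<in> L) \<Longrightarrow> \<alpha> x \<in> \<rat>"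
  by (auto simp: rational_forms_def)

lemma rational_forms_zero: "(\<lambda>x. 0) \<in> rational_forms k L"
  by (simp add: rational_forms_def zero_in_alt_forms)

lemma rational_forms_const: "c \<in> \<rat> \<Longrightarrow> (\<lambda>x. c) \<in> rational_forms 0 L"
  by (simp add: rational_forms_def const_in_alt_forms)

lemma rational_forms_add:
  "\<alpha> \<in> rational_forms k L \<Longrightarrow> \<beta> \<in> rational_forms k L \<Longrightarrow> (\<lambda>x. \<alpha> x + \<beta> x) \<in> rational_forms k L"
  by (simp add: rational_forms_def add_in_alt_forms)

lemma rational_forms_scale: "c \<in> \<rat> \<Longrightarrow> \<alpha> \<in> rational_forms k L \<Longrightarrow> (\<lambda>x. c * \<alpha> x) \<in> rational_forms k L"
  by (simp add: rational_forms_def scale_in_alt_forms)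

lemma rational_forms_diff:
  "\<alpha> \<in> rational_forms k L \<Longrightarrow> \<beta> \<in> rational_forms k L \<Longrightarrow> (\<lambda>x. \<alpha> x - \<beta> x) \<in> rational_forms k L"
  by (simp add: rational_forms_def diff_in_alt_forms)

lemma rational_forms_wedge:
  assumes a: "\<alpha> \<in> rational_forms p L" and b: "\<beta> \<in> rational_forms q L"
  shows "wedge p q \<alpha> \<beta> \<in> rational_forms (p + q) L"
proof -
  have f: "(fact m :: real) \<in> \<rat>" for m
    by (metis Rats_of_nat of_nat_fact)
  have "wedge p q \<alpha> \<beta> x \<in> \<rat>" if "\<And>i. x i \<in> L" for x
    unfolding wedge_def using that
    by (intro Rats_divide Rats_sum Rats_mult rational_formsD(2)[OF a] rational_formsD(2)[OF b] Rats_of_int f)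
  then show ?thesis
    using wedge_in_alt_forms[OF rational_formsD(1)[OF a] rational_formsD(1)[OF b]]
    by (simp add: rational_forms_def)
qed

lemma rational_forms_wedge_list:
  "set \<alpha>s \<subseteq> rational_forms d L \<Longrightarrow> wedge_list d \<alpha>s \<in> rational_forms (d * length \<alpha>s) L"
  by (induction \<alpha>s) (simp_all add: rational_forms_const rational_forms_wedge)

lemma rational_forms_wedge_power: "\<alpha> \<in> rational_forms d L \<Longrightarrow> wedge_power d \<alpha> m \<in> rational_forms (d * m) L"
  using rational_forms_wedge_list[of "replicate m \<alpha>" d] set_replicate_conv_if[of m \<alpha>]
  by (simp add: wedge_power_def split: if_splits)

text \<open>The map only has to send \<open>M\<close> into rational multiples of \<open>L\<close>:
  multilinearity extracts the denominators of the arguments. This generality is required for the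
  section of \<open>f\<close>, which need not map lattice to lattice.\<close>

lemma rational_forms_pullback:
  assumes a: "\<alpha> \<in> rational_forms k L" and g: "linear g"
    and L: "\<And>x. x \<in> M \<Longrightarrow> \<exists>m::nat. m > 0 \<and> real m *\<^sub>R g x \<in> L"
  shows "pullback g \<alpha> \<in> rational_forms k M"
proof -
  have "pullback g \<alpha> x \<in> \<rat>" if x: "\<And>i. x i \<in> M" for x
  proof -
    have "\<forall>i. \<exists>m::nat. m > 0 \<and> real m *\<^sub>R g (x i) \<in> L" using L x by blast
    then obtain m :: "nat \<Rightarrow> nat" where m: "\<And>i. m i > 0" "\<And>i. real (m i) *\<^sub>R g (x i) \<in> L"
      by metis
    have "\<alpha> (\<lambda>i. real (m i) *\<^sub>R g (x i)) \<in> \<rat>" by (rule rational_formsD(2)[OF a m(2)])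
    then have "(\<Prod>i<k. real (m i)) * pullback g \<alpha> x \<in> \<rat>"
      using alt_forms_scale_args[OF rational_formsD(1)[OF a], of "\<lambda>i. real (m i)" "\<lambda>i. g (x i)"]
      by (simp add: pullback_def)
    moreover have "(\<Prod>i<k. real (m i)) \<in> \<rat>"
      by (simp flip: of_nat_prod)
    moreover have "(\<Prod>i<k. real (m i)) \<noteq> 0" using m(1) by (simp add: prod_zero_iff)
    ultimately show ?thesis using Rats_divide[of "(\<Prod>i<k. real (m i)) * pullback g \<alpha> x" "\<Prod>i<k. real (m i)"]
      by simp
  qed
  then show ?thesis
    using pullback_in_alt_forms[OF g rational_formsD(1)[OF a]] by (simp add: rational_forms_def)
qed

lemma subspace_hodge_classes: "rat_space.subspace (hodge_classes k J L)"
  unfolding rat_space.subspace_def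
proof (intro conjI ballI allI)
  show "0 \<in> hodge_classes k J L"
    by (simp add: hodge_classes_def zero_fun_def rational_forms_zero type_forms_zero)
  show "\<alpha> + \<beta> \<in> hodge_classes k J L" if "\<alpha> \<in> hodge_classes k J L" "\<beta> \<in> hodge_classes k J L" for \<alpha> \<beta>
    using that by (auto simp: hodge_classes_def plus_fun_def rational_forms_add type_forms_add)
  show "(\<lambda>x. real_of_rat c * \<alpha> x) \<in> hodge_classes k J L" if "\<alpha> \<in> hodge_classes k J L" for c \<alpha>
    using that by (auto simp: hodge_classes_def rational_forms_scale type_forms_scale)
qed

lemma wedge_in_hodge_classes:
  assumes "\<alpha> \<in> hodge_classes k J L" "\<beta> \<in> hodge_classes l J L"
  shows "wedge (2 * k) (2 * l) \<alpha> \<beta> \<in> hodge_classes (k + l) J L"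
proof -
  have "wedge (2 * k) (2 * l) \<alpha> \<beta> \<in> rational_forms (2 * (k + l)) L"
    using assms by (auto simp: hodge_classes_def distrib_left rational_forms_wedge)
  moreover have "wedge (k + k) (l + l) (\<lambda>x. complex_of_real (\<alpha> x)) (\<lambda>x. complex_of_real (\<beta> x))
    \<in> type_forms J (k + l) (k + l)"
    using assms by (intro wedge_in_type_forms) (simp_all add: hodge_classes_def)
  ultimately show ?thesis
    by (simp add: hodge_classes_def of_real_wedge mult_2)
qed

lemma const_in_hodge_classes: "(\<lambda>x. 1) \<in> hodge_classes 0 J L"
proof -
  have "(\<lambda>x. 1) \<in> type_forms J 0 0"
    unfolding type_forms_def by (rule fun_space.span_base) auto
  then show ?thesis by (simp add: hodge_classes_def rational_forms_const)
qed

lemma wedge_list_in_hodge_classes: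
  "set Ds \<subseteq> hodge_classes 1 J L \<Longrightarrow> wedge_list 2 Ds \<in> hodge_classes (length Ds) J L"
proof (induction Ds)
  case (Cons D Ds)
  then show ?case using wedge_in_hodge_classes[of D 1 J L "wedge_list 2 Ds" "length Ds"] by simp
qed (simp add: const_in_hodge_classes)

lemma divisor_products_subset_hodge_classes: "divisor_products m J L \<subseteq> hodge_classes m J L"
  unfolding divisor_products_def
  by (rule rat_space.span_minimal)
    (auto intro: wedge_list_in_hodge_classes subspace_hodge_classes simp del: One_nat_def)

section \<open>Lattices and integration\<close>

lemma lattice_basis_sum_in:
  "lattice_basis r L b \<Longrightarrow> (\<Sum>i<r. of_int (c i) *\<^sub>R b i) \<in> L"
  by (auto simp: lattice_basis_def)

lemma lattice_basis_in_lattice: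
  assumes "lattice_basis r L b" "i < r"
  shows "b i \<in> L"
proof -
  have "(\<Sum>j<r. of_int (if j = i then 1 else 0) *\<^sub>R b j) = (\<Sum>j<r. if j = i then b j else 0)"
    by (intro sum.cong) auto
  also have "\<dots> = b i" using assms(2) by simp
  finally show ?thesis
    using lattice_basis_sum_in[OF assms(1), of "\<lambda>j. if j = i then 1 else 0"] by simp
qed

lemma lattice_basis_zero: "lattice_basis r L b \<Longrightarrow> 0 \<in> L"
  unfolding lattice_basis_def by (auto intro!: exI[of _ "\<lambda>_. 0"])

lemma lattice_coordinates:
  assumes L: "lattice_basis r L b" and b: "dual_basis r b e" and x: "x \<in> L" and i: "i < r"
  shows "e i x \<in> \<int>"
proof -
  obtain c :: "nat \<Rightarrow> int" where c: "x = (\<Sum>j<r. of_int (c j) *\<^sub>R b j)"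
    using L x unfolding lattice_basis_def by blast
  note l = dual_basisD(1)[OF b i]
  have "e i x = (\<Sum>j<r. of_int (c j) * e i (b j))"
    unfolding c by (simp only: linear_sum[OF l] linear_scale[OF l] real_scaleR_def)
  also have "\<dots> = (\<Sum>j<r. if j = i then of_int (c j) else 0)"
    using dual_basisD(2)[OF b i] by (intro sum.cong) auto
  also have "\<dots> = of_int (c i)" using i by simp
  finally show ?thesis by simp
qed

lemma common_denominator:
  fixes f :: "'i \<Rightarrow> real"
  assumes "finite I" "\<And>i. i \<in> I \<Longrightarrow> f i \<in> \<rat>"
  obtains m :: nat where "m > 0" "\<And>i. i \<in> I \<Longrightarrow> real m * f i \<in> \<int>"
proof -
  have "\<exists>m::nat. m > 0 \<and> (\<forall>i\<in>I. real m * f i \<in> \<int>)"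
    using assms
  proof (induction I)
    case empty
    then show ?case by (intro exI[of _ 1]) auto
  next
    case (insert j I)
    then obtain m :: nat where m: "m > 0" "\<forall>i\<in>I. real m * f i \<in> \<int>" by auto
    have "f j \<in> \<rat>" using insert by simp
    then obtain p :: int and q :: nat where pq: "q > 0" "f j = of_int p / of_nat q"
      by (rule Rats_cases') (metis of_int_of_nat_eq zero_less_imp_eq_int of_nat_0_less_iff)
    have "real (m * q) * f i \<in> \<int>" if "i \<in> insert j I" for i
    proof (cases "i = j")
      case True
      then have "real (m * q) * f i = of_int (int m * p)" using pq by simp
      then show ?thesis by (metis Ints_of_int)
    next
      case False
      then have "real m * f i \<in> \<int>" using that m by auto
      then have "real q * (real m * f i) \<in> \<int>" by (rule Ints_mult[OF Ints_of_nat])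
      then show ?thesis by (simp add: ac_simps)
    qed
    then show ?case using m pq by (intro exI[of _ "m * q"]) auto
  qed
  then show ?thesis using that by blast
qed

lemma rational_multiple_in_lattice:
  assumes L: "lattice_basis r L b" and b: "dual_basis r b e" and x: "\<And>i. i < r \<Longrightarrow> e i x \<in> \<rat>"
  shows "\<exists>m::nat. m > 0 \<and> real m *\<^sub>R x \<in> L"
proof -
  obtain m :: nat where m: "m > 0" "\<And>i. i \<in> {..<r} \<Longrightarrow> real m * e i x \<in> \<int>"
    using common_denominator[of "{..<r}" "\<lambda>i. e i x"] x by auto
  then have "\<forall>i. \<exists>c. i < r \<longrightarrow> real m * e i x = of_int c"
    by (auto elim!: Ints_cases)
  then obtain c :: "nat \<Rightarrow> int" where c: "\<And>i. i < r \<Longrightarrow> real m * e i x = of_int (c i)"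
    by metis
  have "real m *\<^sub>R x = (\<Sum>i<r. (real m * e i x) *\<^sub>R b i)"
    by (subst dual_basisD(3)[OF b, of x]) (simp add: scaleR_sum_right)
  also have "\<dots> = (\<Sum>i<r. of_int (c i) *\<^sub>R b i)"
    using c by (intro sum.cong) auto
  also have "\<dots> \<in> L" by (rule lattice_basis_sum_in[OF L])
  finally show ?thesis using m by blast
qed

lemma countable_lattice:
  assumes "lattice_basis r L b"
  shows "countable L"
proof -
  \<comment> \<open>Coefficients beyond \<open>r\<close> are irrelevant. Without restricting them
    the index set of all integer sequences would be uncountable.\<close>
  have "L = (\<lambda>c. \<Sum>i<r. of_int (c i) *\<^sub>R b i) ` ({..<r} \<rightarrow>\<^sub>E (UNIV :: int set))"
  proof (intro equalityI subsetI)
    fix x assume "x \<in> L"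
    then obtain c :: "nat \<Rightarrow> int" where "x = (\<Sum>i<r. of_int (c i) *\<^sub>R b i)"
      using assms unfolding lattice_basis_def by blast
    then have "x = (\<Sum>i<r. of_int (restrict c {..<r} i) *\<^sub>R b i)" by simp
    then show "x \<in> (\<lambda>c. \<Sum>i<r. of_int (c i) *\<^sub>R b i) ` ({..<r} \<rightarrow>\<^sub>E (UNIV :: int set))"
      by (intro image_eqI[of _ _ "restrict c {..<r}"]) auto
  qed (use assms in \<open>auto simp: lattice_basis_def\<close>)
  moreover have "countable ({..<r} \<rightarrow>\<^sub>E (UNIV :: int set))"
    by (rule countable_PiE) auto
  ultimately show ?thesis by simp
qed

text \<open>Adjoin pairs \<open>w\<close>, \<open>J w\<close> one after the other. The span reached
  so far is stable under \<open>J\<close>, so a new \<open>w\<close> outside it forces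
  \<open>J w\<close> to be independent as well.\<close>

lemma complex_basis_exists:
  fixes J :: "'v::real_vector \<Rightarrow> 'v"
  assumes dim: "dim (UNIV :: 'v set) = 2 * n" and J: "complex_structure J" and "m \<le> n"
  shows "\<exists>v. inj_on (\<lambda>i. if even i then v (i div 2) else J (v (i div 2))) {..<2 * m} \<and>
    independent ((\<lambda>i. if even i then v (i div 2) else J (v (i div 2))) ` {..<2 * m})"
  using assms(3)
proof (induction m)
  case 0
  then show ?case by (simp add: real_vector.independent_empty)
next
  case (Suc m)
  have JJ: "J (J x) = - x" for x using J by (simp add: complex_structure_def)
  have Jl: "linear J" using J by (simp add: complex_structure_def)
  define g where "g v i = (if even i then v (i div 2) else J (v (i div 2)))" for v :: "nat \<Rightarrow> 'v" and i :: nat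
  obtain v where v: "inj_on (g v) {..<2 * m}" "independent (g v ` {..<2 * m})"
    using Suc unfolding g_def by auto
  let ?S = "g v ` {..<2 * m}"
  have "span ?S \<noteq> UNIV"
  proof
    assume "span ?S = UNIV"
    then have "dim (UNIV :: 'v set) = card ?S"
      using v(2) by (intro real_vector.dim_unique[of ?S]) auto
    then show False using v(1) dim Suc.prems by (simp add: card_image)
  qed
  then obtain w where w: "w \<notin> span ?S" by auto
  have "?S \<subseteq> {x. J x \<in> span ?S}"
  proof clarify
    fix i assume i: "i < 2 * m"
    show "J (g v i) \<in> span ?S"
    proof (cases "even i")
      case True
      then have "J (g v i) = g v (Suc i)" "Suc i < 2 * m" using i by (auto simp: g_def elim!: evenE)
      then show ?thesis by (auto intro!: span_base)
    next
      case False
      then have "J (g v i) = - g v (i - 1)" "i - 1 < 2 * m" using i by (auto simp: g_def JJ elim!: oddE)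
      then show ?thesis using span_neg[OF span_base[of "g v (i - 1)" ?S]] by auto
    qed
  qed
  moreover have "subspace {x. J x \<in> span ?S}"
    using linear_0[OF Jl] by (auto simp: subspace_def linear_add[OF Jl] linear_scale[OF Jl]
        intro: span_add span_scale span_zero)
  ultimately have inv: "J x \<in> span ?S" if "x \<in> span ?S" for x
    using span_minimal that by blast
  have Jw: "J w \<notin> span (insert w ?S)"
  proof
    assume "J w \<in> span (insert w ?S)"
    then obtain t where t: "J w - t *\<^sub>R w \<in> span ?S" using span_breakdown_eq by blast
    \<comment> \<open>Applying \<open>J + t\<close> eliminates \<open>J w\<close> and leaves a
      negative multiple of \<open>w\<close>, as \<open>J\<close> has no real eigenvalue.\<close>
    have "J (J w - t *\<^sub>R w) + t *\<^sub>R (J w - t *\<^sub>R w) \<in> span ?S"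
      by (intro span_add span_scale inv t)
    moreover have "J (J w - t *\<^sub>R w) + t *\<^sub>R (J w - t *\<^sub>R w) = - (1 + t * t) *\<^sub>R w"
      by (simp add: linear_diff[OF Jl] linear_scale[OF Jl] JJ algebra_simps)
    ultimately have "- (- (1 + t * t) *\<^sub>R w) \<in> span ?S"
      using span_neg by metis
    then have "(1 + t * t) *\<^sub>R w \<in> span ?S"
      by (simp only: scaleR_minus_left minus_minus)
    then have "(1 / (1 + t * t)) *\<^sub>R ((1 + t * t) *\<^sub>R w) \<in> span ?S"
      by (rule span_scale)
    moreover have "1 + t * t \<noteq> 0" using zero_le_square[of t] by linarith
    ultimately show False using w by simp
  qed
  let ?v = "v(m := w)"
  have old: "g ?v i = g v i" if "i < 2 * m" for i
    using that by (auto simp: g_def)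
  have new: "g ?v (2 * m) = w" "g ?v (Suc (2 * m)) = J w"
    by (simp_all add: g_def)
  have dom: "{..<2 * Suc m} = insert (Suc (2 * m)) (insert (2 * m) {..<2 * m})" by auto
  have img: "g ?v ` {..<2 * m} = ?S" using old by (intro image_cong) auto
  have "independent (insert (J w) (insert w ?S))"
    using v(2) w Jw by (intro independent_insertI)
  moreover have "inj_on (g ?v) {..<2 * Suc m}"
  proof -
    have "inj_on (g ?v) {..<2 * m}" using v(1) old by (simp add: inj_on_def)
    moreover have "w \<notin> ?S" using w span_base[of w ?S] by fast
    moreover have "J w \<notin> insert w ?S" using Jw span_base[of "J w" "insert w ?S"] by fast
    ultimately show ?thesis
      unfolding dom using img by (simp add: new)
  qed
  ultimately have "inj_on (g ?v) {..<2 * Suc m} \<and> independent (g ?v ` {..<2 * Suc m})"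
    unfolding dom by (simp add: new img)
  then show ?case unfolding g_def by blast
qed

lemma top_form_exists:
  assumes "dual_basis d b e"
  obtains \<alpha> :: "(nat \<Rightarrow> 'v::real_vector) \<Rightarrow> real" where
    "\<alpha> \<in> alt_forms d" "\<alpha> b = 1" "\<And>L. lattice_basis d L b \<Longrightarrow> \<alpha> \<in> rational_forms d L"
proof -
  let ?w = "wedge_list 1 (map (\<lambda>i. one_form (e i)) (rev [0..<d]))"
  have lin: "one_form (e i) \<in> alt_forms 1" if "i < d" for i
    using that dual_basisD(1)[OF assms] one_form_in_alt_forms by blast
  then have "set (map (\<lambda>i. one_form (e i)) (rev [0..<d])) \<subseteq> alt_forms 1" by auto
  from wedge_list_in_alt_forms[OF this] have alt: "?w \<in> alt_forms d" by simp
  have rat: "?w \<in> rational_forms d L" if L: "lattice_basis d L b" for L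
  proof -
    have "one_form (e i) \<in> rational_forms 1 L" if "i < d" for i
      using lin[OF that] lattice_coordinates[OF L assms _ that] Ints_subset_Rats
      by (auto simp: rational_forms_def one_form_def)
    then have "set (map (\<lambda>i. one_form (e i)) (rev [0..<d])) \<subseteq> rational_forms 1 L" by auto
    from rational_forms_wedge_list[OF this] show ?thesis by simp
  qed
  have v: "?w b \<in> {1, -1}" by (rule wedge_list_dual_basis[OF assms])
  show ?thesis
  \<comment> \<open>The value \<open>?w b\<close> is 1 or -1 and thus its own inverse, so
    multiplication by it normalizes the form.\<close>
  proof (rule that[of "\<lambda>x. ?w b * ?w x"])
    show "(\<lambda>x. ?w b * ?w x) \<in> alt_forms d" by (rule scale_in_alt_forms[OF alt])
    show "?w b * ?w b = 1" using v by auto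
    show "(\<lambda>x. ?w b * ?w x) \<in> rational_forms d L" if "lattice_basis d L b" for L
      by (rule rational_forms_scale[OF _ rat[OF that]]) (use v in auto)
  qed
qed

lemma lattice_dual_basis_exists:
  fixes L :: "'v::real_vector set"
  assumes "lattice_basis d L b" "dim (UNIV :: 'v set) = d" "d > 0"
  obtains e where "dual_basis d b e"
  using dual_basis_exists[OF assms(2,3), of b] assms(1) unfolding lattice_basis_def by blast

text \<open>Guarantees that the choice inside \<open>torus_integral\<close> is made from a nonempty
  set.\<close>

lemma oriented_basis_exists:
  fixes J :: "'v::real_vector \<Rightarrow> 'v"
  assumes A: "abelian_variety n J L" and n: "n > 0"
  shows "\<exists>b. lattice_basis (2 * n) L b \<and> positively_oriented n J b"
proof -
  have dim: "dim (UNIV :: 'v set) = 2 * n" and J: "complex_structure J"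
    using A by (auto simp: abelian_variety_def)
  obtain b where b: "lattice_basis (2 * n) L b"
    using A by (auto simp: abelian_variety_def is_lattice_def)
  obtain e where e: "dual_basis (2 * n) b e"
    using lattice_dual_basis_exists[OF b dim] n by auto
  define g where "g v i = (if even i then v (i div 2) else J (v (i div 2)))" for v :: "nat \<Rightarrow> 'v" and i :: nat
  obtain v where v: "inj_on (g v) {..<2 * n}" "independent (g v ` {..<2 * n})"
    using complex_basis_exists[OF dim J order_refl] unfolding g_def by auto
  obtain e' where e': "dual_basis (2 * n) (g v) e'"
    using dual_basis_exists[OF dim _ v] n by auto
  obtain \<alpha> :: "(nat \<Rightarrow> 'v) \<Rightarrow> real" where a: "\<alpha> \<in> alt_forms (2 * n)" "\<alpha> (g v) = 1"
    by (rule top_form_exists[OF e']) blast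
  have or: "positively_oriented n J c" if "\<alpha> c > 0" for c
    unfolding positively_oriented_def using a that unfolding g_def
    by (intro bexI[of _ \<alpha>] exI[of _ v]) auto
  have nz: "\<alpha> b \<noteq> 0"
    using top_form_eq_0[OF e a(1)] a(2) by auto
  show ?thesis
  proof (cases "\<alpha> b > 0")
    case True
    then show ?thesis using b or by blast
  next
    case False
    \<comment> \<open>A negatively oriented lattice basis is repaired by exchanging its first two
      vectors.\<close>
    let ?t = "Transposition.transpose 0 (1::nat)"
    let ?c = "\<lambda>i. b (?t i)"
    have t: "?t permutes {..<2 * n}" using n by (intro permutes_swap_id) auto
    have "\<alpha> ?c = - \<alpha> b" using n by (intro alt_forms_transpose[OF a(1)]) auto
    then have "positively_oriented n J ?c" using False nz by (intro or) auto
    moreover have "lattice_basis (2 * n) L ?c"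
      unfolding lattice_basis_def
    proof (intro conjI)
      have im: "?c ` {..<2 * n} = b ` {..<2 * n}"
        using permutes_image[OF t] by (metis image_image)
      show "independent (?c ` {..<2 * n})"
        using b unfolding im by (simp add: lattice_basis_def)
      have "inj_on b (?t ` {..<2 * n})" using b permutes_image[OF t] by (simp add: lattice_basis_def)
      then have "inj_on (b \<circ> ?t) {..<2 * n}"
        using permutes_inj_on[OF t] by (intro comp_inj_on)
      then show "inj_on ?c {..<2 * n}" by (simp add: comp_def)
      have re: "(\<Sum>i<2 * n. of_int (c (?t i)) *\<^sub>R b (?t i)) = (\<Sum>i<2 * n. of_int (c i) *\<^sub>R b i)" for c :: "nat \<Rightarrow> int"
        using sum.permute[OF t, of "\<lambda>i. of_int (c i) *\<^sub>R b i"] by (simp add: comp_def)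
      have "{\<Sum>i<2 * n. of_int (c i) *\<^sub>R b i |c :: nat \<Rightarrow> int. True}
          = {\<Sum>i<2 * n. of_int (c i) *\<^sub>R ?c i |c :: nat \<Rightarrow> int. True}"
      proof (intro equalityI subsetI)
        fix x assume "x \<in> {\<Sum>i<2 * n. of_int (c i) *\<^sub>R b i |c :: nat \<Rightarrow> int. True}"
        then obtain c :: "nat \<Rightarrow> int" where "x = (\<Sum>i<2 * n. of_int (c i) *\<^sub>R b i)" by blast
        then have "x = (\<Sum>i<2 * n. of_int (c (?t i)) *\<^sub>R ?c i)" by (simp only: re)
        then show "x \<in> {\<Sum>i<2 * n. of_int (c i) *\<^sub>R ?c i |c :: nat \<Rightarrow> int. True}" 
          by (intro CollectI exI[of _ "\<lambda>i. c (?t i)"]) auto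
      next
        fix x assume "x \<in> {\<Sum>i<2 * n. of_int (c i) *\<^sub>R ?c i |c :: nat \<Rightarrow> int. True}"
        then obtain c :: "nat \<Rightarrow> int" where "x = (\<Sum>i<2 * n. of_int (c i) *\<^sub>R ?c i)" by blast
        then have "x = (\<Sum>i<2 * n. of_int (c (?t i)) *\<^sub>R b i)"
          using re[of "\<lambda>i. c (?t i)"] by simp
        then show "x \<in> {\<Sum>i<2 * n. of_int (c i) *\<^sub>R b i |c :: nat \<Rightarrow> int. True}"
          by (intro CollectI exI[of _ "\<lambda>i. c (?t i)"]) auto
      qed
      then show "L = {\<Sum>i<2 * n. of_int (c i) *\<^sub>R ?c i |c :: nat \<Rightarrow> int. True}"
        using b by (simp add: lattice_basis_def)
    qed
    ultimately show ?thesis by blast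
  qed
qed

text \<open>All that the later argument retains of integration: it is evaluation at one fixed
  lattice basis.\<close>

lemma torus_integral_basis:
  fixes J :: "'v::real_vector \<Rightarrow> 'v"
  assumes A: "abelian_variety n J L" and n: "n > 0"
  obtains b e where "lattice_basis (2 * n) L b" "dual_basis (2 * n) b e"
    "\<And>\<alpha>. torus_integral n J L \<alpha> = \<alpha> b"
proof -
  define b where "b = (SOME b. lattice_basis (2 * n) L b \<and> positively_oriented n J b)"
  have b: "lattice_basis (2 * n) L b"
    using someI_ex[OF oriented_basis_exists[OF A n]] unfolding b_def by blast
  moreover obtain e where "dual_basis (2 * n) b e"
    using lattice_dual_basis_exists[OF b] A n unfolding abelian_variety_def by auto
  ultimately show ?thesis
    using that unfolding torus_integral_def b_def by blast
qed

text \<open>Surjectivity on the tori only says that every vector of the target is in the range of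
  \<open>f\<close> up to a lattice vector. A line through a vector outside the range would then
  inject the reals into the countable lattice.\<close>

lemma abelian_hom_surj:
  fixes f :: "'u::real_vector \<Rightarrow> 'v::real_vector"
  assumes h: "abelian_hom J1 L1 J2 L2 \<pi> f" and s: "\<pi> ` torus L1 = torus L2"
    and L: "lattice_basis r L2 b"
  shows "surj f"
proof (rule ccontr)
  assume "\<not> surj f"
  then obtain v where v: "v \<notin> range f" by auto
  have f: "linear f" using h by (simp add: abelian_hom_def)
  have "\<exists>x. \<exists>l\<in>L2. y = f x + l" for y
  proof -
    have "torus_point L2 y \<in> torus L2" by (simp add: torus_def)
    then have "torus_point L2 y \<in> \<pi> ` torus L1" by (simp only: s)
    then obtain x where "torus_point L2 y = \<pi> (torus_point L1 x)" by (auto simp: torus_def)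
    then have "torus_point L2 y = torus_point L2 (f x)" using h by (simp add: abelian_hom_def)
    moreover have "y \<in> torus_point L2 y"
      using lattice_basis_zero[OF L] unfolding torus_point_def by force
    ultimately show ?thesis unfolding torus_point_def by auto
  qed
  then have "\<forall>t::real. \<exists>x l. l \<in> L2 \<and> t *\<^sub>R v = f x + l" by blast
  then obtain x l where xl: "\<And>t::real. l t \<in> L2" "\<And>t. t *\<^sub>R v = f (x t) + l t" by metis
  \<comment> \<open>Equal lattice parts at two parameters would put a nonzero multiple of
    \<open>v\<close> into the range of \<open>f\<close>.\<close>
  have "inj l"
  proof (rule injI)
    fix s t assume "l s = l t"
    then have st: "(s - t) *\<^sub>R v = f (x s - x t)"
      using xl(2)[of s] xl(2)[of t] by (simp add: scaleR_diff_left linear_diff[OF f])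
    show "s = t"
    proof (rule ccontr)
      assume "s \<noteq> t"
      then have "v = (1 / (s - t)) *\<^sub>R ((s - t) *\<^sub>R v)" by simp
      also have "\<dots> = f ((1 / (s - t)) *\<^sub>R (x s - x t))"
        unfolding st by (rule linear_scale[OF f, symmetric])
      finally show False using v by blast
    qed
  qed
  moreover have "countable (range l)"
    using countable_subset[OF _ countable_lattice[OF L]] xl(1) by blast
  ultimately have "countable (UNIV :: real set)"
    by (simp add: countable_image_inj_eq)
  then show False using uncountable_UNIV_real by blast
qed

section \<open>Quadratic forms, rationality and interpolation\<close>

text \<open>Gram-Schmidt by induction on the spanning set. The division requires only that
  \<open>g x x\<close> is nonzero, so the sign of \<open>\<omega>\<close> need not be known.\<close>

lemma orthogonal_projection_exists:
  fixes g :: "'v::real_vector \<Rightarrow> 'v \<Rightarrow> real"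
  assumes g: "bilinear g" and sym: "\<And>x y. g x y = g y x" and an: "\<And>x. x \<noteq> 0 \<Longrightarrow> g x x \<noteq> 0"
    and "finite S"
  shows "\<exists>p\<in>span S. \<forall>k\<in>span S. g (x - p) k = 0"
  using assms(4)
proof (induction S arbitrary: x)
  case empty
  then show ?case by (auto simp: bilinear_rzero[OF g])
next
  case (insert a S)
  obtain q where q: "q \<in> span S" "\<And>k. k \<in> span S \<Longrightarrow> g (a - q) k = 0"
    using insert.IH[of a] by blast
  obtain p where p: "p \<in> span S" "\<And>k. k \<in> span S \<Longrightarrow> g (x - p) k = 0"
    using insert.IH[of x] by blast
  \<comment> \<open>If \<open>a\<close> already lies in the span of \<open>S\<close>, then
    \<open>a - q = 0\<close>; division by zero makes \<open>c\<close> equal to 0, which is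
    harmless.\<close>
  define c where "c = g (x - p) (a - q) / g (a - q) (a - q)"
  have sub: "span S \<subseteq> span (insert a S)" by (rule span_mono) auto
  have aq: "a - q \<in> span (insert a S)"
    by (rule span_diff[OF span_base subsetD[OF sub q(1)]]) simp
  have c: "g (x - p) (a - q) = c * g (a - q) (a - q)"
    using an[of "a - q"] by (cases "a - q = 0") (simp_all add: c_def bilinear_rzero[OF g])
  have orth: "g (x - (p + c *\<^sub>R (a - q))) k = 0" if k: "k \<in> span (insert a S)" for k
  proof -
    obtain t where t: "k - t *\<^sub>R a \<in> span S" using span_breakdown_eq[of k a S] k by blast
    define s where "s = k - t *\<^sub>R a + t *\<^sub>R q"
    have s: "s \<in> span S" unfolding s_def using t q(1) by (intro span_add span_scale)
    have ks: "k = s + t *\<^sub>R (a - q)" by (simp add: s_def algebra_simps)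
    have "g (x - (p + c *\<^sub>R (a - q))) y = g (x - p) y - c * g (a - q) y" for y
      using bilinear_lsub[OF g, of "x - p" "c *\<^sub>R (a - q)" y]
      by (simp add: bilinear_lmul[OF g] diff_diff_eq)
    then show ?thesis
      unfolding ks using s p(2) q(2) c by (simp add: bilinear_radd[OF g] bilinear_rmul[OF g])
  qed
  show ?case
    by (rule bexI[of _ "p + c *\<^sub>R (a - q)"]) (use orth p(1) sub aq in \<open>auto intro!: span_add span_scale\<close>)
qed

text \<open>The type carries no norm, so compactness of the unit sphere is replaced by an induction
  that splits off one vector orthogonal to the previous ones.\<close>

lemma definite_form_dominates:
  fixes g h :: "'v::real_vector \<Rightarrow> 'v \<Rightarrow> real"
  assumes g: "bilinear g" and sym: "\<And>x y. g x y = g y x" and pos: "\<And>x. x \<noteq> 0 \<Longrightarrow> g x x > 0"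
    and "finite S" and "bilinear h" "\<And>x y. h x y = h y x"
  shows "\<exists>C. \<forall>u\<in>span S. \<bar>h u u\<bar> \<le> C * g u u"
  using assms(4-)
proof (induction S arbitrary: h)
  case empty
  then show ?case by (auto simp: bilinear_rzero bilinear_rzero[OF g])
next
  case (insert a S)
  note h = \<open>bilinear h\<close>
  obtain q where q: "q \<in> span S" "\<And>k. k \<in> span S \<Longrightarrow> g (a - q) k = 0"
    using orthogonal_projection_exists[OF g sym _ insert.hyps(1), of a] pos by (metis less_irrefl)
  define a' where "a' = a - q"
  have nn: "g x x \<ge> 0" for x using pos[of x] by (cases "x = 0") (auto simp: bilinear_rzero[OF g])
  obtain C where C: "\<And>u. u \<in> span S \<Longrightarrow> \<bar>h u u\<bar> \<le> C * g u u"
    using insert.IH[OF insert.prems] by blast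
  \<comment> \<open>The cross term is bounded through the square of the functional
    \<open>h _ a'\<close>. That square is again a symmetric bilinear form, so the induction
    hypothesis, stated for all \<open>h\<close>, applies to it.\<close>
  have "bilinear (\<lambda>x y. h x a' * h y a')"
    using h by (auto simp: bilinear_def linear_iff algebra_simps)
  then obtain C' where C': "\<And>u. u \<in> span S \<Longrightarrow> \<bar>h u a' * h u a'\<bar> \<le> C' * g u u"
    using insert.IH[of "\<lambda>x y. h x a' * h y a'"] by (auto simp: mult.commute)
  \<comment> \<open>The summand 1 absorbs the \<open>t\<^sup>2\<close> that arises when
    \<open>2 * (t * h y a')\<close> is estimated by
    \<open>t\<^sup>2 + h y a' * h y a'\<close>.\<close>
  define D where "D = (\<bar>h a' a'\<bar> + 1) / g a' a'"
  have D: "a' \<noteq> 0 \<Longrightarrow> \<bar>h a' a'\<bar> + 1 = D * g a' a'"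
    using pos[of a'] by (simp add: D_def)
  define E where "E = max (C + C') D"
  have "\<bar>h u u\<bar> \<le> E * g u u" if u: "u \<in> span (insert a S)" for u
  proof -
    obtain t where t: "u - t *\<^sub>R a \<in> span S" using span_breakdown_eq[of u a S] u by blast
    define y where "y = u - t *\<^sub>R a + t *\<^sub>R q"
    have y: "y \<in> span S" unfolding y_def using t q(1) by (intro span_add span_scale)
    have uy: "u = y + t *\<^sub>R a'" by (simp add: y_def a'_def algebra_simps)
    have gy: "g a' y = 0" "g y a' = 0" using q(2)[OF y] sym by (auto simp: a'_def)
    have gu: "g u u = g y y + t\<^sup>2 * g a' a'"
      unfolding uy using gy by (simp add: bilinear_ladd[OF g] bilinear_radd[OF g] bilinear_lmul[OF g] bilinear_rmul[OF g] power2_eq_square)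
    have hu: "h u u = h y y + 2 * (t * h y a') + t\<^sup>2 * h a' a'"
      unfolding uy using insert.prems(2)[of a' y]
      by (simp add: bilinear_ladd[OF h] bilinear_radd[OF h] bilinear_lmul[OF h] bilinear_rmul[OF h] power2_eq_square
          distrib_left)
    show ?thesis
    proof (cases "a' = 0")
      case True
      then have "u = y" "h y a' = 0" using uy by (auto simp: bilinear_rzero[OF h])
      have "C' * g y y \<ge> 0" using C'[OF y] by linarith
      then have "C * g y y \<le> (C + C') * g y y" by (simp add: distrib_right)
      also have "\<dots> \<le> E * g y y" unfolding E_def by (intro mult_right_mono nn) auto
      finally show ?thesis using C[OF y] \<open>u = y\<close> by simp
    next
      case False
      have "\<bar>2 * (t * h y a')\<bar> \<le> t\<^sup>2 + h y a' * h y a'"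
        using sum_squares_bound[of t "h y a'"] sum_squares_bound[of t "- h y a'"]
        by (simp add: abs_le_iff power2_eq_square)
      moreover have "\<bar>t\<^sup>2 * h a' a'\<bar> = t\<^sup>2 * \<bar>h a' a'\<bar>" by (simp add: abs_mult)
      ultimately have "\<bar>h u u\<bar> \<le> C * g y y + C' * g y y + t\<^sup>2 * (\<bar>h a' a'\<bar> + 1)"
        unfolding hu using C[OF y] C'[OF y] by (simp add: distrib_left)
      also have "\<dots> = (C + C') * g y y + D * (t\<^sup>2 * g a' a')"
        unfolding D[OF False] by (simp add: algebra_simps)
      also have "\<dots> \<le> E * g y y + E * (t\<^sup>2 * g a' a')"
        unfolding E_def by (intro add_mono mult_right_mono nn mult_nonneg_nonneg) auto
      finally show ?thesis unfolding gu by (simp add: distrib_left)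
    qed
  qed
  then show ?case by blast
qed

text \<open>A coordinate functional of a Hamel basis of the reals over the rationals that contains
  \<open>r\<close>.\<close>

lemma rational_functional_exists:
  assumes "r \<noteq> 0"
  obtains \<phi> :: "real \<Rightarrow> real" where "\<And>x y. \<phi> (x + y) = \<phi> x + \<phi> y"
    "\<And>q x. q \<in> \<rat> \<Longrightarrow> \<phi> (q * x) = q * \<phi> x" "\<And>x. \<phi> x \<in> \<rat>" "\<phi> r = 1"
proof -
  \<comment> \<open>The vector space \<open>rat_space\<close> consists of functions, so real numbers
    enter as constant functions.\<close>
  let ?r = "\<lambda>_::nat. r"
  have ind: "rat_space.independent {?r}"
    using assms by (intro rat_space.independent_insertI)
      (auto simp: rat_space.span_empty rat_space.independent_empty fun_eq_iff)
  define B where "B = rat_space.extend_basis {?r}"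
  have B: "rat_space.independent B" "rat_space.span B = UNIV" "?r \<in> B"
    using rat_space.independent_extend_basis[OF ind] rat_space.span_extend_basis[OF ind]
      rat_space.extend_basis_superset[OF ind] unfolding B_def by auto
  define \<phi> where "\<phi> x = real_of_rat (rat_space.representation B (\<lambda>_. x) ?r)" for x
  show ?thesis
  proof (rule that[of \<phi>])
    show "\<phi> (x + y) = \<phi> x + \<phi> y" for x y
      using rat_space.representation_add[OF B(1), of "\<lambda>_. x" "\<lambda>_. y"] B(2)
      by (simp add: \<phi>_def plus_fun_def of_rat_add add.commute)
    show "\<phi> (q * x) = q * \<phi> x" if q: "q \<in> \<rat>" for q x
    proof -
      obtain c where "q = real_of_rat c" using q by (auto elim: Rats_cases)
      then show ?thesis
        using rat_space.representation_scale[OF B(1), of "\<lambda>_. x" c] B(2)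
        by (simp add: \<phi>_def of_rat_mult)
    qed
    show "\<phi> x \<in> \<rat>" for x by (simp add: \<phi>_def)
    show "\<phi> r = 1" using rat_space.representation_basis[OF B(1,3)] by (simp add: \<phi>_def)
  qed
qed

text \<open>If \<open>p\<close> has degree \<open>m + 1\<close>, then \<open>p (2 t) - 2\<^sup>m\<^sup>+\<^sup>1 p t\<close> has degree at most \<open>m\<close>.\<close>

lemma polynomial_coefficients_in_subspace:
  fixes c :: "nat \<Rightarrow> 'a \<Rightarrow> real"
  assumes S: "rat_space.subspace S"
    and "\<And>t::nat. t \<ge> T \<Longrightarrow> (\<lambda>x. \<Sum>i\<le>m. real t ^ i * c i x) \<in> S" and "i \<le> m"
  shows "c i \<in> S"
  using assms(2,3)
proof (induction m arbitrary: c i)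
  case 0
  then show ?case by (auto dest: meta_spec[of _ T])
next
  case (Suc m)
  have scale: "(\<lambda>x. a * f x) \<in> S" if "f \<in> S" "a \<in> \<rat>" for f a
    using that S by (auto simp: rat_space.subspace_def elim!: Rats_cases)
  have diff: "(\<lambda>x. f x - g x) \<in> S" if "f \<in> S" "g \<in> S" for f g
    using rat_space.subspace_diff[OF S that] by (simp add: fun_diff_def)
  let ?p = "\<lambda>t::nat. \<lambda>x. \<Sum>i\<le>Suc m. real t ^ i * c i x"
  have low: "c i \<in> S" if i: "i \<le> m" for i
  proof -
    have "(\<lambda>x. \<Sum>i\<le>m. real t ^ i * ((2 ^ i - 2 ^ Suc m) * c i x)) \<in> S" if t: "t \<ge> T" for t
    proof -
      have "(\<lambda>x. ?p (2 * t) x - 2 ^ Suc m * ?p t x) \<in> S"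
        using t by (intro diff scale Suc.prems(1)) auto
      moreover have "?p (2 * t) x - 2 ^ Suc m * ?p t x = (\<Sum>i\<le>m. real t ^ i * ((2 ^ i - 2 ^ Suc m) * c i x))" for x
        by (simp add: sum_distrib_left power_mult_distrib algebra_simps sum_subtractf)
      ultimately show ?thesis by simp
    qed
    from Suc.IH[OF this i] have "(\<lambda>x. (2 ^ i - 2 ^ Suc m) * c i x) \<in> S" .
    \<comment> \<open>The factor to be divided out is rational, and nonzero because
      \<open>i \<le> m\<close>.\<close>
    then have "(\<lambda>x. (1 / (2 ^ i - 2 ^ Suc m)) * ((2 ^ i - 2 ^ Suc m) * c i x)) \<in> S"
      by (rule scale) auto
    moreover have "(2::real) ^ i \<noteq> 2 ^ Suc m" using i power_inject_exp[of "2::real" i "Suc m"] by simp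
    ultimately show ?thesis by simp
  qed
  show ?case
  proof (cases "i = Suc m")
    case False
    then show ?thesis using low Suc.prems(2) by simp
  next
    case True
    define t where "t = Suc T"
    have "(\<lambda>x. \<Sum>i\<in>{..m}. real t ^ i * c i x) \<in> S"
    proof -
      have "(\<Sum>i\<in>{..m}. (\<lambda>x. real t ^ i * c i x)) \<in> S"
        using low by (intro rat_space.subspace_sum[OF S] scale) auto
      moreover have "(\<Sum>i\<in>{..m}. (\<lambda>x. real t ^ i * c i x)) = (\<lambda>x. \<Sum>i\<in>{..m}. real t ^ i * c i x)"
        by (induction m) (simp_all add: plus_fun_def)
      ultimately show ?thesis by simp
    qed
    from diff[OF Suc.prems(1)[of t] this] have "(\<lambda>x. real t ^ Suc m * c (Suc m) x) \<in> S"
      by (simp add: t_def)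
    then have "(\<lambda>x. (1 / real t ^ Suc m) * (real t ^ Suc m * c (Suc m) x)) \<in> S"
      by (rule scale) auto
    then show ?thesis using True by (simp add: t_def)
  qed
qed

section \<open>Surjections of lattices\<close>

text \<open>The sequence that appears in the definiteness hypothesis of the theorem; its entries
  beyond index 1 do not matter to a 2-form.\<close>

definition pair :: "'a \<Rightarrow> 'a \<Rightarrow> nat \<Rightarrow> 'a" where
  "pair x y = (\<lambda>i. if i = 0 then x else y)"

lemma alt_forms_2_pair: "\<alpha> \<in> alt_forms 2 \<Longrightarrow> \<alpha> z = \<alpha> (pair (z 0) (z 1))"
  by (rule alt_forms_cong) (auto simp: pair_def less_2_cases_iff)

lemma bilinear_pair:
  assumes a: "\<alpha> \<in> alt_forms 2"
  shows "bilinear (\<lambda>x y. \<alpha> (pair x y))"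
proof -
  have "linear (\<lambda>y. \<alpha> (pair x y))" for x
  proof -
    have "\<alpha> (pair x y) = \<alpha> ((pair x x)(1 := y))" for y
      by (rule alt_forms_cong[OF a]) (auto simp: pair_def less_2_cases_iff)
    then show ?thesis using alt_forms_linear[OF a, of 1] by simp
  qed
  moreover have "linear (\<lambda>x. \<alpha> (pair x y))" for y
  proof -
    have "\<alpha> (pair x y) = \<alpha> ((pair y y)(0 := x))" for x
      by (rule alt_forms_cong[OF a]) (auto simp: pair_def less_2_cases_iff)
    then show ?thesis using alt_forms_linear[OF a, of 0] by simp
  qed
  ultimately show ?thesis by (simp add: bilinear_def)
qed

lemma pair_swap:
  fixes \<alpha> :: "(nat \<Rightarrow> 'v::real_vector) \<Rightarrow> real"
  assumes a: "\<alpha> \<in> alt_forms 2"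
  shows "\<alpha> (pair y x) = - \<alpha> (pair x y)"
proof -
  have "\<alpha> (pair y x) = \<alpha> (\<lambda>l. pair x y (Transposition.transpose 0 1 l))"
    by (rule alt_forms_cong[OF a]) (auto simp: pair_def less_2_cases_iff)
  then show ?thesis using alt_forms_transpose[OF a, of 0 1 "pair x y"] by simp
qed

lemma alt_forms_2I:
  fixes E :: "'v::real_vector \<Rightarrow> 'v \<Rightarrow> real"
  assumes E: "bilinear E" and z: "\<And>x. E x x = 0"
  shows "(\<lambda>x. E (x 0) (x 1)) \<in> alt_forms 2"
proof (rule alt_formsI)
  show "linear (\<lambda>v. E ((x(i := v)) 0) ((x(i := v)) 1))" if "i < 2" for i and x :: "nat \<Rightarrow> 'v"
    using E that by (auto simp: bilinear_def less_2_cases_iff)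
  show "E (x 0) (x 1) = 0" if "i < 2" "j < 2" "i \<noteq> j" "x i = x j" for i j and x :: "nat \<Rightarrow> 'v"
    using that z by (auto simp: less_2_cases_iff)
qed auto

text \<open>Both sizes are the trace of the identity, computed in the two bases.\<close>

lemma dual_basis_size_unique:
  fixes b c :: "nat \<Rightarrow> 'v::real_vector"
  assumes b: "dual_basis d b e" and c: "dual_basis d' c e'"
  shows "d = d'"
proof -
  have 1: "(\<Sum>i<d. e i v * g (b i)) = g v" if g: "linear g" for g :: "'v \<Rightarrow> real" and v
  proof -
    have "g v = g (\<Sum>i<d. e i v *\<^sub>R b i)" using dual_basisD(3)[OF b, of v] by simp
    then show ?thesis by (simp only: linear_sum[OF g] linear_scale[OF g] real_scaleR_def)
  qed
  have 2: "(\<Sum>j<d'. e' j v * g (c j)) = g v" if g: "linear g" for g :: "'v \<Rightarrow> real" and v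
  proof -
    have "g v = g (\<Sum>j<d'. e' j v *\<^sub>R c j)" using dual_basisD(3)[OF c, of v] by simp
    then show ?thesis by (simp only: linear_sum[OF g] linear_scale[OF g] real_scaleR_def)
  qed
  have "real d = (\<Sum>i<d. e i (b i))"
    using dual_basisD(2)[OF b] by simp
  also have "\<dots> = (\<Sum>i<d. \<Sum>j<d'. e' j (b i) * e i (c j))"
    using 2 dual_basisD(1)[OF b] by simp
  also have "\<dots> = (\<Sum>j<d'. \<Sum>i<d. e i (c j) * e' j (b i))"
    by (subst sum.swap) (simp add: mult.commute)
  also have "\<dots> = (\<Sum>j<d'. e' j (c j))"
    using 1 dual_basisD(1)[OF c] by simp
  also have "\<dots> = real d'"
    using dual_basisD(2)[OF c] by simp
  finally show ?thesis by simp
qed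

locale lattice_surjection =
  fixes N n :: nat
    and Jh :: "'u::real_vector \<Rightarrow> 'u" and Lh :: "'u set" and bU :: "nat \<Rightarrow> 'u" and eU :: "nat \<Rightarrow> 'u \<Rightarrow> real"
    and J :: "'v::real_vector \<Rightarrow> 'v" and L :: "'v set" and bV :: "nat \<Rightarrow> 'v" and eV :: "nat \<Rightarrow> 'v \<Rightarrow> real"
    and f :: "'u \<Rightarrow> 'v"
  assumes dual_U: "dual_basis (2 * N) bU eU" and lattice_U: "lattice_basis (2 * N) Lh bU"
    and dual_V: "dual_basis (2 * n) bV eV" and lattice_V: "lattice_basis (2 * n) L bV"
    and Jh: "complex_structure Jh" and J: "complex_structure J"
    and linear_f: "linear f" and f_J: "\<And>x. f (Jh x) = J (f x)" and f_lattice: "f ` Lh \<subseteq> L"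
    and surj_f: "surj f"
begin

lemma linear_Jh: "linear Jh" and Jh_Jh: "Jh (Jh x) = - x" and linear_J: "linear J"
  using Jh J by (auto simp: complex_structure_def)

lemma span_U: "span (bU ` {..<2 * N}) = UNIV"
proof -
  have "x \<in> span (bU ` {..<2 * N})" for x
  proof -
    have "(\<Sum>i<2 * N. eU i x *\<^sub>R bU i) \<in> span (bU ` {..<2 * N})"
      by (intro span_sum span_scale span_base) auto
    then show ?thesis using dual_basisD(3)[OF dual_U, of x] by simp
  qed
  then show ?thesis by auto
qed

text \<open>A real basis is enough for projections along the kernel; nothing is claimed about its
  rationality.\<close>

lemma kernel_basis:
  obtains B where "finite B" "independent B" "span B = {x. f x = 0}"
proof -
  have K: "subspace {x. f x = 0}"
    by (auto simp: subspace_def linear_0[OF linear_f] linear_add[OF linear_f] linear_scale[OF linear_f])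
  obtain B where B: "B \<subseteq> {x. f x = 0}" "independent B" "{x. f x = 0} \<subseteq> span B"
    by (rule real_vector.basis_exists[of "{x. f x = 0}"])
  have "finite B"
    using independent_span_bound[of "bU ` {..<2 * N}" B] B(2) span_U by auto
  moreover have "span B = {x. f x = 0}"
    using B(1,3) span_minimal[OF _ K] by auto
  ultimately show ?thesis using that B(2) by blast
qed

text \<open>Applying a \<open>\<rat>\<close>-linear functional \<open>\<phi> : \<real> \<rightarrow> \<rat>\<close> to the coordinates preserves every linear
  equation with rational coefficients, so a unique real solution of such equations is rational.\<close>

definition rational_extension :: "(real \<Rightarrow> real) \<Rightarrow> 'u \<Rightarrow> 'u" where
  "rational_extension \<phi> x = (\<Sum>i<2 * N. \<phi> (eU i x) *\<^sub>R bU i)"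

lemma rational_extension_functional:
  assumes add: "\<And>x y. \<phi> (x + y) = \<phi> x + \<phi> y" and scale: "\<And>q x. q \<in> \<rat> \<Longrightarrow> \<phi> (q * x) = q * \<phi> x"
    and psi: "linear \<psi>" and rat: "\<And>i. i < 2 * N \<Longrightarrow> \<psi> (bU i) \<in> \<rat>"
  shows "\<psi> (rational_extension \<phi> x) = \<phi> (\<psi> x)"
proof -
  have z: "\<phi> 0 = 0" using add[of 0 0] by simp
  have sum: "\<phi> (\<Sum>i\<in>I. g i) = (\<Sum>i\<in>I. \<phi> (g i))" for I :: "nat set" and g
    by (induction I rule: infinite_finite_induct) (simp_all add: z add)
  have "\<psi> (rational_extension \<phi> x) = (\<Sum>i<2 * N. \<psi> (bU i) * \<phi> (eU i x))"
    unfolding rational_extension_def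
    by (simp add: linear_sum[OF psi] linear_scale[OF psi] mult.commute)
  also have "\<dots> = \<phi> (\<Sum>i<2 * N. \<psi> (bU i) * eU i x)"
    unfolding sum using scale rat by (intro sum.cong) auto
  also have "(\<Sum>i<2 * N. \<psi> (bU i) * eU i x) = \<psi> (\<Sum>i<2 * N. eU i x *\<^sub>R bU i)"
    by (simp add: linear_sum[OF psi] linear_scale[OF psi] mult.commute)
  also have "\<dots> = \<psi> x"
    using dual_basisD(3)[OF dual_U, of x] by simp
  finally show ?thesis .
qed

text \<open>The section inverts \<open>f\<close> on the \<open>\<omega>\<close>-orthogonal
  complement of its kernel. Definiteness provides existence and uniqueness of the preimage, and
  every other property, such as linearity and compatibility with \<open>J\<close>, follows from
  uniqueness.\<close>

lemma orthogonal_section_exists: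
  assumes om: "\<omega> \<in> hodge_classes 1 Jh Lh" and def: "\<And>u. u \<noteq> 0 \<Longrightarrow> \<omega> (pair u (Jh u)) \<noteq> 0"
  obtains s where "linear s" "\<And>v. f (s v) = v" "\<And>v. s (J v) = Jh (s v)"
    "\<And>v i. v \<in> L \<Longrightarrow> i < 2 * N \<Longrightarrow> eU i (s v) \<in> \<rat>" "\<And>x v. f x = 0 \<Longrightarrow> \<omega> (pair x (s v)) = 0"
proof -
  have rat: "\<omega> \<in> rational_forms 2 Lh" and inv: "\<And>x. \<omega> (\<lambda>i. Jh (x i)) = \<omega> x"
    using om hodge_classes_1_iff[OF dual_U Jh] by auto
  note alt = rational_formsD(1)[OF rat]
  note bil = bilinear_pair[OF alt]
  have inv2: "\<omega> (pair (Jh x) (Jh y)) = \<omega> (pair x y)" for x y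
    using inv[of "pair x y"] alt_forms_2_pair[OF alt, of "\<lambda>i. Jh (pair x y i)"] by (simp add: pair_def)
  have Jswap: "\<omega> (pair (Jh x) y) = - \<omega> (pair x (Jh y))" for x y
    using inv2[of x "Jh y"] bilinear_rneg[OF bil] by (simp add: Jh_Jh)
  have kerJ: "f (Jh x) = 0" if "f x = 0" for x
    using that f_J linear_0[OF linear_J] by simp
  \<comment> \<open>The alternating \<open>\<omega>\<close> admits no orthogonal projection by
    itself. The form \<open>g\<close> is symmetric and anisotropic, and since the kernel is stable
    under \<open>Jh\<close>, being orthogonal to it means the same for \<open>g\<close> and for
    \<open>\<omega>\<close>.\<close>
  define g where "g x y = \<omega> (pair x (Jh y))" for x y
  have g: "bilinear g"
    using bil linear_compose[OF linear_Jh] unfolding g_def bilinear_def comp_def by blast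
  have an: "g x x \<noteq> 0" if "x \<noteq> 0" for x
    using def[OF that] by (simp add: g_def)
  have gsym: "g x y = g y x" for x y
    unfolding g_def using Jswap[of y x] pair_swap[OF alt, of x "Jh y"] by simp
  obtain B where B: "finite B" "independent B" "span B = {x. f x = 0}"
    by (rule kernel_basis)
  define perp where "perp w \<longleftrightarrow> (\<forall>k. f k = 0 \<longrightarrow> \<omega> (pair w k) = 0)" for w
  have ex: "\<exists>w. f w = v \<and> perp w" for v
  proof -
    obtain x where x: "f x = v" using surj_f by (metis surjD)
    obtain p where p: "p \<in> span B" "\<And>k. k \<in> span B \<Longrightarrow> g (x - p) k = 0"
      using orthogonal_projection_exists[OF g gsym an B(1), of x] by blast
    have "\<omega> (pair (x - p) k) = 0" if "f k = 0" for k
    proof -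
      have "f (- Jh k) = 0" using kerJ[OF that] linear_neg[OF linear_f] by simp
      then have "g (x - p) (- Jh k) = 0" using p(2) B(3) by simp
      then show ?thesis by (simp add: g_def linear_neg[OF linear_Jh] Jh_Jh)
    qed
    then show ?thesis
      using x p(1) B(3) linear_diff[OF linear_f] by (intro exI[of _ "x - p"]) (auto simp: perp_def)
  qed
  \<comment> \<open>The difference of two solutions lies in the kernel and is orthogonal to it, in
    particular to its own image under \<open>Jh\<close>.\<close>
  have uniq: "w = w'" if w: "f w = f w'" "perp w" "perp w'" for w w'
  proof (rule ccontr)
    assume "w \<noteq> w'"
    moreover have "f (w - w') = 0" using w linear_diff[OF linear_f] by simp
    then have "\<omega> (pair w (Jh (w - w'))) = 0" "\<omega> (pair w' (Jh (w - w'))) = 0"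
      using kerJ w unfolding perp_def by blast+
    then have "\<omega> (pair (w - w') (Jh (w - w'))) = 0"
      using bilinear_lsub[OF bil, of w w'] by simp
    ultimately show False using def[of "w - w'"] by simp
  qed
  define s where "s v = (SOME w. f w = v \<and> perp w)" for v
  have s: "f (s v) = v" "perp (s v)" for v
    using someI_ex[OF ex[of v]] unfolding s_def by auto
  have sI: "s v = w" if "f w = v" "perp w" for v w
    using uniq[of "s v" w] s[of v] that by simp
  have perp_add: "perp (x + y)" if "perp x" "perp y" for x y
    using that bilinear_ladd[OF bil] by (simp add: perp_def)
  have perp_scale: "perp (c *\<^sub>R x)" if "perp x" for c x
    using that bilinear_lmul[OF bil] by (simp add: perp_def)
  have perp_J: "perp (Jh x)" if "perp x" for x
    using that kerJ by (simp add: perp_def Jswap)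
  show ?thesis
  proof (rule that[of s])
    show "linear s"
    proof (rule linearI)
      show "s (x + y) = s x + s y" for x y
        by (rule sI) (simp_all add: linear_add[OF linear_f] s perp_add)
      show "s (c *\<^sub>R x) = c *\<^sub>R s x" for c x
        by (rule sI) (simp_all add: linear_scale[OF linear_f] s perp_scale)
    qed
    show "f (s v) = v" for v by (rule s)
    show "s (J v) = Jh (s v)" for v
      by (rule sI) (simp_all add: f_J s perp_J)
    show "\<omega> (pair x (s v)) = 0" if "f x = 0" for x v
      using s(2)[of v] that pair_swap[OF alt, of x "s v"] by (simp add: perp_def)
    show "eU i (s v) \<in> \<rat>" if v: "v \<in> L" and i: "i < 2 * N" for v i
    proof -
      obtain \<rho> :: "real \<Rightarrow> real" where rho: "\<And>x y. \<rho> (x + y) = \<rho> x + \<rho> y"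
        "\<And>q x. q \<in> \<rat> \<Longrightarrow> \<rho> (q * x) = q * \<rho> x" "\<And>x. \<rho> x \<in> \<rat>" "\<rho> 1 = 1"
        by (rule rational_functional_exists[of 1]) auto
      have rho_rat: "\<rho> q = q" if "q \<in> \<rat>" for q
        using rho(2)[OF that, of 1] rho(4) by simp
      have unit: "eU j (bU i) \<in> \<rat>" if "j < 2 * N" "i < 2 * N" for i j
        using dual_basisD(2)[OF dual_U that] by simp
      have eU_ext: "eU j (rational_extension \<phi> x) = \<phi> (eU j x)"
        if "\<And>x y. \<phi> (x + y) = \<phi> x + \<phi> y" "\<And>q x. q \<in> \<rat> \<Longrightarrow> \<phi> (q * x) = q * \<phi> x" "j < 2 * N" for \<phi> j x
        by (rule rational_extension_functional[OF that(1,2) dual_basisD(1)[OF dual_U that(3)] unit[OF that(3)]])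
      have eV_rat: "eV j (f (bU i)) \<in> \<rat>" if "j < 2 * n" "i < 2 * N" for i j
        using lattice_coordinates[OF lattice_V dual_V _ that(1)] f_lattice
          lattice_basis_in_lattice[OF lattice_U that(2)] Ints_subset_Rats by blast
      have eV_ext: "eV j (f (rational_extension \<phi> x)) = \<phi> (eV j (f x))"
        if "\<And>x y. \<phi> (x + y) = \<phi> x + \<phi> y" "\<And>q x. q \<in> \<rat> \<Longrightarrow> \<phi> (q * x) = q * \<phi> x" "j < 2 * n" for \<phi> j x
        using rational_extension_functional[of \<phi> "\<lambda>x. eV j (f x)"]
          linear_compose[OF linear_f dual_basisD(1)[OF dual_V that(3)]] that eV_rat
        by (simp add: comp_def)
      have om_rat: "\<omega> (pair x y) \<in> \<rat>"
        if x: "\<And>i. i < 2 * N \<Longrightarrow> eU i x \<in> \<rat>" and y: "\<And>i. i < 2 * N \<Longrightarrow> eU i y \<in> \<rat>" for x y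
      proof -
        obtain m :: nat where m: "m > 0" "real m *\<^sub>R x \<in> Lh"
          using rational_multiple_in_lattice[OF lattice_U dual_U x] by blast
        obtain l :: nat where l: "l > 0" "real l *\<^sub>R y \<in> Lh"
          using rational_multiple_in_lattice[OF lattice_U dual_U y] by blast
        have "\<omega> (pair (real m *\<^sub>R x) (real l *\<^sub>R y)) \<in> \<rat>"
          using m l by (intro rational_formsD(2)[OF rat]) (simp add: pair_def)
        then have "real m * (real l * \<omega> (pair x y)) \<in> \<rat>"
          by (simp add: bilinear_lmul[OF bil] bilinear_rmul[OF bil] mult_ac)
        then have "real m * (real l * \<omega> (pair x y)) / (real m * real l) \<in> \<rat>"
          by (intro Rats_divide) auto
        then show ?thesis using m l by simp
      qed
      \<comment> \<open>The vector \<open>?w'\<close> has rational coordinates. It is shown to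
        satisfy the same equations as \<open>?w\<close>, so the two agree by uniqueness.\<close>
      let ?w = "s v"
      let ?w' = "rational_extension \<rho> ?w"
      have w'_rat: "eU j ?w' \<in> \<rat>" if "j < 2 * N" for j
        using eU_ext[OF rho(1,2) that] rho(3) by simp
      have "perp ?w'"
        unfolding perp_def
      proof (intro allI impI, rule ccontr)
        fix k assume k: "f k = 0" and nz: "\<omega> (pair ?w' k) \<noteq> 0"
        \<comment> \<open>A real kernel vector \<open>k\<close> that violates orthogonality is
          turned into a rational kernel vector \<open>?l\<close> with
          \<open>\<omega> (pair ?w' ?l) = 1\<close>. For rational \<open>?l\<close>, however, this
          value is also \<open>\<rho>\<close> applied to
          \<open>\<omega> (pair ?w ?l) = 0\<close>.\<close>
        obtain \<phi> :: "real \<Rightarrow> real" where phi: "\<And>x y. \<phi> (x + y) = \<phi> x + \<phi> y"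
          "\<And>q x. q \<in> \<rat> \<Longrightarrow> \<phi> (q * x) = q * \<phi> x" "\<And>x. \<phi> x \<in> \<rat>" "\<phi> (\<omega> (pair ?w' k)) = 1"
          by (rule rational_functional_exists[OF nz]) auto
        let ?l = "rational_extension \<phi> k"
        have z: "\<phi> 0 = 0" "\<rho> 0 = 0" using phi(1)[of 0 0] rho(1)[of 0 0] by simp_all
        have l_rat: "eU j ?l \<in> \<rat>" if "j < 2 * N" for j
          using eU_ext[OF phi(1,2) that] phi(3) by simp
        have "f ?l = 0"
        proof -
          have "eV j (f ?l) = 0" if "j < 2 * n" for j
            using eV_ext[OF phi(1,2) that] k z linear_0[OF dual_basisD(1)[OF dual_V that]] by simp
          then show ?thesis using dual_basisD(3)[OF dual_V, of "f ?l"] by simp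
        qed
        then have "\<omega> (pair ?w ?l) = 0" using s(2) by (simp add: perp_def)
        moreover have "\<omega> (pair ?w' ?l) = \<rho> (\<omega> (pair ?w ?l))"
          using rational_extension_functional[OF rho(1,2), of "\<lambda>x. \<omega> (pair x ?l)" ?w] bil om_rat unit l_rat
          by (simp add: bilinear_def)
        moreover have "\<omega> (pair ?w' ?l) = \<phi> (\<omega> (pair ?w' k))"
          using rational_extension_functional[OF phi(1,2), of "\<lambda>x. \<omega> (pair ?w' x)" k] bil om_rat unit w'_rat
          by (simp add: bilinear_def)
        ultimately show False using phi(4) z by simp
      qed
      \<comment> \<open>The coordinates of the lattice vector \<open>v\<close> are rational, and
        \<open>\<rho>\<close> fixes rational numbers.\<close>
      moreover have "f ?w' = v"
      proof -
        have "eV j (f ?w') = eV j v" if "j < 2 * n" for j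
          using eV_ext[OF rho(1,2) that, of ?w] s(1)[of v] rho_rat
            lattice_coordinates[OF lattice_V dual_V v that] Ints_subset_Rats by auto
        then have "(\<Sum>j<2 * n. eV j (f ?w') *\<^sub>R bV j) = (\<Sum>j<2 * n. eV j v *\<^sub>R bV j)" by simp
        then show ?thesis using dual_basisD(3)[OF dual_V] by metis
      qed
      ultimately have "?w = ?w'" using sI by blast
      then show ?thesis using w'_rat[OF i] by simp
    qed
  qed
qed

text \<open>The characterization of the pushforward as a relation. It is linear in both arguments
  without presupposing that every form has a pushforward.\<close>

definition push_rel :: "nat \<Rightarrow> ((nat \<Rightarrow> 'u) \<Rightarrow> real) \<Rightarrow> ((nat \<Rightarrow> 'v) \<Rightarrow> real) \<Rightarrow> bool" where
  "push_rel q \<beta> \<gamma> \<longleftrightarrow> \<gamma> \<in> alt_forms (2 * (n - q)) \<and>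
     (\<forall>u\<in>alt_forms (2 * q). wedge (2 * (n - q)) (2 * q) \<gamma> u bV =
        wedge (2 * (N - q)) (2 * q) \<beta> (pullback f u) bU)"

lemma push_rel_unique:
  assumes q: "q \<le> n" and g: "push_rel q \<beta> \<gamma>" "push_rel q \<beta> \<gamma>'"
  shows "\<gamma> = \<gamma>'"
proof -
  have "(\<lambda>x. \<gamma> x + (-1) * \<gamma>' x) = (\<lambda>x. 0)"
  proof (rule wedge_nondegenerate[OF dual_V, of _ "2 * (n - q)"])
    show "(\<lambda>x. \<gamma> x + (-1) * \<gamma>' x) \<in> alt_forms (2 * (n - q))"
      using g by (intro add_in_alt_forms scale_in_alt_forms) (auto simp: push_rel_def)
    show "2 * (n - q) \<le> 2 * n" by simp
    have e: "2 * n - 2 * (n - q) = 2 * q" using q by simp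
    fix u :: "(nat \<Rightarrow> 'v) \<Rightarrow> real" assume "u \<in> alt_forms (2 * n - 2 * (n - q))"
    then show "wedge (2 * (n - q)) (2 * n - 2 * (n - q)) (\<lambda>x. \<gamma> x + (-1) * \<gamma>' x) u bV = 0"
      unfolding e wedge_add_left wedge_scale_left using g by (simp add: push_rel_def)
  qed
  then show ?thesis by (simp add: fun_eq_iff)
qed

lemma push_rel_zero: "push_rel q (\<lambda>x. 0) (\<lambda>x. 0)"
  by (simp add: push_rel_def zero_in_alt_forms wedge_zero_left)

lemma push_rel_add:
  "push_rel q \<beta> \<gamma> \<Longrightarrow> push_rel q \<beta>' \<gamma>' \<Longrightarrow> push_rel q (\<lambda>x. \<beta> x + \<beta>' x) (\<lambda>x. \<gamma> x + \<gamma>' x)"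
  by (simp add: push_rel_def add_in_alt_forms wedge_add_left)

lemma push_rel_scale: "push_rel q \<beta> \<gamma> \<Longrightarrow> push_rel q (\<lambda>x. c * \<beta> x) (\<lambda>x. c * \<gamma> x)"
  by (simp add: push_rel_def scale_in_alt_forms wedge_scale_left)

end

text \<open>Collects the forms along the kernel in the first factor and the forms pulled back from
  \<open>A\<close> in the second; \<open>\<epsilon>\<close> may pass \<open>\<alpha>\<close> because
  its degree is even.\<close>

lemma wedge_exchange:
  fixes \<kappa> \<alpha> \<epsilon> \<upsilon> :: "(nat \<Rightarrow> 'v::real_vector) \<Rightarrow> real"
  assumes k: "\<kappa> \<in> alt_forms (2 * j)" and a: "\<alpha> \<in> alt_forms (2 * i)"
    and e: "\<epsilon> \<in> alt_forms 2" and u: "\<upsilon> \<in> alt_forms r"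
  shows "wedge (2 * j + 2 * i + 2) r (wedge (2 * j + 2 * i) 2 (wedge (2 * j) (2 * i) \<kappa> \<alpha>) \<epsilon>) \<upsilon>
    = wedge (2 * j + 2) (2 * i + r) (wedge (2 * j) 2 \<kappa> \<epsilon>) (wedge (2 * i) r \<alpha> \<upsilon>)"
proof -
  have "wedge (2 * j + 2 * i) 2 (wedge (2 * j) (2 * i) \<kappa> \<alpha>) \<epsilon>
      = wedge (2 * j) (2 * i + 2) \<kappa> (wedge (2 * i) 2 \<alpha> \<epsilon>)"
    by (rule wedge_assoc[OF k a e])
  also have "wedge (2 * i) 2 \<alpha> \<epsilon> = wedge 2 (2 * i) \<epsilon> \<alpha>"
    by (rule wedge_commute_even[OF a e]) simp
  also have "wedge (2 * j) (2 * i + 2) \<kappa> (wedge 2 (2 * i) \<epsilon> \<alpha>)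
      = wedge (2 * j + 2) (2 * i) (wedge (2 * j) 2 \<kappa> \<epsilon>) \<alpha>"
    using wedge_assoc[OF k e a] by (simp add: add.commute)
  finally show ?thesis
    using wedge_assoc[OF wedge_in_alt_forms[OF k e] a u] by (simp add: ac_simps)
qed

lemma wedge_power_scale: "wedge_power d (\<lambda>x. c * \<alpha> x) m = (\<lambda>x. c ^ m * wedge_power d \<alpha> m x)"
proof (induction m)
  case (Suc m)
  have "wedge_power d (\<lambda>x. c * \<alpha> x) (Suc m)
      = wedge d (d * m) (\<lambda>x. c * \<alpha> x) (\<lambda>x. c ^ m * wedge_power d \<alpha> m x)"
    by (simp only: wedge_power_Suc Suc.IH)
  also have "\<dots> = (\<lambda>x. c * wedge d (d * m) \<alpha> (\<lambda>x. c ^ m * wedge_power d \<alpha> m x) x)"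
    by (rule wedge_scale_left)
  also have "wedge d (d * m) \<alpha> (\<lambda>x. c ^ m * wedge_power d \<alpha> m x)
      = (\<lambda>x. c ^ m * wedge d (d * m) \<alpha> (wedge_power d \<alpha> m) x)"
    by (rule wedge_scale_right)
  finally show ?case
    by (simp only: wedge_power_Suc[of d \<alpha> m] power_Suc mult.assoc)
qed (simp add: wedge_power_0)

lemma sum_fun_apply: "(\<Sum>i\<in>I. F i) x = (\<Sum>i\<in>I. F i x)"
  by (induction I rule: infinite_finite_induct) simp_all

text \<open>Secures finite-dimensionality: \<open>rat_space.dim\<close> is only a meaningful bound
  where a finite basis exists.\<close>

lemma rational_2_forms_finite_span:
  fixes b :: "nat \<Rightarrow> 'v::real_vector"
  assumes b: "dual_basis d b e" and L: "lattice_basis d L b"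
  shows "\<exists>W. finite W \<and> rational_forms 2 L \<subseteq> rat_space.span W"
proof (intro exI conjI subsetI)
  let ?w = "\<lambda>(i, j). wedge 1 1 (one_form (e j)) (one_form (e i))"
  let ?W = "?w ` ({..<d} \<times> {..<d})"
  show "finite ?W" by simp
  fix \<alpha> assume \<alpha>: "\<alpha> \<in> rational_forms 2 L"
  note alt = rational_formsD(1)[OF \<alpha>]
  define r where "r i j = \<alpha> (pair (b j) (b i))" for i j
  have r: "r i j \<in> \<rat>" if "i < d" "j < d" for i j
    unfolding r_def using lattice_basis_in_lattice[OF L] that
    by (intro rational_formsD(2)[OF \<alpha>]) (simp add: pair_def)
  have c: "contract 2 (b i) \<alpha> = (\<lambda>x. \<Sum>j<d. r i j * one_form (e j) x)" if "i < d" for i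
  proof
    fix x :: "nat \<Rightarrow> 'v"
    have l: "linear (\<lambda>y. \<alpha> (pair y (b i)))" using bilinear_pair[OF alt] by (simp add: bilinear_def)
    have "contract 2 (b i) \<alpha> x = \<alpha> (pair (x 0) (b i))"
      using alt_forms_2_pair[OF alt, of "x(1 := b i)"] by (simp add: contract_def)
    also have "\<dots> = \<alpha> (pair (\<Sum>j<d. e j (x 0) *\<^sub>R b j) (b i))"
      using dual_basisD(3)[OF b, of "x 0"] by simp
    also have "\<dots> = (\<Sum>j<d. r i j * e j (x 0))"
      by (simp add: linear_sum[OF l] linear_scale[OF l] r_def mult.commute)
    finally show "contract 2 (b i) \<alpha> x = (\<Sum>j<d. r i j * one_form (e j) x)"
      by (simp add: one_form_def)
  qed
  have "\<alpha> x = (\<Sum>i<d. \<Sum>j<d. (r i j / 2) * wedge 1 1 (one_form (e j)) (one_form (e i)) x)" for x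
  proof -
    have "2 * \<alpha> x = (\<Sum>i<d. wedge 1 1 (contract 2 (b i) \<alpha>) (one_form (e i)) x)"
      using sum_contract_wedge_dual[OF b alt, of x] by simp
    also have "\<dots> = (\<Sum>i<d. \<Sum>j<d. r i j * wedge 1 1 (one_form (e j)) (one_form (e i)) x)"
      by (intro sum.cong refl) (simp add: c wedge_sum_left wedge_scale_left del: One_nat_def)
    finally show ?thesis by (simp add: sum_divide_distrib[symmetric])
  qed
  then have eq: "\<alpha> = (\<Sum>i<d. \<Sum>j<d. (\<lambda>x. (r i j / 2) * ?w (i, j) x))"
    by (simp add: fun_eq_iff sum_fun_apply)
  show "\<alpha> \<in> rat_space.span ?W"
    unfolding eq
  proof (intro rat_space.span_sum)
    fix i j assume ij: "i \<in> {..<d}" "j \<in> {..<d}"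
    have "r i j / 2 \<in> \<rat>" using r ij by simp
    then obtain c where "r i j / 2 = real_of_rat c" by (rule Rats_cases)
    moreover have "(\<lambda>x. real_of_rat c * ?w (i, j) x) \<in> rat_space.span ?W"
      using ij by (intro rat_space.span_scale rat_space.span_base) blast
    ultimately show "(\<lambda>x. (r i j / 2) * ?w (i, j) x) \<in> rat_space.span ?W" by simp
  qed
qed

section \<open>Integration over the fibre\<close>

locale split_surjection = lattice_surjection N n Jh Lh bU eU J L bV eV f
  for N n :: nat
    and Jh :: "'u::real_vector \<Rightarrow> 'u" and Lh :: "'u set" and bU :: "nat \<Rightarrow> 'u" and eU :: "nat \<Rightarrow> 'u \<Rightarrow> real"
    and J :: "'v::real_vector \<Rightarrow> 'v" and L :: "'v set" and bV :: "nat \<Rightarrow> 'v" and eV :: "nat \<Rightarrow> 'v \<Rightarrow> real"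
    and f :: "'u \<Rightarrow> 'v" +
  fixes s :: "'v \<Rightarrow> 'u"
  assumes linear_s: "linear s" and f_s: "\<And>v. f (s v) = v" and s_J: "\<And>v. s (J v) = Jh (s v)"
    and s_rational: "\<And>v i. v \<in> L \<Longrightarrow> i < 2 * N \<Longrightarrow> eU i (s v) \<in> \<rat>"
begin

definition proj :: "'u \<Rightarrow> 'u" where "proj x = x - s (f x)"

text \<open>The map \<open>stretch\<close> is the identity on the kernel of \<open>f\<close> and multiplication by 2 on the image of
  \<open>s\<close>. It multiplies a form by a power of 2 that records its degree along the image of \<open>s\<close>, and a top
  form by \<open>2\<^sup>2\<^sup>n\<close>; this decides which terms of the expansion survive.\<close>

definition stretch :: "'u \<Rightarrow> 'u" where "stretch x = x + s (f x)"

lemma linear_proj: "linear proj"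
  unfolding proj_def
  by (auto intro!: linearI simp: linear_add[OF linear_f] linear_add[OF linear_s]
      linear_scale[OF linear_f] linear_scale[OF linear_s] algebra_simps)

lemma f_proj: "f (proj x) = 0" and proj_s: "proj (s v) = 0" and f_stretch: "f (stretch x) = 2 *\<^sub>R f x"
  and proj_stretch: "proj (stretch x) = proj x"
  unfolding proj_def stretch_def
  by (simp_all add: linear_add[OF linear_f] linear_diff[OF linear_f] linear_add[OF linear_s] f_s scaleR_2)

lemma rational_pullback_f:
  assumes "\<alpha> \<in> rational_forms k L"
  shows "pullback f \<alpha> \<in> rational_forms k Lh"
  by (rule rational_forms_pullback[OF assms linear_f]) (use f_lattice in \<open>auto intro!: exI[of _ 1]\<close>)

lemma rational_pullback_s:
  assumes "\<alpha> \<in> rational_forms k Lh"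
  shows "pullback s \<alpha> \<in> rational_forms k L"
  by (rule rational_forms_pullback[OF assms linear_s])
    (rule rational_multiple_in_lattice[OF lattice_U dual_U s_rational])

lemma rational_pullback_proj:
  assumes "\<alpha> \<in> rational_forms k Lh"
  shows "pullback proj \<alpha> \<in> rational_forms k Lh"
proof (rule rational_forms_pullback[OF assms linear_proj])
  fix x assume x: "x \<in> Lh"
  show "\<exists>m::nat. m > 0 \<and> real m *\<^sub>R proj x \<in> Lh"
  proof (rule rational_multiple_in_lattice[OF lattice_U dual_U])
    fix i assume i: "i < 2 * N"
    have "eU i x \<in> \<rat>" using lattice_coordinates[OF lattice_U dual_U x i] Ints_subset_Rats by blast
    moreover have "eU i (s (f x)) \<in> \<rat>" using s_rational i x f_lattice by blast
    ultimately show "eU i (proj x) \<in> \<rat>"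
      unfolding proj_def linear_diff[OF dual_basisD(1)[OF dual_U i]] by (rule Rats_diff)
  qed
qed

lemma pullback_stretch_proj: "pullback stretch (pullback proj \<alpha>) = pullback proj \<alpha>"
  by (simp add: pullback_def proj_stretch)

lemma pullback_stretch_f:
  fixes u :: "(nat \<Rightarrow> 'v) \<Rightarrow> real"
  assumes "u \<in> alt_forms k"
  shows "pullback stretch (pullback f u) = (\<lambda>x. 2 ^ k * pullback f u x)"
  using alt_forms_scale_args[OF assms, of "\<lambda>_. 2"] by (simp add: pullback_def f_stretch fun_eq_iff)

lemma top_form_stretch:
  fixes X :: "(nat \<Rightarrow> 'u) \<Rightarrow> real"
  assumes X: "X \<in> alt_forms (2 * N)" and st: "\<And>x. pullback stretch X x = 2 ^ d * X x" and d: "d \<noteq> 2 * n"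
  shows "X x = 0"
proof -
  obtain B where B: "finite B" "independent B" "span B = {x. f x = 0}"
    by (rule kernel_basis)
  obtain h where h: "bij_betw h {0..<card B} B"
    using ex_bij_betw_nat_finite[OF B(1)] by blast
  define r where "r = card B"
  have hB: "h i \<in> B" if "i < r" for i
    using h that by (auto simp: r_def bij_betw_def)
  have fh: "f (h i) = 0" if "i < r" for i
    using span_base[OF hB[OF that]] B(3) by blast
  \<comment> \<open>A basis of the kernel followed by the image of \<open>bV\<close> under
    \<open>s\<close>, on which \<open>stretch\<close> is diagonal.\<close>
  define c where "c i = (if i < r then h i else s (bV (i - r)))" for i
  define e where "e i x = (if i < r then representation B (proj x) (h i) else eV (i - r) (f x))" for i x
  have projB: "proj x \<in> span B" for x using f_proj B(3) by simp
  have split: "{..<r + 2 * n} = {..<r} \<union> (\<lambda>i. r + i) ` {..<2 * n}"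
  proof (intro equalityI subsetI)
    fix i assume "i \<in> {..<r + 2 * n}"
    then show "i \<in> {..<r} \<union> (\<lambda>i. r + i) ` {..<2 * n}"
      by (cases "i < r") (auto intro!: image_eqI[of _ _ "i - r"])
  qed auto
  have dual: "dual_basis (r + 2 * n) c e"
    unfolding dual_basis_def
  proof (intro conjI allI impI)
    show "linear (e i)" if i: "i < r + 2 * n" for i
    proof (cases "i < r")
      case True
      show ?thesis
        by (rule linearI) (use True in \<open>simp_all add: e_def linear_add[OF linear_proj] linear_scale[OF linear_proj]
            representation_add[OF B(2) projB projB] representation_scale[OF B(2) projB]\<close>)
    next
      case False
      then have "linear (eV (i - r))" using i dual_basisD(1)[OF dual_V] by simp
      from linear_compose[OF linear_f this] show ?thesis
        using False by (simp add: e_def[abs_def] comp_def)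
    qed
    show "e i (c j) = (if i = j then 1 else 0)" if i: "i < r + 2 * n" and j: "j < r + 2 * n" for i j
    proof -
      have 1: "proj (h j) = h j" if "j < r" for j
        using fh[OF that] by (simp add: proj_def linear_0[OF linear_s])
      have 2: "representation B (h j) (h i) = (if i = j then 1 else 0)" if "i < r" "j < r" for i j
        using representation_basis[OF B(2) hB[OF that(2)]] h that
        by (auto simp: r_def bij_betw_def inj_on_eq_iff)
      have 3: "representation B 0 = (\<lambda>_. 0)" by (rule representation_zero)
      show ?thesis
        using i j dual_basisD(2)[OF dual_V, of "i - r" "j - r"] dual_basisD(1)[OF dual_V, of "i - r"]
        by (auto simp: e_def c_def 1 2 3 proj_s f_s fh linear_0)
    qed
    show "x = (\<Sum>i<r + 2 * n. e i x *\<^sub>R c i)" for x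
    proof -
      have "(\<Sum>i<r. e i x *\<^sub>R c i) = (\<Sum>i<r. representation B (proj x) (h i) *\<^sub>R h i)"
        by (simp add: e_def c_def)
      also have "\<dots> = (\<Sum>w\<in>B. representation B (proj x) w *\<^sub>R w)"
        using sum.reindex_bij_betw[OF h] by (simp add: r_def lessThan_atLeast0)
      also have "\<dots> = proj x"
        by (rule sum_representation_eq[OF B(2) projB B(1) order_refl])
      finally have 1: "(\<Sum>i<r. e i x *\<^sub>R c i) = proj x" .
      have "(\<Sum>i\<in>(\<lambda>i. r + i) ` {..<2 * n}. e i x *\<^sub>R c i) = (\<Sum>i<2 * n. eV i (f x) *\<^sub>R s (bV i))"
        by (subst sum.reindex) (auto simp: e_def c_def)
      also have "\<dots> = s (\<Sum>i<2 * n. eV i (f x) *\<^sub>R bV i)"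
        by (simp add: linear_sum[OF linear_s] linear_scale[OF linear_s])
      also have "\<dots> = s (f x)" using dual_basisD(3)[OF dual_V, of "f x"] by simp
      finally have 2: "(\<Sum>i\<in>(\<lambda>i. r + i) ` {..<2 * n}. e i x *\<^sub>R c i) = s (f x)" .
      have "(\<Sum>i<r + 2 * n. e i x *\<^sub>R c i) = proj x + s (f x)"
        unfolding split using 1 2 by (subst sum.union_disjoint) auto
      then show ?thesis by (simp add: proj_def)
    qed
  qed
  \<comment> \<open>The size of the adapted basis must be \<open>2 * N\<close> before
    \<open>X\<close> can be treated as a top form for it.\<close>
  have rN: "r + 2 * n = 2 * N" by (rule dual_basis_size_unique[OF dual dual_U])
  have sc: "stretch (c i) = (if i < r then 1 else 2) *\<^sub>R c i" for i
    by (simp add: stretch_def c_def fh linear_0[OF linear_s] f_s scaleR_2)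
  have "2 ^ d * X c = X (\<lambda>i. (if i < r then 1 else 2) *\<^sub>R c i)"
    unfolding st[symmetric] pullback_def sc ..
  also have "\<dots> = (\<Prod>i<2 * N. if i < r then 1 else 2) * X c"
    using alt_forms_scale_args[OF X, of "\<lambda>i. if i < r then 1 else 2" c] by simp
  also have "(\<Prod>i<2 * N. if i < r then 1 else (2::real)) = 2 ^ (2 * n)"
  proof -
    have "(\<Prod>i\<in>{..<r} \<union> (\<lambda>i. r + i) ` {..<2 * n}. if i < r then 1 else (2::real))
        = (\<Prod>i<r. if i < r then 1 else 2) * (\<Prod>i\<in>(\<lambda>i. r + i) ` {..<2 * n}. if i < r then 1 else 2)"
      by (rule prod.union_disjoint) auto
    also have "\<dots> = 2 ^ (2 * n)" by (subst prod.reindex) auto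
    finally show ?thesis unfolding rN[symmetric] split .
  qed
  finally have "X c = 0" using d by simp
  then show ?thesis using top_form_eq_0[OF dual[unfolded rN] X] by simp
qed

text \<open>The weights \<open>k\<close> of \<open>X\<close> and \<open>r\<close> of the pulled back
  form add up, while a nonzero top form has weight \<open>2 * n\<close>.\<close>

lemma fiber_integral_zero:
  fixes X :: "(nat \<Rightarrow> 'u) \<Rightarrow> real"
  assumes X: "X \<in> alt_forms p" and st: "\<And>x. pullback stretch X x = 2 ^ k * X x"
    and u: "u \<in> alt_forms r" and pr: "p + r = 2 * N" and ne: "k + r \<noteq> 2 * n"
  shows "wedge p r X (pullback f u) bU = 0"
proof (rule top_form_stretch[OF _ _ ne])
  show "wedge p r X (pullback f u) \<in> alt_forms (2 * N)"
    using wedge_in_alt_forms[OF X pullback_in_alt_forms[OF linear_f u]] pr by simp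
  have "pullback stretch X = (\<lambda>x. 2 ^ k * X x)" using st by (rule ext)
  then show "pullback stretch (wedge p r X (pullback f u)) x = 2 ^ (k + r) * wedge p r X (pullback f u) x" for x
    unfolding pullback_wedge pullback_stretch_f[OF u] by (simp add: wedge_scale_left wedge_scale_right power_add)
qed

text \<open>Every top form on the target is a multiple of one rational form \<open>vol\<close>, so
  \<open>C\<close> is found by testing against \<open>vol\<close> alone.\<close>

lemma fiber_integral_top:
  assumes X: "X \<in> rational_forms p Lh" and p: "p + 2 * n = 2 * N"
  obtains C where "C \<in> \<rat>" "\<And>u. u \<in> alt_forms (2 * n) \<Longrightarrow> wedge p (2 * n) X (pullback f u) bU = C * u bV"
proof -
  obtain vol where vol: "vol \<in> alt_forms (2 * n)" "vol bV = 1" "vol \<in> rational_forms (2 * n) L"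
    by (rule top_form_exists[OF dual_V]) (use lattice_V in blast)
  let ?C = "wedge p (2 * n) X (pullback f vol) bU"
  show ?thesis
  proof (rule that[of ?C])
    have w: "wedge p (2 * n) X (pullback f vol) \<in> rational_forms (2 * N) Lh"
      using rational_forms_wedge[OF X rational_pullback_f[OF vol(3)]] p by simp
    \<comment> \<open>Rationality is stated for sequences lying entirely in the lattice; beyond
      \<open>2 * N\<close> the values of \<open>bU\<close> are unspecified and are replaced by
      0.\<close>
    have "wedge p (2 * n) X (pullback f vol) (\<lambda>i. if i < 2 * N then bU i else 0) \<in> \<rat>"
      using lattice_basis_in_lattice[OF lattice_U] lattice_basis_zero[OF lattice_U]
      by (intro rational_formsD(2)[OF w]) auto
    also have "wedge p (2 * n) X (pullback f vol) (\<lambda>i. if i < 2 * N then bU i else 0) = ?C"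
      by (rule alt_forms_cong[OF rational_formsD(1)[OF w]]) simp
    finally show "?C \<in> \<rat>" .
    fix u :: "(nat \<Rightarrow> 'v) \<Rightarrow> real" assume u: "u \<in> alt_forms (2 * n)"
    have z: "(\<lambda>x. u x - u bV * vol x) = (\<lambda>x. 0)"
      by (rule top_form_eq_0[OF dual_V diff_in_alt_forms[OF u scale_in_alt_forms[OF vol(1)]]]) (simp add: vol(2))
    have "u x = u bV * vol x" for x using fun_cong[OF z, of x] by simp
    then have "pullback f u = (\<lambda>x. u bV * pullback f vol x)"
      unfolding pullback_def by (rule ext)
    then show "wedge p (2 * n) X (pullback f u) bU = ?C * u bV"
      by (simp add: wedge_scale_right mult.commute)
  qed
qed

lemma fiber_integral:
  assumes X: "X \<in> rational_forms p Lh" and st: "pullback stretch X = X"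
  obtains C where "C \<in> \<rat>" "\<And>r u. u \<in> alt_forms r \<Longrightarrow> p + r = 2 * N \<Longrightarrow>
    wedge p r X (pullback f u) bU = (if r = 2 * n then C * u bV else 0)"
proof -
  have z: "wedge p r X (pullback f u) bU = 0" if "u \<in> alt_forms r" "p + r = 2 * N" "r \<noteq> 2 * n" for r u
    using fiber_integral_zero[OF rational_formsD(1)[OF X], of 0 u r] st that by simp
  show ?thesis
  proof (cases "p + 2 * n = 2 * N")
    case True
    obtain C where "C \<in> \<rat>" "\<And>u. u \<in> alt_forms (2 * n) \<Longrightarrow> wedge p (2 * n) X (pullback f u) bU = C * u bV"
      by (rule fiber_integral_top[OF X True]) auto
    then show ?thesis using z by (intro that[of C]) auto
  next
    case False
    \<comment> \<open>Here the degrees never allow \<open>r = 2 * n\<close>, so the constant is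
      arbitrary.\<close>
    then show ?thesis using z by (intro that[of 0]) auto
  qed
qed

lemma pullback_s_hodge:
  assumes "D \<in> hodge_classes 1 Jh Lh"
  shows "pullback s D \<in> hodge_classes 1 J L"
proof -
  have D: "D \<in> rational_forms 2 Lh" "\<And>x. D (\<lambda>i. Jh (x i)) = D x"
    using assms hodge_classes_1_iff[OF dual_U Jh] by auto
  have "pullback s D (\<lambda>i. J (x i)) = pullback s D x" for x
    using D(2)[of "\<lambda>i. s (x i)"] by (simp add: pullback_def s_J)
  then show ?thesis
    using rational_pullback_s[OF D(1)] hodge_classes_1_iff[OF dual_V J] by blast
qed

lemma orthogonal_decomposition:
  fixes D :: "(nat \<Rightarrow> 'u) \<Rightarrow> real"
  assumes D: "D \<in> alt_forms 2" and orth: "\<And>x v. f x = 0 \<Longrightarrow> D (pair x (s v)) = 0"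
  shows "D = (\<lambda>x. pullback proj D x + pullback f (pullback s D) x)"
proof
  fix x :: "nat \<Rightarrow> 'u"
  note bil = bilinear_pair[OF D]
  have x: "x i = proj (x i) + s (f (x i))" for i by (simp add: proj_def)
  have "D x = D (pair (proj (x 0) + s (f (x 0))) (proj (x 1) + s (f (x 1))))"
    using alt_forms_2_pair[OF D, of x] x by simp
  also have "\<dots> = D (pair (proj (x 0)) (proj (x 1))) + D (pair (s (f (x 0))) (s (f (x 1))))"
    using orth[OF f_proj] pair_swap[OF D, of "s (f (x 0))" "proj (x 1)"]
    by (simp add: bilinear_ladd[OF bil] bilinear_radd[OF bil])
  also have "\<dots> = pullback proj D x + pullback f (pullback s D) x"
    using alt_forms_2_pair[OF D, of "\<lambda>i. proj (x i)"] alt_forms_2_pair[OF D, of "\<lambda>i. s (f (x i))"]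
    by (simp add: pullback_def)
  finally show "D x = pullback proj D x + pullback f (pullback s D) x" .
qed

text \<open>Each term of the mixed part takes one argument along the kernel and one along the image
  of \<open>s\<close>; its weight is therefore 1.\<close>

lemma mixed_part_stretch:
  fixes D :: "(nat \<Rightarrow> 'u) \<Rightarrow> real"
  assumes D: "D \<in> alt_forms 2"
  shows "pullback stretch (\<lambda>x. D x - pullback proj D x - pullback f (pullback s D) x) x
    = 2 * (D x - pullback proj D x - pullback f (pullback s D) x)"
proof -
  note bil = bilinear_pair[OF D]
  define M where "M x = D x - pullback proj D x - pullback f (pullback s D) x" for x
  have M: "M x = D (pair (proj (x 0)) (s (f (x 1)))) + D (pair (s (f (x 0))) (proj (x 1)))" for x
  proof -
    have x: "x i = proj (x i) + s (f (x i))" for i by (simp add: proj_def)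
    have "D x = D (pair (proj (x 0) + s (f (x 0))) (proj (x 1) + s (f (x 1))))"
      using alt_forms_2_pair[OF D, of x] x by simp
    then show ?thesis
      using alt_forms_2_pair[OF D, of "\<lambda>i. proj (x i)"] alt_forms_2_pair[OF D, of "\<lambda>i. s (f (x i))"]
      by (simp add: M_def pullback_def bilinear_ladd[OF bil] bilinear_radd[OF bil])
  qed
  have "pullback stretch M x = 2 * M x"
    unfolding pullback_def M
    by (simp add: proj_stretch f_stretch linear_scale[OF linear_s] bilinear_lmul[OF bil] bilinear_rmul[OF bil])
  then show ?thesis unfolding M_def .
qed

text \<open>In the summand with \<open>j\<close> factors along the kernel and
  \<open>i = M - j\<close> pulled back factors, the kernel part of \<open>D\<close> survives exactly
  if \<open>i = n - q\<close>, and the pulled back part exactly if \<open>i + 1 = n - q\<close>. The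
  integrals along the fibre become the constants.\<close>

lemma push_divisor:
  assumes om: "\<omega> \<in> hodge_classes 1 Jh Lh" and orth: "\<And>x v. f x = 0 \<Longrightarrow> \<omega> (pair x (s v)) = 0"
    and q: "q \<le> n" "q + 1 \<le> N" and D: "D \<in> hodge_classes 1 Jh Lh"
  obtains c1 c2 where "c1 \<in> \<rat>" "c2 \<in> \<rat>" "q = n \<longrightarrow> c2 = 0"
    "push_rel q (wedge (2 * (N - q - 1)) 2 (wedge_power 2 \<omega> (N - q - 1)) D)
      (\<lambda>x. c1 * wedge_power 2 (pullback s \<omega>) (n - q) x
        + c2 * wedge 2 (2 * (n - q - 1)) (pullback s D) (wedge_power 2 (pullback s \<omega>) (n - q - 1)) x)"
proof -
  define M where "M = N - q - 1"
  have rom: "\<omega> \<in> rational_forms 2 Lh" and rD: "D \<in> rational_forms 2 Lh"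
    using om D hodge_classes_1_iff[OF dual_U Jh] by auto
  define a where "a = pullback s \<omega>"
  define k where "k = pullback proj \<omega>"
  define D1 where "D1 = pullback proj D"
  define DA where "DA = pullback s D"
  define D2 where "D2 x = D x - D1 x - pullback f DA x" for x
  have ra: "a \<in> rational_forms 2 L" and rDA: "DA \<in> rational_forms 2 L"
    and rk: "k \<in> rational_forms 2 Lh" and rD1: "D1 \<in> rational_forms 2 Lh"
    unfolding a_def DA_def k_def D1_def by (intro rational_pullback_s rational_pullback_proj rom rD)+
  have rD2: "D2 \<in> rational_forms 2 Lh"
    unfolding D2_def by (intro rational_forms_diff rD rD1 rational_pullback_f rDA)
  note rkp = rational_forms_wedge_power[OF rk]
  note kp = rational_formsD(1)[OF rkp]
  note ap = wedge_power_in_alt_forms[OF rational_formsD(1)[OF ra]]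
  note alt = rational_formsD(1)[OF rDA] rational_formsD(1)[OF rD1] rational_formsD(1)[OF rD2]
  have st_k: "pullback stretch (wedge_power 2 k j) = wedge_power 2 k j" for j
    unfolding pullback_wedge_power by (simp add: k_def pullback_stretch_proj)
  have st_D1: "pullback stretch D1 = D1" by (simp add: D1_def pullback_stretch_proj)
  have st_D2: "pullback stretch D2 x = 2 * D2 x" for x
    using mixed_part_stretch[OF rational_formsD(1)[OF rD]] by (simp add: D2_def[abs_def] D1_def DA_def)
  have "\<exists>C. C \<in> \<rat> \<and> (\<forall>r u. u \<in> alt_forms r \<longrightarrow> 2 * j + 2 + r = 2 * N \<longrightarrow>
    wedge (2 * j + 2) r (wedge (2 * j) 2 (wedge_power 2 k j) D1) (pullback f u) bU = (if r = 2 * n then C * u bV else 0))" for j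
    using fiber_integral[OF rational_forms_wedge[OF rkp[of j] rD1]]
    unfolding pullback_wedge st_k st_D1 by metis
  then obtain C where C: "\<And>j. C j \<in> \<rat>" "\<And>j r u. u \<in> alt_forms r \<Longrightarrow> 2 * j + 2 + r = 2 * N \<Longrightarrow>
    wedge (2 * j + 2) r (wedge (2 * j) 2 (wedge_power 2 k j) D1) (pullback f u) bU = (if r = 2 * n then C j * u bV else 0)"
    by metis
  have "\<exists>C. C \<in> \<rat> \<and> (\<forall>r u. u \<in> alt_forms r \<longrightarrow> 2 * j + r = 2 * N \<longrightarrow>
    wedge (2 * j) r (wedge_power 2 k j) (pullback f u) bU = (if r = 2 * n then C * u bV else 0))" for j
    using fiber_integral[OF rkp[of j] st_k] by metis
  then obtain C' where C': "\<And>j. C' j \<in> \<rat>" "\<And>j r u. u \<in> alt_forms r \<Longrightarrow> 2 * j + r = 2 * N \<Longrightarrow>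
    wedge (2 * j) r (wedge_power 2 k j) (pullback f u) bU = (if r = 2 * n then C' j * u bV else 0)"
    by metis
  \<comment> \<open>At most one \<open>j\<close> contributes to each sum, and none does when the
    required exponent exceeds \<open>M\<close>.\<close>
  define c1 where "c1 = (\<Sum>j\<le>M. real (M choose j) * (if M - j = n - q then C j else 0))"
  define c2 where "c2 = (\<Sum>j\<le>M. real (M choose j) * (if M - j + 1 = n - q then C' j else 0))"
  have rel: "wedge (2 * (n - q)) (2 * q) (\<lambda>x. c1 * wedge_power 2 a (n - q) x
      + c2 * wedge 2 (2 * (n - q - 1)) DA (wedge_power 2 a (n - q - 1)) x) u bV
    = wedge (2 * (N - q)) (2 * q) (wedge (2 * M) 2 (wedge_power 2 \<omega> M) D) (pullback f u) bU"
    if u: "u \<in> alt_forms (2 * q)" for u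
  proof -
    note fu = pullback_in_alt_forms[OF linear_f u]
    define Z1 where "Z1 = wedge (2 * (n - q)) (2 * q) (wedge_power 2 a (n - q)) u bV"
    define Z2 where "Z2 = wedge (2 * (n - q)) (2 * q) (wedge 2 (2 * (n - q - 1)) DA (wedge_power 2 a (n - q - 1))) u bV"
    have D_eq: "D = (\<lambda>x. (D1 x + D2 x) + pullback f DA x)" by (simp add: D2_def)
    have om_eq: "\<omega> = (\<lambda>x. k x + pullback f a x)"
      unfolding k_def a_def by (rule orthogonal_decomposition[OF rational_formsD(1)[OF rom] orth])
    have fa: "pullback f a \<in> alt_forms 2"
      by (rule pullback_in_alt_forms[OF linear_f rational_formsD(1)[OF ra]])
    have summand: "wedge (2 * (N - q)) (2 * q) (wedge (2 * M) 2
        (wedge (2 * j) (2 * (M - j)) (wedge_power 2 k j) (wedge_power 2 (pullback f a) (M - j))) D) (pullback f u) bU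
      = (if M - j = n - q then C j else 0) * Z1 + (if M - j + 1 = n - q then C' j else 0) * Z2"
      if j: "j \<le> M" for j
    proof -
      define i where "i = M - j"
      have e1: "2 * (N - q) = 2 * j + 2 * i + 2" and e2: "2 * M = 2 * j + 2 * i" and e3: "j + i + 1 + q = N"
        using j q by (auto simp: i_def M_def)
      let ?K = "wedge_power 2 k j"
      let ?A = "wedge_power 2 a i"
      let ?w = "\<lambda>E. wedge (2 * j + 2) (2 * i + 2 * q) (wedge (2 * j) 2 ?K E) (pullback f (wedge (2 * i) (2 * q) ?A u)) bU"
      note Au = wedge_in_alt_forms[OF ap[of i] u]
      have ex: "wedge (2 * j + 2 * i + 2) (2 * q) (wedge (2 * j + 2 * i) 2
          (wedge (2 * j) (2 * i) ?K (pullback f ?A)) E) (pullback f u) bU = ?w E"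
        if "E \<in> alt_forms 2" for E
        unfolding wedge_exchange[OF kp pullback_in_alt_forms[OF linear_f ap] that fu] pullback_wedge ..
      have w1: "?w D1 = (if M - j = n - q then C j else 0) * Z1"
      proof -
        have "?w D1 = (if 2 * i + 2 * q = 2 * n then C j * wedge (2 * i) (2 * q) ?A u bV else 0)"
          using e3 by (intro C(2)[OF Au]) simp
        also have "2 * i + 2 * q = 2 * n \<longleftrightarrow> i = n - q" using q by auto
        finally show ?thesis by (simp add: Z1_def i_def)
      qed
      \<comment> \<open>A matter of parity: the mixed part has weight 1, everything else in the
        product has even weight, and the weight of a top form is even.\<close>
      have w2: "?w D2 = 0"
      proof (rule fiber_integral_zero[OF wedge_in_alt_forms[OF kp alt(3)] _ Au])
        have "pullback stretch D2 = (\<lambda>x. 2 * D2 x)" using st_D2 by (rule ext)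
        then show "pullback stretch (wedge (2 * j) 2 ?K D2) x = 2 ^ 1 * wedge (2 * j) 2 ?K D2 x" for x
          unfolding pullback_wedge st_k by (simp add: wedge_scale_right)
        show "2 * j + 2 + (2 * i + 2 * q) = 2 * N" using e3 by simp
        show "1 + (2 * i + 2 * q) \<noteq> 2 * n" by presburger
      qed
      have w3: "?w (pullback f DA) = (if M - j + 1 = n - q then C' j else 0) * Z2"
      proof -
        let ?R = "wedge 2 (2 * i + 2 * q) DA (wedge (2 * i) (2 * q) ?A u)"
        have "?w (pullback f DA) = wedge (2 * j) (2 + (2 * i + 2 * q)) ?K (pullback f ?R) bU"
          using wedge_assoc[OF kp pullback_in_alt_forms[OF linear_f alt(1)] pullback_in_alt_forms[OF linear_f Au]]
          by (simp add: pullback_wedge)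
        also have "\<dots> = (if 2 + (2 * i + 2 * q) = 2 * n then C' j * ?R bV else 0)"
          using e3 by (intro C'(2)[OF wedge_in_alt_forms[OF alt(1) Au]]) simp
        also have "?R = wedge (2 + 2 * i) (2 * q) (wedge 2 (2 * i) DA ?A) u"
          by (rule wedge_assoc[OF alt(1) ap u, symmetric])
        also have "2 + (2 * i + 2 * q) = 2 * n \<longleftrightarrow> i + 1 = n - q" using q by auto
        also have "(if i + 1 = n - q then C' j * wedge (2 + 2 * i) (2 * q) (wedge 2 (2 * i) DA ?A) u bV else 0)
            = (if M - j + 1 = n - q then C' j else 0) * Z2"
        proof (cases "i + 1 = n - q")
          case True
          then have e: "2 + 2 * i = 2 * (n - q)" and i: "i = n - q - 1" by auto
          have "wedge (2 + 2 * i) (2 * q) (wedge 2 (2 * i) DA ?A) u bV = Z2"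
            unfolding Z2_def e unfolding i ..
          then show ?thesis using True by (simp flip: i_def)
        next
          case False
          then show ?thesis by (simp flip: i_def)
        qed
        finally show ?thesis .
      qed
      have "wedge (2 * j + 2 * i + 2) (2 * q) (wedge (2 * j + 2 * i) 2
          (wedge (2 * j) (2 * i) ?K (pullback f ?A)) D) (pullback f u) bU = ?w D1 + ?w D2 + ?w (pullback f DA)"
        by (subst D_eq) (simp only: wedge_add_right wedge_add_left ex[OF alt(2)] ex[OF alt(3)]
            ex[OF pullback_in_alt_forms[OF linear_f alt(1)]])
      then show ?thesis
        unfolding w1 w2 w3 unfolding e1 e2 pullback_wedge_power i_def[symmetric] by simp
    qed
    have pow: "wedge_power 2 \<omega> M = (\<lambda>x. \<Sum>j\<le>M. real (M choose j) *
        wedge (2 * j) (2 * (M - j)) (wedge_power 2 k j) (wedge_power 2 (pullback f a) (M - j)) x)"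
      by (subst om_eq) (rule ext, rule wedge_power_add[OF rational_formsD(1)[OF rk] fa])
    have "wedge (2 * (N - q)) (2 * q) (wedge (2 * M) 2 (wedge_power 2 \<omega> M) D) (pullback f u) bU
      = (\<Sum>j\<le>M. real (M choose j) * ((if M - j = n - q then C j else 0) * Z1 + (if M - j + 1 = n - q then C' j else 0) * Z2))"
      unfolding pow wedge_sum_left wedge_scale_left by (intro sum.cong refl) (simp add: summand)
    also have "\<dots> = c1 * Z1 + c2 * Z2"
      unfolding c1_def c2_def sum_distrib_right sum.distrib[symmetric] by (intro sum.cong refl) (simp add: algebra_simps)
    finally show ?thesis
      by (simp add: wedge_add_left wedge_scale_left Z1_def Z2_def)
  qed
  \<comment> \<open>For \<open>q = n\<close> the exponent \<open>n - q - 1\<close> is truncated and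
    the second term would have the wrong degree; its coefficient vanishes because
    \<open>M - j + 1\<close> is positive.\<close>
  have c2_0: "q = n \<longrightarrow> c2 = 0"
    unfolding c2_def by (auto intro!: sum.neutral)
  show ?thesis
  proof (rule that[of c1 c2])
    show "c1 \<in> \<rat>" "c2 \<in> \<rat>"
      unfolding c1_def c2_def using C(1) C'(1) by (auto intro!: Rats_sum Rats_mult)
    show "q = n \<longrightarrow> c2 = 0" by (fact c2_0)
    let ?g = "\<lambda>x. c1 * wedge_power 2 a (n - q) x + c2 * wedge 2 (2 * (n - q - 1)) DA (wedge_power 2 a (n - q - 1)) x"
    have "?g \<in> alt_forms (2 * (n - q))"
    proof (cases "q = n")
      case True
      then show ?thesis using c2_0 scale_in_alt_forms[OF ap[of "n - q"], of c1] by simp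
    next
      case False
      then have "2 + 2 * (n - q - 1) = 2 * (n - q)" using q by auto
      then have "wedge 2 (2 * (n - q - 1)) DA (wedge_power 2 a (n - q - 1)) \<in> alt_forms (2 * (n - q))"
        using wedge_in_alt_forms[OF alt(1) ap[of "n - q - 1"]] by simp
      then show ?thesis by (intro add_in_alt_forms scale_in_alt_forms ap)
    qed
    then show "push_rel q (wedge (2 * (N - q - 1)) 2 (wedge_power 2 \<omega> (N - q - 1)) D)
      (\<lambda>x. c1 * wedge_power 2 (pullback s \<omega>) (n - q) x
        + c2 * wedge 2 (2 * (n - q - 1)) (pullback s D) (wedge_power 2 (pullback s \<omega>) (n - q - 1)) x)"
      unfolding push_rel_def using rel by (simp add: a_def DA_def M_def)
  qed
qed

end

section \<open>Pushforward of divisors\<close>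

lemma divisor_products_combination:
  assumes a: "a \<in> hodge_classes 1 J L" and b: "b \<in> hodge_classes 1 J L"
    and c: "c1 \<in> \<rat>" "c2 \<in> \<rat>" "m = 0 \<longrightarrow> c2 = 0"
  shows "(\<lambda>x. c1 * wedge_power 2 a m x + c2 * wedge 2 (2 * (m - 1)) b (wedge_power 2 a (m - 1)) x)
    \<in> divisor_products m J L"
proof -
  have scale: "(\<lambda>x. c * \<alpha> x) \<in> divisor_products m J L" if al: "\<alpha> \<in> divisor_products m J L" and cc: "c \<in> \<rat>" for c \<alpha>
  proof -
    obtain r where "c = real_of_rat r" using cc by (rule Rats_cases)
    then show ?thesis using al rat_space.span_scale unfolding divisor_products_def by blast
  qed
  have gen: "wedge_list 2 Ds \<in> divisor_products m J L" if "length Ds = m" "set Ds \<subseteq> hodge_classes 1 J L" for Ds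
    unfolding divisor_products_def using that by (intro rat_space.span_base) blast
  have rep: "set (replicate l a) \<subseteq> hodge_classes 1 J L" for l
    using a by (auto dest: in_set_replicate[THEN iffD1])
  have 1: "wedge_power 2 a m \<in> divisor_products m J L"
    unfolding wedge_power_def by (rule gen) (simp_all only: length_replicate rep)
  show ?thesis
  proof (cases "m = 0")
    case True
    then show ?thesis using scale[OF 1 c(1)] c(3) by simp
  next
    case False
    have "wedge_list 2 (b # replicate (m - 1) a) \<in> divisor_products m J L"
      using False b rep[of "m - 1"] by (intro gen) auto
    then have 2: "wedge 2 (2 * (m - 1)) b (wedge_power 2 a (m - 1)) \<in> divisor_products m J L"
      by (simp add: wedge_power_def)
    show ?thesis
      using rat_space.span_add[OF scale[OF 1 c(1), unfolded divisor_products_def] scale[OF 2 c(2), unfolded divisor_products_def]]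
      by (simp add: divisor_products_def plus_fun_def)
  qed
qed

lemma polarization_in_hodge_classes:
  fixes J :: "'v::real_vector \<Rightarrow> 'v" and b :: "nat \<Rightarrow> 'v"
  assumes b: "dual_basis d b e" and J: "complex_structure J" and E: "polarization J L E"
  shows "(\<lambda>x. E (x 0) (x 1)) \<in> hodge_classes 1 J L"
proof -
  have "(\<lambda>x. E (x 0) (x 1)) \<in> alt_forms 2"
    using E by (intro alt_forms_2I) (auto simp: polarization_def)
  moreover have "E x y \<in> \<rat>" if "x \<in> L" "y \<in> L" for x y
    using E that Ints_subset_Rats unfolding polarization_def by blast
  ultimately have "(\<lambda>x. E (x 0) (x 1)) \<in> rational_forms 2 L"
    by (simp add: rational_forms_def)
  moreover have "E (J x) (J y) = E x y" for x y
    using E unfolding polarization_def by blast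
  ultimately show ?thesis
    unfolding hodge_classes_1_iff[OF b J] by simp
qed

lemma dim_hodge_classes_1:
  fixes J :: "'v::real_vector \<Rightarrow> 'v" and b :: "nat \<Rightarrow> 'v"
  assumes b: "dual_basis d b e" and L: "lattice_basis d L b"
  obtains B where "finite B" "card B = rat_space.dim (hodge_classes 1 J L)"
    "B \<subseteq> hodge_classes 1 J L" "hodge_classes 1 J L \<subseteq> rat_space.span B"
proof -
  obtain W :: "((nat \<Rightarrow> 'v) \<Rightarrow> real) set" where W: "finite W" "rational_forms 2 L \<subseteq> rat_space.span W"
    using rational_2_forms_finite_span[OF b L] by blast
  obtain B where B: "B \<subseteq> hodge_classes 1 J L" "rat_space.independent B"
    "hodge_classes 1 J L \<subseteq> rat_space.span B" "card B = rat_space.dim (hodge_classes 1 J L)"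
    by (rule rat_space.basis_exists[of "hodge_classes 1 J L"])
  have "hodge_classes 1 J L \<subseteq> rational_forms 2 L"
    by (auto simp: hodge_classes_def)
  then have "finite B"
    using rat_space.independent_span_bound[OF W(1) B(2)] B(1) W(2) by blast
  then show ?thesis using that B by blast
qed

context lattice_surjection
begin

lemma n_le_N: "n \<le> N"
proof -
  have "range f = f ` span (bU ` {..<2 * N})" by (simp add: span_U)
  also have "\<dots> = span (f ` bU ` {..<2 * N})" by (rule linear_span_image[OF linear_f, symmetric])
  finally have "span (f ` bU ` {..<2 * N}) = UNIV" using surj_f by simp
  then have "card (bV ` {..<2 * n}) \<le> card (f ` bU ` {..<2 * N})"
    using independent_span_bound[of "f ` bU ` {..<2 * N}" "bV ` {..<2 * n}"] lattice_V
    by (auto simp: lattice_basis_def)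
  also have "\<dots> \<le> 2 * N"
    using card_image_le[of "{..<2 * N}" "f \<circ> bU"] by (simp add: image_comp)
  finally show ?thesis using lattice_V by (simp add: lattice_basis_def card_image)
qed

text \<open>The order of quantifiers matters: \<open>a\<close> depends on \<open>\<omega>\<close>
  only and serves all \<open>D\<close> at once. This confines the image to that of a single linear
  map.\<close>

lemma push_definite:
  assumes om: "\<omega> \<in> hodge_classes 1 Jh Lh" and def: "\<And>u. u \<noteq> 0 \<Longrightarrow> \<omega> (pair u (Jh u)) \<noteq> 0"
    and q: "q \<le> n" "q + 1 \<le> N"
  shows "\<exists>a\<in>hodge_classes 1 J L. \<forall>D\<in>hodge_classes 1 Jh Lh.
    \<exists>b\<in>hodge_classes 1 J L. \<exists>c1\<in>\<rat>. \<exists>c2\<in>\<rat>. (n - q = 0 \<longrightarrow> c2 = 0) \<and>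
      push_rel q (wedge (2 * (N - q - 1)) 2 (wedge_power 2 \<omega> (N - q - 1)) D)
      (\<lambda>x. c1 * wedge_power 2 a (n - q) x + c2 * wedge 2 (2 * (n - q - 1)) b (wedge_power 2 a (n - q - 1)) x)"
proof -
  obtain s where s: "linear s" "\<And>v. f (s v) = v" "\<And>v. s (J v) = Jh (s v)"
    "\<And>v i. v \<in> L \<Longrightarrow> i < 2 * N \<Longrightarrow> eU i (s v) \<in> \<rat>" "\<And>x v. f x = 0 \<Longrightarrow> \<omega> (pair x (s v)) = 0"
    by (rule orthogonal_section_exists[OF om def]) auto
  interpret split_surjection N n Jh Lh bU eU J L bV eV f s
    by (intro split_surjection.intro lattice_surjection_axioms split_surjection_axioms.intro s(1-4))
  show ?thesis
  proof (rule bexI[of _ "pullback s \<omega>"], rule ballI)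
    show "pullback s \<omega> \<in> hodge_classes 1 J L" by (rule pullback_s_hodge[OF om])
    fix D assume D: "D \<in> hodge_classes 1 Jh Lh"
    obtain c1 c2 where c: "c1 \<in> \<rat>" "c2 \<in> \<rat>" "q = n \<longrightarrow> c2 = 0"
      "push_rel q (wedge (2 * (N - q - 1)) 2 (wedge_power 2 \<omega> (N - q - 1)) D)
      (\<lambda>x. c1 * wedge_power 2 (pullback s \<omega>) (n - q) x
        + c2 * wedge 2 (2 * (n - q - 1)) (pullback s D) (wedge_power 2 (pullback s \<omega>) (n - q - 1)) x)"
      by (rule push_divisor[OF om s(5) q D])
    have "n - q = 0 \<longrightarrow> c2 = 0" using c(3) q(1) by auto
    then show "\<exists>b\<in>hodge_classes 1 J L. \<exists>c1\<in>\<rat>. \<exists>c2\<in>\<rat>. (n - q = 0 \<longrightarrow> c2 = 0) \<and>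
      push_rel q (wedge (2 * (N - q - 1)) 2 (wedge_power 2 \<omega> (N - q - 1)) D)
      (\<lambda>x. c1 * wedge_power 2 (pullback s \<omega>) (n - q) x
        + c2 * wedge 2 (2 * (n - q - 1)) b (wedge_power 2 (pullback s \<omega>) (n - q - 1)) x)"
      by (intro bexI[of _ "pullback s D"] bexI[of _ c1] bexI[of _ c2] conjI)
        (assumption | rule c pullback_s_hodge[OF D])+
  qed
qed

lemma definite_perturbation:
  assumes om: "\<omega> \<in> hodge_classes 1 Jh Lh" and E: "polarization Jh Lh E"
  obtains T :: nat where "\<And>t u. t \<ge> T \<Longrightarrow> u \<noteq> 0 \<Longrightarrow> real t * E u (Jh u) + \<omega> (pair u (Jh u)) \<noteq> 0"
proof -
  have E': "bilinear E" "\<And>x y. E x (Jh y) = E y (Jh x)" "\<And>x. x \<noteq> 0 \<Longrightarrow> E x (Jh x) > 0"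
    using E by (auto simp: polarization_def)
  have alt: "\<omega> \<in> alt_forms 2" and inv: "\<And>x. \<omega> (\<lambda>i. Jh (x i)) = \<omega> x"
    using om hodge_classes_1_iff[OF dual_U Jh] rational_formsD(1) by auto
  have bil: "bilinear (\<lambda>x y. F x (Jh y))" if "bilinear F" for F :: "'u \<Rightarrow> 'u \<Rightarrow> real"
    using that linear_compose[OF linear_Jh] unfolding bilinear_def comp_def by blast
  have sym: "\<omega> (pair x (Jh y)) = \<omega> (pair y (Jh x))" for x y
  proof -
    have "\<omega> (pair x (Jh y)) = \<omega> (pair (Jh x) (Jh (Jh y)))"
      using inv[of "pair x (Jh y)"] alt_forms_2_pair[OF alt, of "\<lambda>i. Jh (pair x (Jh y) i)"]
      by (simp add: pair_def)
    then show ?thesis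
      using pair_swap[OF alt, of y "Jh x"] bilinear_rneg[OF bilinear_pair[OF alt]] by (simp add: Jh_Jh)
  qed
  obtain C where C: "\<And>u. \<bar>\<omega> (pair u (Jh u))\<bar> \<le> C * E u (Jh u)"
    using definite_form_dominates[OF bil[OF E'(1)] E'(2,3) _ bil[OF bilinear_pair[OF alt]] sym,
        of "bU ` {..<2 * N}"] span_U by auto
  \<comment> \<open>Any multiple beyond the domination constant \<open>C\<close> outweighs
    \<open>\<omega>\<close>, with strict inequality by positivity of \<open>E\<close>.\<close>
  obtain T :: nat where T: "C < real T" using reals_Archimedean2 by blast
  show ?thesis
  proof (rule that[of T])
    fix t :: nat and u assume "t \<ge> T" "u \<noteq> (0 :: 'u)"
    then have "C * E u (Jh u) < real t * E u (Jh u)"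
      using T E'(3)[of u] by (intro mult_strict_right_mono) auto
    then show "real t * E u (Jh u) + \<omega> (pair u (Jh u)) \<noteq> 0"
      using C[of u] by linarith
  qed
qed

lemma push_in_divisor_products:
  assumes om: "\<omega> \<in> hodge_classes 1 Jh Lh" and E: "polarization Jh Lh E"
    and q: "q \<le> n" "q + 1 \<le> N" and D: "D \<in> hodge_classes 1 Jh Lh"
  obtains \<gamma> where "\<gamma> \<in> divisor_products (n - q) J L"
    "push_rel q (wedge (2 * (N - q - 1)) 2 (wedge_power 2 \<omega> (N - q - 1)) D) \<gamma>"
proof -
  define M where "M = N - q - 1"
  define \<epsilon> where "\<epsilon> x = E (x 0) (x 1)" for x :: "nat \<Rightarrow> 'u"
  \<comment> \<open>Membership in \<open>S\<close> includes the existence of a pushforward, so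
    interpolation yields existence for the original \<open>\<omega>\<close> too.\<close>
  define S where "S = {\<beta>. \<exists>\<gamma>\<in>divisor_products (n - q) J L. push_rel q \<beta> \<gamma>}"
  have S: "rat_space.subspace S"
    unfolding rat_space.subspace_def
  proof (intro conjI ballI allI)
    show "0 \<in> S"
      using push_rel_zero rat_space.span_zero unfolding S_def divisor_products_def by (auto simp: zero_fun_def)
    show "\<beta> + \<beta>' \<in> S" if be: "\<beta> \<in> S" "\<beta>' \<in> S" for \<beta> \<beta>'
    proof -
      obtain \<gamma> \<gamma>' where g: "\<gamma> \<in> divisor_products (n - q) J L" "push_rel q \<beta> \<gamma>"
        "\<gamma>' \<in> divisor_products (n - q) J L" "push_rel q \<beta>' \<gamma>'"
        using be by (auto simp: S_def)
      then have "\<gamma> + \<gamma>' \<in> divisor_products (n - q) J L"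
        unfolding divisor_products_def by (intro rat_space.span_add)
      moreover have "push_rel q (\<beta> + \<beta>') (\<gamma> + \<gamma>')"
        using push_rel_add[OF g(2,4)] by (simp add: plus_fun_def)
      ultimately show ?thesis unfolding S_def by blast
    qed
    show "(\<lambda>x. real_of_rat c * \<beta> x) \<in> S" if be: "\<beta> \<in> S" for c \<beta>
    proof -
      obtain \<gamma> where g: "\<gamma> \<in> divisor_products (n - q) J L" "push_rel q \<beta> \<gamma>"
        using be by (auto simp: S_def)
      then have "(\<lambda>x. real_of_rat c * \<gamma> x) \<in> divisor_products (n - q) J L"
        unfolding divisor_products_def by (intro rat_space.span_scale)
      then show ?thesis using push_rel_scale[OF g(2)] unfolding S_def by blast
    qed
  qed
  obtain T :: nat where T: "\<And>t u. t \<ge> T \<Longrightarrow> u \<noteq> 0 \<Longrightarrow> real t * E u (Jh u) + \<omega> (pair u (Jh u)) \<noteq> 0"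
    by (rule definite_perturbation[OF om E]) blast
  have eps: "\<epsilon> \<in> hodge_classes 1 Jh Lh"
    using polarization_in_hodge_classes[OF dual_U Jh E] by (simp add: \<epsilon>_def[abs_def])
  have alt: "\<epsilon> \<in> alt_forms 2" "\<omega> \<in> alt_forms 2"
    using eps om hodge_classes_1_iff[OF dual_U Jh] rational_formsD(1) by auto
  \<comment> \<open>The coefficient of \<open>t ^ i\<close> after expanding the power of
    \<open>t \<epsilon> + \<omega>\<close>: the index \<open>i\<close> counts the factors
    \<open>\<epsilon>\<close>.\<close>
  define c where "c i x = real (M choose i) *
    wedge (2 * M) 2 (wedge (2 * i) (2 * (M - i)) (wedge_power 2 \<epsilon> i) (wedge_power 2 \<omega> (M - i))) D x" for i x
  have "(\<lambda>x. \<Sum>i\<le>M. real t ^ i * c i x) \<in> S" if t: "t \<ge> T" for t :: nat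
  proof -
    let ?\<omega> = "\<lambda>x. real t * \<epsilon> x + \<omega> x"
    have "(\<lambda>x. real_of_rat (of_nat t) * \<epsilon> x) + \<omega> \<in> hodge_classes 1 Jh Lh"
      by (intro rat_space.subspace_add[OF subspace_hodge_classes] rat_space.subspace_scale[OF subspace_hodge_classes] eps om)
    then have omt: "?\<omega> \<in> hodge_classes 1 Jh Lh" by (simp add: plus_fun_def)
    have deft: "?\<omega> (pair u (Jh u)) \<noteq> 0" if "u \<noteq> 0" for u
      using T[OF t that] by (simp add: \<epsilon>_def pair_def)
    obtain a where a: "a \<in> hodge_classes 1 J L"
      "\<forall>D\<in>hodge_classes 1 Jh Lh. \<exists>b\<in>hodge_classes 1 J L. \<exists>c1\<in>\<rat>. \<exists>c2\<in>\<rat>. (n - q = 0 \<longrightarrow> c2 = 0) \<and>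
        push_rel q (wedge (2 * (N - q - 1)) 2 (wedge_power 2 ?\<omega> (N - q - 1)) D)
        (\<lambda>x. c1 * wedge_power 2 a (n - q) x + c2 * wedge 2 (2 * (n - q - 1)) b (wedge_power 2 a (n - q - 1)) x)"
      using push_definite[OF omt deft q] by (rule bexE)
    obtain b c1 c2 where bc: "b \<in> hodge_classes 1 J L" "c1 \<in> \<rat>" "c2 \<in> \<rat>" "n - q = 0 \<longrightarrow> c2 = 0"
      "push_rel q (wedge (2 * (N - q - 1)) 2 (wedge_power 2 ?\<omega> (N - q - 1)) D)
        (\<lambda>x. c1 * wedge_power 2 a (n - q) x + c2 * wedge 2 (2 * (n - q - 1)) b (wedge_power 2 a (n - q - 1)) x)"
      using bspec[OF a(2) D] by (elim bexE conjE) (rule that)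
    have "wedge (2 * M) 2 (wedge_power 2 ?\<omega> M) D \<in> S"
      unfolding S_def M_def using divisor_products_combination[OF a(1) bc(1-4)] bc(5) by blast
    also have "wedge (2 * M) 2 (wedge_power 2 ?\<omega> M) D = (\<lambda>x. \<Sum>i\<le>M. real t ^ i * c i x)"
    proof -
      have pow: "wedge_power 2 ?\<omega> M = (\<lambda>x. \<Sum>i\<le>M. real (M choose i) *
          (real t ^ i * wedge (2 * i) (2 * (M - i)) (wedge_power 2 \<epsilon> i) (wedge_power 2 \<omega> (M - i)) x))"
        by (rule ext) (simp only: wedge_power_add[OF scale_in_alt_forms[OF alt(1)] alt(2)] wedge_power_scale wedge_scale_left)
      show ?thesis
        unfolding pow wedge_sum_left wedge_scale_left c_def
        by (intro ext sum.cong refl mult.left_commute)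
    qed
    finally show ?thesis .
  qed
  then have "c 0 \<in> S"
    by (rule polynomial_coefficients_in_subspace[OF S]) simp_all
  moreover have "c 0 = wedge (2 * M) 2 (wedge_power 2 \<omega> M) D"
  proof -
    have "wedge 0 (2 * M) (\<lambda>x. 1) (wedge_power 2 \<omega> M) = wedge_power 2 \<omega> M"
      by (rule ext) (simp add: wedge_0_left[OF const_in_alt_forms wedge_power_in_alt_forms[OF alt(2)]])
    then show ?thesis by (simp add: c_def[abs_def] wedge_power_0)
  qed
  ultimately have "wedge (2 * M) 2 (wedge_power 2 \<omega> M) D \<in> S" by simp
  then obtain \<gamma> where "\<gamma> \<in> divisor_products (n - q) J L"
    "push_rel q (wedge (2 * M) 2 (wedge_power 2 \<omega> M) D) \<gamma>"
    unfolding S_def by (elim CollectE bexE)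
  then show ?thesis unfolding M_def by (rule that)
qed

text \<open>Discharges the definite description once a pushforward has been exhibited;
  \<open>n \<le> N\<close> keeps the truncated degrees of \<open>gysin\<close> meaningful.\<close>

lemma push_map_eq:
  assumes IV: "\<And>\<alpha>. torus_integral n J L \<alpha> = \<alpha> bV" and IU: "\<And>\<alpha>. torus_integral N Jh Lh \<alpha> = \<alpha> bU"
    and q: "q \<le> n" and g: "push_rel q (wedge (2 * (N - q - 1)) 2 (wedge_power 2 \<omega> (N - q - 1)) D) \<gamma>"
  shows "push_map N Jh Lh n J L f q \<omega> D = \<gamma>"
proof -
  have e1: "2 * (N - q) - 2 * (N - n) = 2 * (n - q)" and e2: "2 * N - 2 * (N - q) = 2 * q"
    using q n_le_N by auto
  show ?thesis
    unfolding push_map_def gysin_def e1 e2 IV IU push_rel_def[symmetric]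
    using g by (intro the_equality push_rel_unique[OF q])
qed

text \<open>Stated for any map \<open>F\<close> that agrees with the pushforward, so that the
  dimension count involves no integrals.\<close>

lemma dim_push_image_le:
  assumes om: "\<omega> \<in> hodge_classes 1 Jh Lh" and def: "\<And>u. u \<noteq> 0 \<Longrightarrow> \<omega> (pair u (Jh u)) \<noteq> 0"
    and q: "q \<le> n" "q + 1 \<le> N" and n: "n > 0" and E: "polarization J L E"
    and F: "\<And>D \<gamma>. push_rel q (wedge (2 * (N - q - 1)) 2 (wedge_power 2 \<omega> (N - q - 1)) D) \<gamma> \<Longrightarrow> F D = \<gamma>"
  shows "rat_space.dim (F ` hodge_classes 1 Jh Lh) \<le> rat_space.dim (hodge_classes 1 J L)"
proof -
  let ?H = "hodge_classes 1 J L"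
  obtain B where B: "finite B" "card B = rat_space.dim ?H" "B \<subseteq> ?H" "?H \<subseteq> rat_space.span B"
    by (rule dim_hodge_classes_1[OF dual_V lattice_V])
  obtain a where a: "a \<in> ?H"
    "\<forall>D\<in>hodge_classes 1 Jh Lh. \<exists>b\<in>?H. \<exists>c1\<in>\<rat>. \<exists>c2\<in>\<rat>. (n - q = 0 \<longrightarrow> c2 = 0) \<and>
      push_rel q (wedge (2 * (N - q - 1)) 2 (wedge_power 2 \<omega> (N - q - 1)) D)
      (\<lambda>x. c1 * wedge_power 2 a (n - q) x + c2 * wedge 2 (2 * (n - q - 1)) b (wedge_power 2 a (n - q - 1)) x)"
    using push_definite[OF om def q] by (rule bexE)
  have formula: "\<exists>b\<in>?H. \<exists>c1\<in>\<rat>. \<exists>c2\<in>\<rat>. (n - q = 0 \<longrightarrow> c2 = 0) \<and>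
      F D = (\<lambda>x. c1 * wedge_power 2 a (n - q) x + c2 * wedge 2 (2 * (n - q - 1)) b (wedge_power 2 a (n - q - 1)) x)"
    if D: "D \<in> hodge_classes 1 Jh Lh" for D
    using bspec[OF a(2) D] by (elim bexE conjE) (intro bexI conjI F; assumption)
  show ?thesis
  proof (cases "n - q = 0")
    case True
    have "F D \<in> rat_space.span {\<lambda>x. 1}" if D: "D \<in> hodge_classes 1 Jh Lh" for D
    proof -
      obtain b c1 c2 where c: "c1 \<in> \<rat>" "c2 = 0" 
        "F D = (\<lambda>x. c1 * wedge_power 2 a (n - q) x + c2 * wedge 2 (2 * (n - q - 1)) b (wedge_power 2 a (n - q - 1)) x)"
        using formula[OF D] True by blast
      obtain r where "c1 = real_of_rat r" using c(1) by (rule Rats_cases)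
      then have "F D = (\<lambda>x. real_of_rat r * (\<lambda>x. 1) x)" using c(2,3) True by (simp add: wedge_power_0)
      moreover have "(\<lambda>x. real_of_rat r * (\<lambda>x. 1) x) \<in> rat_space.span {\<lambda>x :: nat \<Rightarrow> 'v. 1 :: real}"
        by (intro rat_space.span_scale rat_space.span_base) simp
      ultimately show ?thesis by simp
    qed
    then have "rat_space.dim (F ` hodge_classes 1 Jh Lh) \<le> card {\<lambda>x :: nat \<Rightarrow> 'v. 1 :: real}"
      by (intro rat_space.dim_le_card) auto
    \<comment> \<open>The constants have dimension 1, so one nonzero class on the target suffices;
      the polarization is one, as it is positive on \<open>bV 0\<close> and
      \<open>J (bV 0)\<close>.\<close>
    also have "\<dots> \<le> card B"
    proof -
      have "bV 0 \<noteq> 0"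
        using dual_basisD(2)[OF dual_V, of 0 0] linear_0[OF dual_basisD(1)[OF dual_V, of 0]] n by auto
      then have "E (bV 0) (J (bV 0)) \<noteq> 0" using E by (auto simp: polarization_def)
      moreover have "E (bV 0) (J (bV 0)) = 0" if "(\<lambda>x. E (x 0) (x 1)) = (0 :: (nat \<Rightarrow> 'v) \<Rightarrow> real)"
        using fun_cong[OF that, of "pair (bV 0) (J (bV 0))"] by (simp add: pair_def)
      ultimately have "(\<lambda>x. E (x 0) (x 1)) \<noteq> (0 :: (nat \<Rightarrow> 'v) \<Rightarrow> real)" by blast
      then have "B \<noteq> {}"
        using polarization_in_hodge_classes[OF dual_V J E] B(4) by (auto simp: rat_space.span_empty)
      then show ?thesis using B(1) by (simp add: Suc_leI card_gt_0_iff)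
    qed
    finally show ?thesis using B(2) by simp
  next
    case False
    \<comment> \<open>A linear map on the (1,1) classes of the target that does not depend on
      \<open>D\<close>; the image of a spanning set under it has at most as many elements.\<close>
    define \<Psi> where "\<Psi> \<beta> = wedge 2 (2 * (n - q - 1)) \<beta> (wedge_power 2 a (n - q - 1))" for \<beta>
    have psi: "\<Psi> \<beta> \<in> rat_space.span (\<Psi> ` B)" if "\<beta> \<in> rat_space.span B" for \<beta>
      using that
    proof (induction rule: rat_space.span_induct)
      case base
      have "\<Psi> 0 = 0" by (simp add: \<Psi>_def zero_fun_def wedge_zero_left)
      moreover have "\<Psi> (\<beta> + \<beta>') = \<Psi> \<beta> + \<Psi> \<beta>'" for \<beta> \<beta>'
        by (simp add: \<Psi>_def plus_fun_def wedge_add_left)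
      moreover have "\<Psi> (\<lambda>x. real_of_rat c * \<beta> x) = (\<lambda>x. real_of_rat c * \<Psi> \<beta> x)" for c \<beta>
        by (simp add: \<Psi>_def wedge_scale_left)
      ultimately show ?case
        by (auto simp: rat_space.subspace_def intro: rat_space.span_zero rat_space.span_add rat_space.span_scale)
    next
      case (step \<beta>)
      then show ?case by (intro rat_space.span_base) auto
    qed
    have "F D \<in> rat_space.span (\<Psi> ` B)" if D: "D \<in> hodge_classes 1 Jh Lh" for D
    proof -
      obtain b c1 c2 where c: "b \<in> ?H" "c1 \<in> \<rat>" "c2 \<in> \<rat>"
        "F D = (\<lambda>x. c1 * wedge_power 2 a (n - q) x + c2 * wedge 2 (2 * (n - q - 1)) b (wedge_power 2 a (n - q - 1)) x)"
        using formula[OF D] by blast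
      obtain r1 r2 where r: "c1 = real_of_rat r1" "c2 = real_of_rat r2"
        using c(2,3) by (metis Rats_cases)
      \<comment> \<open>The pure power of \<open>a\<close> is itself \<open>\<Psi> a\<close>, so
        both terms of the formula lie in the range of \<open>\<Psi>\<close>.\<close>
      have "Suc (n - q - 1) = n - q" using False by simp
      then have "wedge_power 2 a (n - q) = \<Psi> a"
        using wedge_power_Suc[of 2 a "n - q - 1"] by (simp add: \<Psi>_def)
      then have "F D = \<Psi> (\<lambda>x. real_of_rat r1 * a x + real_of_rat r2 * b x)"
        unfolding c(4) r by (simp add: \<Psi>_def wedge_add_left wedge_scale_left)
      moreover have "(\<lambda>x. real_of_rat r1 * a x) + (\<lambda>x. real_of_rat r2 * b x) \<in> rat_space.span B"
        using a(1) c(1) B(4) by (intro rat_space.span_add rat_space.span_scale) auto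
      ultimately show ?thesis using psi by (simp add: plus_fun_def)
    qed
    then have "rat_space.dim (F ` hodge_classes 1 Jh Lh) \<le> card (\<Psi> ` B)"
      using B(1) by (intro rat_space.dim_le_card) auto
    also have "\<dots> \<le> card B" by (rule card_image_le[OF B(1)])
    finally show ?thesis using B(2) by simp
  qed
qed

end

theorem theorem1p1:
  fixes Jhat :: "'u::real_vector \<Rightarrow> 'u" and Lhat :: "'u set"
    and J :: "'v::real_vector \<Rightarrow> 'v" and L :: "'v set"
    and \<pi> :: "'u set \<Rightarrow> 'v set" and f :: "'u \<Rightarrow> 'v"
    and \<omega> :: "(nat \<Rightarrow> 'u) \<Rightarrow> real"
    and N n q :: nat
  assumes "abelian_variety N Jhat Lhat"
    and "abelian_variety n J L"
    and "abelian_hom Jhat Lhat J L \<pi> f"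
    and "\<pi> ` torus Lhat = torus L"
    and "\<omega> \<in> hodge_classes 1 Jhat Lhat"
    and "1 \<le> q" and "q \<le> n" and "q + 1 \<le> N"
  shows "((\<forall>u. u \<noteq> 0 \<longrightarrow> \<omega> (\<lambda>i. if i = 0 then u else Jhat u) \<noteq> 0) \<longrightarrow>
            rat_space.dim (push_map N Jhat Lhat n J L f q \<omega> ` hodge_classes 1 Jhat Lhat)
              \<le> rat_space.dim (hodge_classes 1 J L)) \<and>
         push_map N Jhat Lhat n J L f q \<omega> ` hodge_classes 1 Jhat Lhat
           \<subseteq> fun_space.span (divisor_products (n - q) J L) \<and>
         push_map N Jhat Lhat n J L f q \<omega> \<in>
           hodge_classes 1 Jhat Lhat \<rightarrow> hodge_classes (n - q) J L \<and>
         (rat_space.dim (hodge_classes (n - q) J L) > rat_space.dim (divisor_products (n - q) J L) \<longrightarrow>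
            push_map N Jhat Lhat n J L f q \<omega> ` hodge_classes 1 Jhat Lhat
              \<noteq> hodge_classes (n - q) J L)"
proof -
  have pos: "N > 0" "n > 0" using assms(6-8) by auto
  obtain bU eU where U: "lattice_basis (2 * N) Lhat bU" "dual_basis (2 * N) bU eU"
    "\<And>\<alpha>. torus_integral N Jhat Lhat \<alpha> = \<alpha> bU"
    by (rule torus_integral_basis[OF assms(1) pos(1)]) blast
  obtain bV eV where V: "lattice_basis (2 * n) L bV" "dual_basis (2 * n) bV eV"
    "\<And>\<alpha>. torus_integral n J L \<alpha> = \<alpha> bV"
    by (rule torus_integral_basis[OF assms(2) pos(2)]) blast
  obtain Ehat where Ehat: "polarization Jhat Lhat Ehat"
    using assms(1) unfolding abelian_variety_def by blast
  obtain E where E: "polarization J L E"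
    using assms(2) unfolding abelian_variety_def by blast
  interpret lattice_surjection N n Jhat Lhat bU eU J L bV eV f
  proof (rule lattice_surjection.intro)
    show "complex_structure Jhat" "complex_structure J"
      using assms(1,2) by (auto simp: abelian_variety_def)
    show "linear f" "f ` Lhat \<subseteq> L" "\<And>x. f (Jhat x) = J (f x)"
      using assms(3) by (auto simp: abelian_hom_def)
    show "surj f" by (rule abelian_hom_surj[OF assms(3,4) V(1)])
  qed (fact U V)+
  let ?H = "hodge_classes 1 Jhat Lhat"
  let ?push = "push_map N Jhat Lhat n J L f q \<omega>"
  note push_eq = push_map_eq[OF V(3) U(3) assms(7)]
  \<comment> \<open>Stronger than the asserted inclusion in the real span: the image lies in the
    rational span, which also gives the remaining claims.\<close>
  have sub: "?push ` ?H \<subseteq> divisor_products (n - q) J L"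
  proof
    fix \<gamma> assume "\<gamma> \<in> ?push ` ?H"
    then obtain D where D: "D \<in> ?H" "\<gamma> = ?push D" by (rule imageE)
    obtain \<gamma>' where "\<gamma>' \<in> divisor_products (n - q) J L"
      "push_rel q (wedge (2 * (N - q - 1)) 2 (wedge_power 2 \<omega> (N - q - 1)) D) \<gamma>'"
      by (rule push_in_divisor_products[OF assms(5) Ehat assms(7,8) D(1)])
    then show "\<gamma> \<in> divisor_products (n - q) J L"
      using push_eq D(2) by simp
  qed
  have hodge: "divisor_products (n - q) J L \<subseteq> hodge_classes (n - q) J L"
    by (rule divisor_products_subset_hodge_classes)
  have dim: "rat_space.dim (?push ` ?H) \<le> rat_space.dim (hodge_classes 1 J L)"
    if "\<forall>u. u \<noteq> 0 \<longrightarrow> \<omega> (\<lambda>i. if i = 0 then u else Jhat u) \<noteq> 0"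
  proof (rule dim_push_image_le[OF assms(5) _ assms(7,8) pos(2) E push_eq])
    show "\<omega> (pair u (Jhat u)) \<noteq> 0" if "u \<noteq> 0" for u
      using \<open>\<forall>u. u \<noteq> 0 \<longrightarrow> \<omega> (\<lambda>i. if i = 0 then u else Jhat u) \<noteq> 0\<close> that
      by (simp add: pair_def)
  qed
  have nonsurj: "?push ` ?H \<noteq> hodge_classes (n - q) J L"
    if "rat_space.dim (hodge_classes (n - q) J L) > rat_space.dim (divisor_products (n - q) J L)"
  proof
    assume "?push ` ?H = hodge_classes (n - q) J L"
    \<comment> \<open>Surjectivity would squeeze the divisor products between the image and all
      Hodge classes, so the two dimensions could not differ.\<close>
    then have "hodge_classes (n - q) J L = divisor_products (n - q) J L"
      using sub hodge by (intro equalityI) simp_all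
    then show False using that by simp
  qed
  have "?push ` ?H \<subseteq> fun_space.span (divisor_products (n - q) J L)"
    by (rule order_trans[OF sub fun_space.span_superset])
  moreover have "?push \<in> ?H \<rightarrow> hodge_classes (n - q) J L"
    using order_trans[OF sub hodge] by (rule image_subset_iff_funcset[THEN iffD1])
  ultimately show ?thesis
    using dim nonsurj by (intro conjI impI)
qed

end
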